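(* Let $Q>1$ and let $(X_0,d,\mu_0)$ and $(Y_0,d_Y,\nu_0)$ be Ahlfors $Q$-regular spaces. Let $X$ and $Y$ be the same metric spaces but equipped with the weighted measures $d\mu=w\,d\mu_0$ and $d\nu=w_Y\,d\nu_0$, where the weights $w,w_Y$ are represented pointwise by $$w(x)=\limsup_{r\to0}\frac{1}{\mu_0(B(x,r))}\int_{B(x,r)}w\,d\mu_0,\quad x\in X,\qquad w_Y(y)=\liminf_{r\to0}\frac{1}{\nu_0(B(y,r))}\int_{B(y,r)}w_Y\,d\nu_0,\quad y\in Y.$$ Let $\Omega\subset X$ be open and bounded and let $f\colon\Omega\to Y$ be injective and continuous, with $\nu(f(\Omega))<\infty$. Suppose there is a set $E\subset\Omega$ that is the union of a countable set and a set with $\sigma$-finite $\widehat{\mathcal H}$-measure, such that $h_f<\infty$ in $\Omega\setminus E$. Suppose also that $w\colon\Omega\setminus E\to(0,\infty)$ is locally bounded away from zero and $$\left(\frac{[w(\cdot)\max\{h_f(\cdot),1\}]^{Q}}{w_Y(f(\cdot))}\right)^{1/(Q-1)}\in L^1(\Omega,\mu_0).$$ Then $f\in D^1(\Omega;Y)$.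
   Context: Standing assumptions: all measures on $X$ and $Y$ are Borel regular outer measures and every ball has finite measure (also for $\mu$ and $\nu$). $B(x,r)$ denotes the open ball. A weight is a nonnegative locally integrable function. The quotient in the integrability condition is understood as $+\infty$ where its denominator is $0$ and its numerator is positive. Ahlfors $Q$-regular: $(X_0,d,\mu_0)$ is Ahlfors $Q$-regular if there is a constant $C\ge1$ with $C^{-1}r^Q\le\mu_0(B(x,r))\le Cr^Q$ for all $x\in X_0$ and $0<r<\operatorname{diam}X_0$. Dilatation: for $f\colon\Omega\to Y$, $x\in\Omega$, $r>0$, $$L_f(x,r):=\sup\{d_Y(f(y),f(x)): y\in\Omega,\ d(y,x)\le r\},\qquad l_f(x,r):=\inf\{d_Y(f(y),f(x)): y\in\Omega,\ d(y,x)\ge r\},$$ $H_f(x,r):=L_f(x,r)/l_f(x,r)$ (interpreted as $\infty$ if the denominator is zero), and $h_f(x):=\liminf_{r\to0}H_f(x,r)$. Codimension $1$ Hausdorff measure (with respect to the weighted measure $\mu$): for $A\subset X$ and $0<\rho<\infty$, $$\widehat{\mathcal H}_{\rho}(A):=\inf\Big\{\sum_j\frac{\mu(B(x_j,2r_j))}{r_j}: A\subset\bigcup_jB(x_j,r_j),\ r_j\le\rho\Big\},$$ with $j$ running over a finite or countable index set, and $\widehat{\mathcal H}(A):=\lim_{\rho\to0}\widehat{\mathcal H}_{\rho}(A)$. Curves: all curves are continuous maps from compact intervals, rectifiable and arc-length parametrized, $\gamma\colon[0,\ell_\gamma]\to X$; $\int_\gamma g\,ds:=\int_0^{\ell_\gamma}g(\gamma(s))\,ds$.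 Upper gradient and Dirichlet space: for $H\subset X$ and $f\colon H\to Y$, a Borel function $g\colon H\to[0,\infty]$ is an upper gradient of $f$ in $H$ if $d_Y(f(\gamma(0)),f(\gamma(\ell_\gamma)))\le\int_\gamma g\,ds$ for every curve $\gamma$ in $H$. For $\mu$-measurable $H$, $D^1(H;Y)$ is the set of functions $f\colon H\to Y$ having an upper gradient $g\in L^1(H)$ (with respect to $\mu$). *)

theory Defs
  imports "HOL-Analysis.Analysis"
begin

section \<open>Borel regular outer measures\<close>

text \<open>Measures are outer measures defined on all subsets of the space. Measurability and
  integrals refer to the Caratheodory sigma-algebra of the outer measure.\<close>

definition borel_regular_outer_measure :: "('a::metric_space set \<Rightarrow> ennreal) \<Rightarrow> bool" where
  "borel_regular_outer_measure \<mu> \<longleftrightarrow>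
     outer_measure_space UNIV \<mu> \<and>
     sets borel \<subseteq> lambda_system UNIV UNIV \<mu> \<and>
     (\<forall>A. \<exists>B\<in>sets borel. A \<subseteq> B \<and> \<mu> B = \<mu> A)"

definition caratheodory_measure :: "('a set \<Rightarrow> ennreal) \<Rightarrow> 'a measure" where
  "caratheodory_measure \<mu> = measure_of UNIV (lambda_system UNIV UNIV \<mu>) \<mu>"

definition finite_on_balls :: "('a::metric_space set \<Rightarrow> ennreal) \<Rightarrow> bool" where
  "finite_on_balls \<mu> \<longleftrightarrow> (\<forall>x r. \<mu> (ball x r) < \<infinity>)"

text \<open>Extended diameter: the library's \<open>diameter\<close> is real valued and meaningful only for
  bounded sets.\<close>

definition ediam :: "'a::metric_space set \<Rightarrow> ennreal" where
  "ediam S = (SUP x\<in>S. SUP y\<in>S. ennreal (dist x y))"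

definition ahlfors_regular :: "real \<Rightarrow> ('a::metric_space set \<Rightarrow> ennreal) \<Rightarrow> bool" where
  "ahlfors_regular Q \<mu> \<longleftrightarrow>
     (\<exists>C::real. C \<ge> 1 \<and>
       (\<forall>x r. 0 < r \<and> ennreal r < ediam (UNIV :: 'a set) \<longrightarrow>
          ennreal (inverse C * r powr Q) \<le> \<mu> (ball x r) \<and>
          \<mu> (ball x r) \<le> ennreal (C * r powr Q)))"

text \<open>Weights are \<open>[0,\<infinity>]\<close>-valued, since the pointwise representatives defined by upper or
  lower limits of averages may be infinite at some points.\<close>

definition weight :: "('a::metric_space set \<Rightarrow> ennreal) \<Rightarrow> ('a \<Rightarrow> ennreal) \<Rightarrow> bool" where
  "weight \<mu> w \<longleftrightarrow>
     w \<in> borel_measurable (caratheodory_measure \<mu>) \<and>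
     (\<forall>x. \<exists>r>0. (\<integral>\<^sup>+z\<in>ball x r. w z \<partial>caratheodory_measure \<mu>) < \<infinity>)"

definition weighted_measure ::
    "('a set \<Rightarrow> ennreal) \<Rightarrow> ('a \<Rightarrow> ennreal) \<Rightarrow> 'a set \<Rightarrow> ennreal" where
  "weighted_measure \<mu> w = outer_measure_of (density (caratheodory_measure \<mu>) w)"

definition average ::
    "('a::metric_space set \<Rightarrow> ennreal) \<Rightarrow> ('a \<Rightarrow> ennreal) \<Rightarrow> 'a \<Rightarrow> real \<Rightarrow> ennreal" where
  "average \<mu> w x r = (\<integral>\<^sup>+z\<in>ball x r. w z \<partial>caratheodory_measure \<mu>) / \<mu> (ball x r)"

definition L1_on :: "('a set \<Rightarrow> ennreal) \<Rightarrow> 'a set \<Rightarrow> ('a \<Rightarrow> ennreal) \<Rightarrow> bool" where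
  "L1_on \<mu> H g \<longleftrightarrow>
     g \<in> borel_measurable (restrict_space (caratheodory_measure \<mu>) H) \<and>
     (\<integral>\<^sup>+x\<in>H. g x \<partial>caratheodory_measure \<mu>) < \<infinity>"

text \<open>Powers of elements of \<open>[0,\<infinity>]\<close> with a positive exponent.\<close>

definition ennreal_powr :: "ennreal \<Rightarrow> real \<Rightarrow> ennreal" where
  "ennreal_powr a p = (if a = \<infinity> then \<infinity> else ennreal (enn2real a powr p))"


section \<open>Dilatation\<close>

definition dil_L ::
    "'a::metric_space set \<Rightarrow> ('a \<Rightarrow> 'b::metric_space) \<Rightarrow> 'a \<Rightarrow> real \<Rightarrow> ennreal" where
  "dil_L \<Omega> f x r = (SUP y\<in>{y\<in>\<Omega>. dist y x \<le> r}. ennreal (dist (f y) (f x)))"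

definition dil_l ::
    "'a::metric_space set \<Rightarrow> ('a \<Rightarrow> 'b::metric_space) \<Rightarrow> 'a \<Rightarrow> real \<Rightarrow> ennreal" where
  "dil_l \<Omega> f x r = (INF y\<in>{y\<in>\<Omega>. dist y x \<ge> r}. ennreal (dist (f y) (f x)))"

text \<open>The case distinction is needed because \<open>0 / 0 = 0\<close> in \<^typ>\<open>ennreal\<close>.\<close>

definition dil_H ::
    "'a::metric_space set \<Rightarrow> ('a \<Rightarrow> 'b::metric_space) \<Rightarrow> 'a \<Rightarrow> real \<Rightarrow> ennreal" where
  "dil_H \<Omega> f x r = (if dil_l \<Omega> f x r = 0 then \<infinity> else dil_L \<Omega> f x r / dil_l \<Omega> f x r)"

definition dil_h ::
    "'a::metric_space set \<Rightarrow> ('a \<Rightarrow> 'b::metric_space) \<Rightarrow> 'a \<Rightarrow> ennreal" where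
  "dil_h \<Omega> f x = Liminf (at_right 0) (\<lambda>r. dil_H \<Omega> f x r)"


section \<open>Codimension one Hausdorff measure\<close>

text \<open>The index set \<open>J\<close> of a cover is an arbitrary, finite or infinite, set of naturals.\<close>

definition codim1_content ::
    "('a::metric_space set \<Rightarrow> ennreal) \<Rightarrow> real \<Rightarrow> 'a set \<Rightarrow> ennreal" where
  "codim1_content \<mu> \<rho> A =
     Inf {(\<Sum>\<^sub>\<infinity>j\<in>J. \<mu> (ball (c j) (2 * r j)) / ennreal (r j)) | (J :: nat set) c r.
            (\<forall>j\<in>J. 0 < r j \<and> r j \<le> \<rho>) \<and> A \<subseteq> (\<Union>j\<in>J. ball (c j) (r j))}"

definition codim1_hausdorff :: "('a::metric_space set \<Rightarrow> ennreal) \<Rightarrow> 'a set \<Rightarrow> ennreal" where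
  "codim1_hausdorff \<mu> A = Lim (at_right 0) (\<lambda>\<rho>. codim1_content \<mu> \<rho> A)"

definition sigma_finite_codim1 :: "('a::metric_space set \<Rightarrow> ennreal) \<Rightarrow> 'a set \<Rightarrow> bool" where
  "sigma_finite_codim1 \<mu> A \<longleftrightarrow>
     (\<exists>S :: nat \<Rightarrow> 'a set. A = (\<Union>n. S n) \<and> (\<forall>n. codim1_hausdorff \<mu> (S n) < \<infinity>))"


section \<open>Curves, upper gradients and the Dirichlet space\<close>

definition curve_length :: "(real \<Rightarrow> 'a::metric_space) \<Rightarrow> real \<Rightarrow> real \<Rightarrow> ennreal" where
  "curve_length \<gamma> a b =
     (SUP ts\<in>{ts. sorted ts \<and> set ts \<subseteq> {a..b}}.
        \<Sum>i<length ts - 1. ennreal (dist (\<gamma> (ts ! i)) (\<gamma> (ts ! Suc i))))"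

text \<open>A rectifiable curve of length \<open>l\<close>, parametrized by arc length on \<open>[0,l]\<close>, with image
  in \<open>H\<close>. The case \<open>l = 0\<close> is a constant curve.\<close>

definition arc_length_curve ::
    "'a::metric_space set \<Rightarrow> (real \<Rightarrow> 'a) \<Rightarrow> real \<Rightarrow> bool" where
  "arc_length_curve H \<gamma> l \<longleftrightarrow>
     0 \<le> l \<and> continuous_on {0..l} \<gamma> \<and> \<gamma> ` {0..l} \<subseteq> H \<and>
     (\<forall>t\<in>{0..l}. curve_length \<gamma> 0 t = ennreal t)"

definition upper_gradient ::
    "'a::metric_space set \<Rightarrow> ('a \<Rightarrow> 'b::metric_space) \<Rightarrow> ('a \<Rightarrow> ennreal) \<Rightarrow> bool" where
  "upper_gradient H f g \<longleftrightarrow>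
     g \<in> borel_measurable (restrict_space borel H) \<and>
     (\<forall>\<gamma> l. arc_length_curve H \<gamma> l \<longrightarrow>
        ennreal (dist (f (\<gamma> 0)) (f (\<gamma> l))) \<le> (\<integral>\<^sup>+s\<in>{0..l}. g (\<gamma> s) \<partial>lborel))"

text \<open>Functions on \<open>H\<close> are total functions of which only the values on \<open>H\<close> matter.\<close>

definition dirichlet_space ::
    "('a::metric_space set \<Rightarrow> ennreal) \<Rightarrow> 'a set \<Rightarrow> ('a \<Rightarrow> 'b::metric_space) set" where
  "dirichlet_space \<mu> H = {f. \<exists>g. upper_gradient H f g \<and> L1_on \<mu> H g}"

end

theory Submission
  imports Defs
begin

text \<open>A point \<open>x\<close> outside \<open>E\<close> has arbitrarily small radii \<open>r\<close> for which the oscillation \<open>L\<close> of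
  \<open>f\<close> on \<open>ball x r\<close> is comparable to the radius \<open>l\<close> of a ball about \<open>f x\<close> whose preimage lies in
  \<open>ball x r\<close>. Covering by such balls, the sum of the functions \<open>L / r\<close> on \<open>ball x (2 * r)\<close>
  dominates the variation of \<open>f\<close> along every curve that is long compared with the radii. The
  regularity of both spaces and the representatives of the weights bound the \<open>\<mu>\<close>-mass of one
  summand, by Young's inequality, by \<open>T F r\<^sup>Q + T\<^bsup>1-Q\<^esup> \<nu>(ball (f x) l)\<close> for every \<open>T > 0\<close>, where \<open>F\<close>
  is the integrand of the hypothesis. The image balls overlap boundedly, so these sums are
  uniformly integrable as the radii tend to \<open>0\<close>.

  The set \<open>F = \<infinity>\<close> is null and is covered with respect to \<open>\<nu>\<^sub>0\<close> with arbitrarily small mass; so is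
  the part of \<open>E\<close> with \<open>\<sigma>\<close>-finite codimension one measure, since \<open>f\<close> oscillates little on small
  balls; countable sets have countable image along a curve. Suitable convex combinations of the
  uniformly integrable sums converge in \<open>L\<^sup>1\<close>, and a fast converging sequence has an
  integrable majorant, which is the required upper gradient.\<close>

section \<open>Majorants of uniformly integrable sequences\<close>

text \<open>An L1 limit of the sums would bound the variation of \<open>f\<close> only along almost
  every curve. The target is therefore one integrable function lying everywhere above some convex
  combination of arbitrarily fine sums: a nonconstant curve is long compared with all but finitely
  many scales, so no curve is lost.

  Origin of the exponent \<open>1 / (Q - 1)\<close>: a summand has mass of order L w r^(Q-1), where
  L is at most 2 h l. Put P = F + 1. If L / r is at most 2 T P / w, this is of order T P r^Q.
  Otherwise r is below w h l / (T P), and the mass is at most of order T^(1-Q) ((w h)^Q / P^(Q-1))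
  l^Q. Since F^(Q-1) = (w h)^Q / \<open>w\<^sub>Y\<close>, the coefficient is below the target
  weight at f x, so the image ball pays.

  Keeping T free gives uniform integrability: a large T makes the image part small, and the summands
  of bounded slope and weight are bounded in L2.

  \<open>E\<close> is an arbitrary set, so the parts of a curve are compared through the outer
  measure of their images.\<close>

inductive_set midpoint_closure :: "('a \<Rightarrow> ennreal) set \<Rightarrow> ('a \<Rightarrow> ennreal) set" for \<F> where
  base: "g \<in> \<F> \<Longrightarrow> g \<in> midpoint_closure \<F>"
| mid: "g \<in> midpoint_closure \<F> \<Longrightarrow> h \<in> midpoint_closure \<F> \<Longrightarrow>
    (\<lambda>x. (g x + h x) / 2) \<in> midpoint_closure \<F>"

lemma midpoint_closure_mono: "\<F> \<subseteq> \<G> \<Longrightarrow> g \<in> midpoint_closure \<F> \<Longrightarrow> g \<in> midpoint_closure \<G>"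
  by (rotate_tac 1, induction rule: midpoint_closure.induct) (auto intro: midpoint_closure.intros)

lemma ennreal_half_add_half: "(a::ennreal) / 2 + a / 2 = a"
  by (cases a) (auto simp: divide_ennreal[of _ 2, simplified] ennreal_plus[symmetric]
      ennreal_top_divide simp del: ennreal_plus)

lemma ennreal_midpoint_le: "a \<le> c \<Longrightarrow> b \<le> c \<Longrightarrow> (a + b) / 2 \<le> (c::ennreal)"
  by (metis add_divide_distrib_ennreal add_mono divide_right_mono_ennreal ennreal_half_add_half)

lemma ennreal_le_midpoint: "c \<le> a \<Longrightarrow> c \<le> b \<Longrightarrow> (c::ennreal) \<le> (a + b) / 2"
  by (metis add_divide_distrib_ennreal add_mono divide_right_mono_ennreal ennreal_half_add_half)

lemma nn_integral_midpoint:
  assumes "g \<in> borel_measurable M" "h \<in> borel_measurable M"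
  shows "(\<integral>\<^sup>+x. (g x + h x) / 2 \<partial>M) = ((\<integral>\<^sup>+x. g x \<partial>M) + (\<integral>\<^sup>+x. h x \<partial>M)) / 2"
  using assms by (simp add: nn_integral_divide nn_integral_add)

text \<open>The square root of exp (-t), continued by 0 at \<infinity>. Its values are real and
  bounded, so differences can be squared and integrated over a finite measure without any
  integrability of the original functions.\<close>

definition exp_half :: "ennreal \<Rightarrow> real" where
  "exp_half t = (if t = \<infinity> then 0 else exp (- enn2real t / 2))"

lemma exp_half_bounds: "0 \<le> exp_half t" "exp_half t \<le> 1"
  by (auto simp: exp_half_def)

lemma exp_half_measurable [measurable]: "exp_half \<in> borel_measurable borel"
  unfolding exp_half_def[abs_def] by measurable

text \<open>Plays the part of the parallelogram law: the mixed term of a squared difference becomes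
  the functional at the midpoint. Infinite values fit in, since both sides then vanish.\<close>

lemma exp_half_midpoint: "(exp_half ((s + t) / 2))\<^sup>2 = exp_half s * exp_half t"
proof (cases s; cases t)
  fix a b :: real
  assume *: "0 \<le> a" "s = ennreal a" "0 \<le> b" "t = ennreal b"
  then have "(s + t) / 2 = ennreal ((a + b) / 2)"
    by (simp add: divide_ennreal[of _ 2, simplified] ennreal_plus[symmetric] del: ennreal_plus)
  with * show ?thesis
    by (simp add: exp_half_def power2_eq_square exp_add[symmetric] field_simps)
qed (auto simp: exp_half_def ennreal_top_divide)

text \<open>The inverse of \<open>exp_half\<close> is Lipschitz, with constant
  \<open>2 * exp (c / 2)\<close>, only over the values \<open>t \<le> c\<close>. What exceeds
  \<open>c\<close> is charged to \<open>t - c\<close>, which uniform integrability will make small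
  in the mean.\<close>

lemma ennreal_diff_le_exp_half:
  fixes s t :: ennreal and c :: real
  assumes "0 \<le> c"
  shows "t - s \<le> ennreal (2 * exp (c / 2) * \<bar>exp_half s - exp_half t\<bar>) + (t - ennreal c)"
proof (cases "t \<le> s")
  case True
  then show ?thesis by (cases "t = \<infinity>") (auto simp: top.not_eq_extremum diff_eq_0_ennreal)
next
  case False
  then obtain a where a: "s = ennreal a" "0 \<le> a" by (cases s) auto
  have lip: "b - a \<le> 2 * exp (c / 2) * (exp (- a / 2) - exp (- b / 2))"
    if "a \<le> b" "b \<le> c" for b
  proof -
    have "1 + (b - a) / 2 \<le> exp ((b - a) / 2)" by (rule exp_ge_add_one_self)
    then have "(b - a) / 2 \<le> exp ((b - a) / 2) - 1" by linarith
    then have "(b - a) / 2 * exp (- b / 2) \<le> (exp ((b - a) / 2) - 1) * exp (- b / 2)"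
      by (intro mult_right_mono) auto
    also have "\<dots> = exp (- a / 2) - exp (- b / 2)"
      by (simp add: algebra_simps exp_add[symmetric] diff_divide_distrib)
    finally have 1: "(b - a) / 2 * exp (- b / 2) \<le> exp (- a / 2) - exp (- b / 2)" .
    have "(b - a) * exp (- b / 2) * exp (c / 2) \<ge> (b - a) * 1"
      unfolding mult.assoc exp_add[symmetric] using that by (intro mult_left_mono) auto
    moreover have "(b - a) * exp (- b / 2) * exp (c / 2) \<le>
        2 * (exp (- a / 2) - exp (- b / 2)) * exp (c / 2)"
      using 1 by (intro mult_right_mono) auto
    ultimately show ?thesis by (simp add: algebra_simps)
  qed
  have es: "exp_half s = exp (- a / 2)" using a by (simp add: exp_half_def)
  show ?thesis
  proof (cases "t \<le> ennreal c")
    case True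
    then obtain b where b: "t = ennreal b" "0 \<le> b" by (cases t) (auto simp: top_unique)
    have "b - a \<le> 2 * exp (c / 2) * \<bar>exp_half s - exp_half t\<bar>"
    proof -
      have "2 * exp (c / 2) * (exp (- a / 2) - exp (- b / 2)) \<le>
          2 * exp (c / 2) * \<bar>exp_half s - exp_half t\<bar>"
        using b es by (intro mult_left_mono) (auto simp: exp_half_def)
      moreover have "b - a \<le> 2 * exp (c / 2) * (exp (- a / 2) - exp (- b / 2))"
        using True False a b assms by (intro lip) (auto simp: ennreal_le_iff2)
      ultimately show ?thesis by (rule order_trans[rotated])
    qed
    then show ?thesis using a b
      by (auto simp: ennreal_minus intro!: add_increasing2 ennreal_leI)
  next
    case *: False
    have et: "exp_half t \<le> exp (- c / 2)"
      using * by (cases t) (auto simp: exp_half_def not_le ennreal_less_iff ennreal_le_iff2 assms)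
    show ?thesis
    proof (cases "a \<le> c")
      case True
      \<comment> \<open>The gap from \<open>s\<close> to \<open>t\<close> is cut at
        \<open>c\<close>. Up to \<open>c\<close> the Lipschitz bound applies, and replacing
        \<open>c\<close> by the larger \<open>t\<close> only increases the difference of the values
        of \<open>exp_half\<close>.\<close>
      have "t - s \<le> (t - ennreal c) + ennreal (c - a)"
        using True a * assms
        by (cases t) (auto simp: ennreal_minus ennreal_plus[symmetric] not_le ennreal_less_iff
            ennreal_le_iff2 simp del: ennreal_plus)
      also have "c - a \<le> 2 * exp (c / 2) * \<bar>exp_half s - exp_half t\<bar>"
      proof -
        have "exp (- a / 2) - exp (- c / 2) \<le> \<bar>exp_half s - exp_half t\<bar>"
          using et es by auto
        then have "2 * exp (c / 2) * (exp (- a / 2) - exp (- c / 2)) \<le>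
            2 * exp (c / 2) * \<bar>exp_half s - exp_half t\<bar>"
          by (intro mult_left_mono) auto
        then show ?thesis using lip[of c] True by linarith
      qed
      finally show ?thesis by (simp add: add.commute ennreal_leI)
    next
      case False
      then have "t - s \<le> t - ennreal c"
        using a by (intro ennreal_minus_mono) (auto intro: ennreal_leI)
      then show ?thesis by (intro add_increasing) auto
    qed
  qed
qed

text \<open>The excess over a fixed level is a convex function of the value, so uniform
  integrability, expressed through excesses, passes to all dyadic convex combinations.\<close>

lemma midpoint_closure_excess:
  assumes "g \<in> midpoint_closure \<F>" and "c \<noteq> \<infinity>"
    and "\<And>f. f \<in> \<F> \<Longrightarrow> f \<in> borel_measurable M \<and> (\<integral>\<^sup>+x. (f x - c) \<partial>M) \<le> \<eta>"
  shows "g \<in> borel_measurable M \<and> (\<integral>\<^sup>+x. (g x - c) \<partial>M) \<le> \<eta>"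
  using assms(1)
proof induction
  case (base g)
  then show ?case using assms(3) by blast
next
  case (mid g h)
  have [measurable]: "g \<in> borel_measurable M" "h \<in> borel_measurable M" using mid by auto
  have "(a + b) / 2 - c \<le> ((a - c) + (b - c)) / 2" for a b :: ennreal
  proof -
    have *: "t \<le> c + (t - c)" for t :: ennreal
      by (metis ennreal_minus_le_iff order_refl top.not_eq_extremum ennreal_top_minus)
    have "(a + b) / 2 \<le> ((c + (a - c)) + (c + (b - c))) / 2"
      by (intro divide_right_mono_ennreal add_mono *)
    also have "\<dots> = (c / 2 + c / 2) + ((a - c) + (b - c)) / 2"
      by (simp add: add_divide_distrib_ennreal ac_simps)
    finally have "(a + b) / 2 \<le> c + ((a - c) + (b - c)) / 2"
      by (simp only: ennreal_half_add_half)
    then show ?thesis using assms(2) by (simp add: ennreal_minus_le_iff)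
  qed
  then have "(\<integral>\<^sup>+x. ((g x + h x) / 2 - c) \<partial>M) \<le> (\<integral>\<^sup>+x. ((g x - c) + (h x - c)) / 2 \<partial>M)"
    by (intro nn_integral_mono) auto
  also have "\<dots> = ((\<integral>\<^sup>+x. g x - c \<partial>M) + (\<integral>\<^sup>+x. h x - c \<partial>M)) / 2"
    by (intro nn_integral_midpoint) auto
  also have "\<dots> \<le> \<eta>" using mid by (intro ennreal_midpoint_le) auto
  finally show ?case by simp
qed

text \<open>Almost minimisers of \<open>\<integral> exp (- g)\<close> over a decreasing sequence of midpoint-convex sets form a
  Cauchy sequence, because the convexity defect of \<open>exp (- t)\<close> at a midpoint is half the square
  of the difference of the values of \<open>exp_half\<close>.\<close>

lemma exp_half_Cauchy:
  fixes \<F> :: "nat \<Rightarrow> ('a \<Rightarrow> ennreal) set"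
  assumes M: "finite_measure M"
    and meas: "\<And>n g. g \<in> \<F> n \<Longrightarrow> g \<in> borel_measurable M"
    and mid: "\<And>n g h. g \<in> \<F> n \<Longrightarrow> h \<in> \<F> n \<Longrightarrow> (\<lambda>x. (g x + h x) / 2) \<in> \<F> n"
    and anti: "\<And>n m. n \<le> m \<Longrightarrow> \<F> m \<subseteq> \<F> n"
    and ne: "\<And>n. \<F> n \<noteq> {}"
  obtains h where "\<And>n. h n \<in> \<F> n"
    "\<And>\<epsilon>::real. 0 < \<epsilon> \<Longrightarrow> \<exists>n0. \<forall>n\<ge>n0. \<forall>m\<ge>n0.
       (\<integral>x. (exp_half (h n x) - exp_half (h m x))\<^sup>2 \<partial>M) < \<epsilon>"
proof -
  interpret finite_measure M by fact
  define \<Psi> where "\<Psi> g = (\<integral>x. (exp_half (g x))\<^sup>2 \<partial>M)" for g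
  define iv where "iv n = inverse (real (Suc n))" for n
  have iv: "0 < iv n" "n \<le> m \<Longrightarrow> iv m \<le> iv n" for n m
    unfolding iv_def by (auto intro!: le_imp_inverse_le)
  define d where "d n = (INF g\<in>\<F> n. \<Psi> g)" for n
  have int: "integrable M (\<lambda>x. exp_half (g x) * exp_half (h x))"
    if "g \<in> \<F> n" "h \<in> \<F> n" for g h n
  proof (rule integrable_const_bound[of _ 1])
    show "AE x in M. norm (exp_half (g x) * exp_half (h x)) \<le> 1"
      by (auto simp: exp_half_bounds abs_mult intro!: mult_le_one)
    have [measurable]: "g \<in> borel_measurable M" "h \<in> borel_measurable M" using meas that by auto
    show "(\<lambda>x. exp_half (g x) * exp_half (h x)) \<in> borel_measurable M" by measurable
  qed
  have bdd: "bdd_below (\<Psi> ` \<F> n)" for n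
    by (rule bdd_belowI[of _ 0]) (auto simp: \<Psi>_def intro!: integral_nonneg_AE)
  have dle: "d n \<le> \<Psi> g" if "g \<in> \<F> n" for n g
    unfolding d_def by (rule cINF_lower[OF bdd that])
  have dmono: "d n \<le> d m" if "n \<le> m" for n m
    unfolding d_def using anti[OF that] by (intro cINF_superset_mono ne bdd) auto
  have dbd: "d n \<le> measure M (space M)" for n
  proof -
    obtain g where g: "g \<in> \<F> n" using ne by blast
    have "\<Psi> g \<le> (\<integral>x. 1 \<partial>M)" unfolding \<Psi>_def
      using int[OF g g] by (intro integral_mono) (auto simp: power2_eq_square exp_half_bounds mult_le_one)
    with dle[OF g] show ?thesis by simp
  qed
  have "\<exists>g\<in>\<F> n. \<Psi> g < d n + iv n" for n
    using cINF_less_iff[OF ne bdd, of n "d n + iv n"] by (auto simp: d_def iv)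
  then obtain h where h: "\<And>n. h n \<in> \<F> n" "\<And>n. \<Psi> (h n) < d n + iv n"
    by metis
  have "convergent d"
    using incseq_convergent[of d "measure M (space M)"] dmono dbd
    by (metis convergentI incseq_def)
  \<comment> \<open>Since the sets shrink, \<open>h m\<close> and hence the midpoint belong to
    \<open>\<F> n\<close>, where the functional is at least \<open>d n\<close>. The infima
    \<open>d\<close> increase and are bounded, so the right-hand side tends to 0.\<close>
  have gap: "(\<integral>x. (exp_half (h n x) - exp_half (h m x))\<^sup>2 \<partial>M) \<le>
     2 * (d m - d n) + 4 * iv n" if "n \<le> m" for n m
  proof -
    have hm: "h m \<in> \<F> n" using h anti that by blast
    note hn = h(1)[of n]
    have 1: "\<Psi> (\<lambda>x. (h n x + h m x) / 2) = (\<integral>x. exp_half (h n x) * exp_half (h m x) \<partial>M)"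
      unfolding \<Psi>_def exp_half_midpoint ..
    have "(\<integral>x. (exp_half (h n x) - exp_half (h m x))\<^sup>2 \<partial>M) =
       \<Psi> (h n) + \<Psi> (h m) - 2 * (\<integral>x. exp_half (h n x) * exp_half (h m x) \<partial>M)"
      unfolding \<Psi>_def power2_diff using int[OF hn hn] int[OF hm hm] int[OF hn hm]
      by (simp add: power2_eq_square mult.assoc)
    also have "\<dots> \<le> \<Psi> (h n) + \<Psi> (h m) - 2 * d n"
      using dle[OF mid[OF hn hm]] 1 by simp
    finally have le: "(\<integral>x. (exp_half (h n x) - exp_half (h m x))\<^sup>2 \<partial>M) \<le>
        (d m - d n) + iv n + iv m"
      using h(2)[of n] h(2)[of m] by linarith
    moreover have "(d m - d n) + iv n + iv m \<le> 2 * (d m - d n) + 4 * iv n"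
      using dmono[OF that] iv(1)[of n] iv(2)[OF that] by (auto simp: algebra_simps)
    ultimately show ?thesis by (rule order_trans)
  qed
  show ?thesis
  proof
    show "h n \<in> \<F> n" for n by fact
    fix \<epsilon> :: real assume \<epsilon>: "0 < \<epsilon>"
    from \<open>convergent d\<close> have "Cauchy d" by (rule convergent_Cauchy)
    then obtain n1 where n1: "\<And>m n. m \<ge> n1 \<Longrightarrow> n \<ge> n1 \<Longrightarrow> \<bar>d m - d n\<bar> < \<epsilon> / 4"
      using \<epsilon> unfolding Cauchy_def dist_real_def by (metis divide_pos_pos zero_less_numeral)
    obtain n2 where n2: "iv n2 < \<epsilon> / 8"
      using reals_Archimedean[of "\<epsilon> / 8"] \<epsilon> by (auto simp: iv_def)
    have main: "(\<integral>x. (exp_half (h n x) - exp_half (h m x))\<^sup>2 \<partial>M) < \<epsilon>"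
      if "n \<le> m" "max n1 n2 \<le> n" for n m
    proof -
      have "iv n \<le> iv n2"
        using that iv by auto
      then have "2 * (d m - d n) + 4 * iv n < \<epsilon>"
      proof -
        have "\<bar>d m - d n\<bar> < \<epsilon> / 4" using that by (intro n1) auto
        then show ?thesis using \<open>iv n \<le> iv n2\<close> n2 by (simp only: right_diff_distrib)
      qed
      with gap[OF that(1)] show ?thesis by (rule le_less_trans)
    qed
    show "\<exists>n0. \<forall>n\<ge>n0. \<forall>m\<ge>n0. (\<integral>x. (exp_half (h n x) - exp_half (h m x))\<^sup>2 \<partial>M) < \<epsilon>"
    proof (intro exI[of _ "max n1 n2"] allI impI)
      fix n m assume nm: "max n1 n2 \<le> n" "max n1 n2 \<le> m"
      show "(\<integral>x. (exp_half (h n x) - exp_half (h m x))\<^sup>2 \<partial>M) < \<epsilon>"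
        using main[of n m] main[of m n] nm
        by (cases "n \<le> m") (auto simp: power2_commute[of "exp_half (h n _)"])
    qed
  qed
qed

text \<open>Replaces weak compactness in L1 followed by Mazur's lemma. Almost minimisers of the
  exponential functional are Cauchy after applying \<open>exp_half\<close>; uniform integrability
  upgrades this to L1; a subsequence with summable gaps is dominated by its first term plus all
  upward increments. The domination holds at every point, because null sets are visible to single
  curves.\<close>

theorem uniformly_integrable_majorant:
  fixes G :: "nat \<Rightarrow> 'a \<Rightarrow> ennreal"
  assumes M: "finite_measure M"
    and meas: "\<And>i. G i \<in> borel_measurable M"
    and ui: "\<And>\<eta>::real. 0 < \<eta> \<Longrightarrow> \<exists>c::real. 0 \<le> c \<and> (\<forall>i. (\<integral>\<^sup>+x. (G i x - ennreal c) \<partial>M) \<le> ennreal \<eta>)"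
  obtains g where "g \<in> borel_measurable M" "(\<integral>\<^sup>+x. g x \<partial>M) < \<infinity>"
    "\<And>n. \<exists>h\<in>midpoint_closure (G ` {n..}). \<forall>x. h x \<le> g x"
proof -
  interpret finite_measure M by fact
  define \<F> where "\<F> n = midpoint_closure (G ` {n..})" for n
  have excess: "g \<in> borel_measurable M \<and> (\<integral>\<^sup>+x. (g x - ennreal c) \<partial>M) \<le> ennreal \<eta>"
    if "\<forall>i. (\<integral>\<^sup>+x. (G i x - ennreal c) \<partial>M) \<le> ennreal \<eta>" "g \<in> \<F> n" for c \<eta> g n
    using that meas unfolding \<F>_def by (intro midpoint_closure_excess[of g "G ` {n..}"]) auto
  have meas': "g \<in> borel_measurable M" if "g \<in> \<F> n" for g n
  proof -
    obtain c where "\<forall>i. (\<integral>\<^sup>+x. (G i x - ennreal c) \<partial>M) \<le> ennreal 1"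
      using ui[of 1] by auto
    from excess[OF this that] show ?thesis by blast
  qed
  obtain h where h: "\<And>n. h n \<in> \<F> n" and C: "\<And>\<epsilon>::real. 0 < \<epsilon> \<Longrightarrow> \<exists>n0. \<forall>n\<ge>n0. \<forall>m\<ge>n0.
       (\<integral>x. (exp_half (h n x) - exp_half (h m x))\<^sup>2 \<partial>M) < \<epsilon>"
  proof (rule exp_half_Cauchy[OF M, of \<F>])
    show "\<F> m \<subseteq> \<F> n" if "n \<le> m" for n m
      unfolding \<F>_def using that by (auto intro!: midpoint_closure_mono[of "G ` {m..}"])
    show "\<F> n \<noteq> {}" for n unfolding \<F>_def by (auto intro: midpoint_closure.base)
  qed (auto simp: \<F>_def intro: midpoint_closure.mid meas'[unfolded \<F>_def])
  have [measurable]: "h n \<in> borel_measurable M" for n using h meas' by blast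
  have L1: "\<exists>n0. \<forall>n\<ge>n0. \<forall>m\<ge>n0. (\<integral>\<^sup>+x. (h m x - h n x) \<partial>M) \<le> ennreal \<eta>" if \<eta>: "0 < \<eta>" for \<eta> :: real
  proof -
    obtain c where c: "0 \<le> c" "\<forall>i. (\<integral>\<^sup>+x. (G i x - ennreal c) \<partial>M) \<le> ennreal (\<eta> / 3)"
      using ui[of "\<eta> / 3"] \<eta> by auto
    define D where "D = 2 * exp (c / 2)"
    define V where "V = measure M (space M) + 1"
    have "D > 0" "V > 0" by (auto simp: D_def V_def add_nonneg_pos)
    \<comment> \<open>\<open>k\<close> balances the splitting of \<bar>e\<bar> into \<open>k\<close>
      and \<open>e\<^sup>2 / k\<close>: the constant part contributes at most D V k = \<eta> / 3,
      and the Cauchy bound chosen next makes the quadratic part at most \<eta> / 3 as well. The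
      third \<eta> / 3 is the excess over \<open>c\<close>.\<close>
    define k where "k = \<eta> / (3 * D * V)"
    have "k > 0" using \<open>D > 0\<close> \<open>V > 0\<close> \<eta> by (auto simp: k_def)
    obtain n0 where n0: "\<And>n m. n \<ge> n0 \<Longrightarrow> m \<ge> n0 \<Longrightarrow>
       (\<integral>x. (exp_half (h n x) - exp_half (h m x))\<^sup>2 \<partial>M) < \<eta> * k / (3 * D)"
      using C[of "\<eta> * k / (3 * D)"] \<eta> \<open>k > 0\<close> \<open>D > 0\<close> by auto
    have "(\<integral>\<^sup>+x. (h m x - h n x) \<partial>M) \<le> ennreal \<eta>" if nm: "n \<ge> n0" "m \<ge> n0" for n m
    proof -
      define e where "e x = exp_half (h n x) - exp_half (h m x)" for x
      have [measurable]: "e \<in> borel_measurable M" unfolding e_def[abs_def] by measurable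
      have eb: "\<bar>e x\<bar> \<le> 1" for x
        using exp_half_bounds[of "h n x"] exp_half_bounds[of "h m x"] by (auto simp: e_def)
      have ie: "integrable M (\<lambda>x. (e x)\<^sup>2)"
        by (rule integrable_const_bound[of _ 1]) (auto simp: eb abs_square_le_1)
      have ab: "\<bar>e x\<bar> \<le> k + (e x)\<^sup>2 / k" for x
      proof -
        have "0 \<le> (\<bar>e x\<bar> - k)\<^sup>2 + \<bar>e x\<bar> * k" using \<open>k > 0\<close> by auto
        then show ?thesis using \<open>k > 0\<close> by (simp add: field_simps power2_eq_square)
      qed
      have "(\<integral>\<^sup>+x. (h m x - h n x) \<partial>M) \<le>
          (\<integral>\<^sup>+x. ennreal (D * (k + (e x)\<^sup>2 / k)) + (h m x - ennreal c) \<partial>M)"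
      proof (rule nn_integral_mono)
        fix x
        have "h m x - h n x \<le> ennreal (D * \<bar>e x\<bar>) + (h m x - ennreal c)"
          unfolding D_def e_def by (rule ennreal_diff_le_exp_half) fact
        also have "\<dots> \<le> ennreal (D * (k + (e x)\<^sup>2 / k)) + (h m x - ennreal c)"
          using ab[of x] \<open>D > 0\<close> by (intro add_right_mono ennreal_leI mult_left_mono) auto
        finally show "h m x - h n x \<le> ennreal (D * (k + (e x)\<^sup>2 / k)) + (h m x - ennreal c)" .
      qed
      also have "\<dots> = (\<integral>\<^sup>+x. ennreal (D * (k + (e x)\<^sup>2 / k)) \<partial>M) + (\<integral>\<^sup>+x. (h m x - ennreal c) \<partial>M)"
        by (rule nn_integral_add) auto
      also have "(\<integral>\<^sup>+x. ennreal (D * (k + (e x)\<^sup>2 / k)) \<partial>M) =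
          ennreal (\<integral>x. D * (k + (e x)\<^sup>2 / k) \<partial>M)"
        using ie \<open>D > 0\<close> \<open>k > 0\<close> by (intro nn_integral_eq_integral) auto
      also have "(\<integral>x. D * (k + (e x)\<^sup>2 / k) \<partial>M) = D * (measure M (space M) * k + (\<integral>x. (e x)\<^sup>2 \<partial>M) / k)"
        using ie by simp
      also have "\<dots> \<le> D * (V * k + (\<eta> * k / (3 * D)) / k)"
        using n0[OF nm] \<open>D > 0\<close> \<open>k > 0\<close>
        by (intro mult_left_mono add_mono divide_right_mono mult_right_mono) (auto simp: V_def e_def)
      also have "\<dots> = \<eta> / 3 + \<eta> / 3"
        using \<open>D > 0\<close> \<open>k > 0\<close> \<open>V > 0\<close> by (simp add: k_def field_simps)
      finally have "(\<integral>\<^sup>+x. (h m x - h n x) \<partial>M) \<le>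
          ennreal (\<eta> / 3 + \<eta> / 3) + (\<integral>\<^sup>+x. (h m x - ennreal c) \<partial>M)"
        by (simp add: add_right_mono ennreal_leI)
      also have "\<dots> \<le> ennreal (\<eta> / 3 + \<eta> / 3) + ennreal (\<eta> / 3)"
        using excess[OF c(2) h[of m]] by (intro add_left_mono) auto
      also have "\<dots> = ennreal \<eta>" using \<eta> by (simp add: ennreal_plus[symmetric] del: ennreal_plus)
      finally show ?thesis .
    qed
    then show ?thesis by blast
  qed
  have "\<exists>n0. \<forall>n\<ge>n0. \<forall>m\<ge>n0. (\<integral>\<^sup>+x. (h m x - h n x) \<partial>M) \<le> ennreal ((1 / 2) ^ k)" for k
    by (rule L1) auto
  then obtain N where N: "\<And>k n m. n \<ge> N k \<Longrightarrow> m \<ge> N k \<Longrightarrow>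
      (\<integral>\<^sup>+x. (h m x - h n x) \<partial>M) \<le> ennreal ((1 / 2) ^ k)" by metis
  \<comment> \<open>The cumulative sum makes two consecutive indices exceed \<open>N k\<close>, and
    the summand \<open>k\<close> keeps the n-th chosen function in the n-th tail.\<close>
  define p where "p k = k + (\<Sum>i\<le>k. N i)" for k
  have p: "p k \<ge> N k" "p (Suc k) \<ge> N k" "p k \<ge> k" for k
    using member_le_sum[of k "{..k}" N] member_le_sum[of k "{..Suc k}" N] by (auto simp: p_def)
  \<comment> \<open>Subtraction is truncated at 0, so the series collects the upward increments
    only; its partial sums already dominate each \<open>h (p n)\<close>.\<close>
  define g where "g x = h (p 0) x + (\<Sum>k. (h (p (Suc k)) x - h (p k) x))" for x
  have partial: "h (p n) x \<le> h (p 0) x + (\<Sum>k<n. (h (p (Suc k)) x - h (p k) x))" for n x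
  proof (induction n)
    case (Suc n)
    have "h (p (Suc n)) x \<le> h (p n) x + (h (p (Suc n)) x - h (p n) x)"
      by (metis ennreal_minus_le_iff order_refl top.not_eq_extremum ennreal_top_minus)
    also have "\<dots> \<le> (h (p 0) x + (\<Sum>k<n. (h (p (Suc k)) x - h (p k) x))) + (h (p (Suc n)) x - h (p n) x)"
      using Suc by (rule add_right_mono)
    finally show ?case by (simp add: add.assoc)
  qed simp
  have le: "h (p n) x \<le> g x" for n x
    unfolding g_def by (rule order_trans[OF partial]) (intro add_left_mono sum_le_suminf, auto)
  show ?thesis
  proof
    show "g \<in> borel_measurable M" unfolding g_def[abs_def] by measurable
    show "\<exists>h\<in>midpoint_closure (G ` {n..}). \<forall>x. h x \<le> g x" for n
    proof (intro bexI[of _ "h (p n)"] allI le)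
      have "h (p n) \<in> \<F> (p n)" by (rule h)
      then show "h (p n) \<in> midpoint_closure (G ` {n..})"
        unfolding \<F>_def using p(3)[of n] by (auto intro: midpoint_closure_mono[rotated])
    qed
    obtain c where c: "0 \<le> c" "\<forall>i. (\<integral>\<^sup>+x. (G i x - ennreal c) \<partial>M) \<le> ennreal 1"
      using ui[of 1] by auto
    have "(\<integral>\<^sup>+x. h (p 0) x \<partial>M) \<le> (\<integral>\<^sup>+x. ennreal c + (h (p 0) x - ennreal c) \<partial>M)"
      by (intro nn_integral_mono)
         (metis ennreal_minus_le_iff order_refl top.not_eq_extremum ennreal_top_minus)
    also have "\<dots> = ennreal c * emeasure M (space M) + (\<integral>\<^sup>+x. (h (p 0) x - ennreal c) \<partial>M)"
      by (subst nn_integral_add) auto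
    also have "\<dots> < \<infinity>"
      using excess[OF c(2) h[of "p 0"]]
      by (auto simp: ennreal_mult_less_top emeasure_eq_measure intro: le_less_trans)
    finally have 1: "(\<integral>\<^sup>+x. h (p 0) x \<partial>M) < \<infinity>" .
    have "(\<integral>\<^sup>+x. (\<Sum>k. (h (p (Suc k)) x - h (p k) x)) \<partial>M) = (\<Sum>k. \<integral>\<^sup>+x. (h (p (Suc k)) x - h (p k) x) \<partial>M)"
      by (intro nn_integral_suminf) auto
    also have "\<dots> \<le> (\<Sum>k. ennreal ((1 / 2) ^ k))"
      using p N by (intro suminf_le) auto
    also have "\<dots> < \<infinity>"
      by (subst suminf_ennreal2) (auto intro!: summable_geometric)
    finally show "(\<integral>\<^sup>+x. g x \<partial>M) < \<infinity>"
      unfolding g_def using 1 by (subst nn_integral_add) auto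
  qed
qed

section \<open>Outer measures and outer regularity\<close>

lemma
  assumes "outer_measure_space UNIV \<mu>"
  shows space_caratheodory_measure [simp]: "space (caratheodory_measure \<mu>) = UNIV"
    and sets_caratheodory_measure: "sets (caratheodory_measure \<mu>) = lambda_system UNIV UNIV \<mu>"
    and emeasure_caratheodory_measure:
      "A \<in> sets (caratheodory_measure \<mu>) \<Longrightarrow> emeasure (caratheodory_measure \<mu>) A = \<mu> A"
proof -
  interpret sigma_algebra UNIV "UNIV :: 'a set set" by (metis Pow_UNIV sigma_algebra_Pow)
  have ms: "measure_space UNIV (lambda_system UNIV UNIV \<mu>) \<mu>"
    by (rule caratheodory_lemma[OF assms])
  then have sa: "sigma_algebra UNIV (lambda_system UNIV UNIV \<mu>)"
    by (simp add: measure_space_def)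
  show "space (caratheodory_measure \<mu>) = UNIV"
    unfolding caratheodory_measure_def by (simp add: space_measure_of_conv)
  show s: "sets (caratheodory_measure \<mu>) = lambda_system UNIV UNIV \<mu>"
    unfolding caratheodory_measure_def using sigma_algebra.sets_measure_of_eq[OF sa] by simp
  show "A \<in> sets (caratheodory_measure \<mu>) \<Longrightarrow> emeasure (caratheodory_measure \<mu>) A = \<mu> A"
    unfolding s using emeasure_measure_of_sigma[OF sa, of \<mu> A] ms
    by (simp add: measure_space_def caratheodory_measure_def)
qed

lemma outer_measure_space_outer_measure_of:
  assumes "space D = UNIV"
  shows "outer_measure_space UNIV (outer_measure_of D)"
  unfolding outer_measure_space_def positive_def increasing_def countably_subadditive_def
proof (intro conjI ballI allI impI)
  show "outer_measure_of D {} = 0" by simp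
  fix A :: "nat \<Rightarrow> 'a set"
  have "\<exists>E\<in>sets D. A n \<subseteq> E \<and> outer_measure_of D (A n) = emeasure D E" for n
    using outer_measure_of_attain[of "A n" D] assms by auto
  then obtain E where E: "\<And>n. E n \<in> sets D" "\<And>n. A n \<subseteq> E n"
    "\<And>n. outer_measure_of D (A n) = emeasure D (E n)" by metis
  have "outer_measure_of D (\<Union>n. A n) \<le> outer_measure_of D (\<Union>n. E n)"
    using E by (intro outer_measure_of_mono) auto
  also have "\<dots> = emeasure D (\<Union>n. E n)" using E by (intro outer_measure_of_eq) auto
  also have "\<dots> \<le> (\<Sum>n. emeasure D (E n))" using E by (intro emeasure_subadditive_countably) auto
  finally show "outer_measure_of D (\<Union>n. A n) \<le> (\<Sum>n. outer_measure_of D (A n))" by (simp add: E)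
qed (auto intro: outer_measure_of_mono)

text \<open>Integrals against a weighted measure run over the Caratheodory sigma-algebra of an outer
  measure. This inclusion lets sets measurable for the density be used there.\<close>

lemma sets_subset_lambda_system_outer_measure_of:
  assumes "space D = UNIV"
  shows "sets D \<subseteq> lambda_system UNIV UNIV (outer_measure_of D)"
proof
  fix A assume A: "A \<in> sets D"
  have "outer_measure_of D (A \<inter> X) + outer_measure_of D ((UNIV - A) \<inter> X) = outer_measure_of D X" for X
  proof (rule antisym)
    obtain E where E: "E \<in> sets D" "X \<subseteq> E" "outer_measure_of D X = emeasure D E"
      using outer_measure_of_attain[of X D] assms by auto
    have "outer_measure_of D (A \<inter> X) + outer_measure_of D ((UNIV - A) \<inter> X) \<le>
        outer_measure_of D (A \<inter> E) + outer_measure_of D (E - A)"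
      using E by (intro add_mono outer_measure_of_mono) auto
    also have "\<dots> = emeasure D (A \<inter> E) + emeasure D (E - A)"
      using A E by (intro arg_cong2[where f = "(+)"] outer_measure_of_eq) auto
    also have "\<dots> = emeasure D E"
      using A E by (subst plus_emeasure) (auto intro!: arg_cong[where f = "emeasure D"])
    finally show "outer_measure_of D (A \<inter> X) + outer_measure_of D ((UNIV - A) \<inter> X) \<le> outer_measure_of D X"
      by (simp add: E)
    obtain E1 where E1: "E1 \<in> sets D" "A \<inter> X \<subseteq> E1" "outer_measure_of D (A \<inter> X) = emeasure D E1"
      using outer_measure_of_attain[of "A \<inter> X" D] assms by auto
    obtain E2 where E2: "E2 \<in> sets D" "(UNIV - A) \<inter> X \<subseteq> E2"
      "outer_measure_of D ((UNIV - A) \<inter> X) = emeasure D E2"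
      using outer_measure_of_attain[of "(UNIV - A) \<inter> X" D] assms by auto
    have "outer_measure_of D X \<le> outer_measure_of D (E1 \<union> E2)"
      using E1 E2 by (intro outer_measure_of_mono) auto
    also have "\<dots> = emeasure D (E1 \<union> E2)" using E1 E2 by (intro outer_measure_of_eq) auto
    also have "\<dots> \<le> emeasure D E1 + emeasure D E2" using E1 E2 by (intro emeasure_subadditive) auto
    finally show "outer_measure_of D X \<le> outer_measure_of D (A \<inter> X) + outer_measure_of D ((UNIV - A) \<inter> X)"
      by (simp add: E1 E2)
  qed
  then show "A \<in> lambda_system UNIV UNIV (outer_measure_of D)"
    by (auto simp: lambda_system_def)
qed

text \<open>The approximation has to be two-sided for the induction: complementation exchanges the
  closed and the open set. An infinite union of closed sets need not be closed, so finitely many are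
  kept and continuity from above, available for finite measures, pays for the rest.\<close>

lemma finite_borel_closed_open_approx:
  fixes M :: "'a::metric_space measure"
  assumes M: "finite_measure M" and sets: "sets M = sets borel" and B: "B \<in> sets borel"
  shows "\<forall>e>0. \<exists>F U. closed F \<and> open U \<and> F \<subseteq> B \<and> B \<subseteq> U \<and> measure M (U - F) < e"
proof -
  interpret finite_measure M by fact
  have [simp]: "A \<in> sets M" if "A \<in> sets borel" for A using that sets by simp
  have "B \<in> sigma_sets UNIV {S. open S}" using B by (simp add: borel_def)
  then show ?thesis
  proof induction
    case (Basic B)
    then have opn: "open B" by simp
    show ?case
    proof (intro allI impI)
      fix e :: real assume "0 < e"
      \<comment> \<open>The points at distance at least 1 / (n + 1) from the complement form closed
        sets exhausting an open set. The whole space is treated apart, because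
        \<open>infdist\<close> to the empty set is 0.\<close>
      define F where "F n = {x. infdist x (- B) \<ge> inverse (real (Suc n))}" for n
      have cF: "closed (F n)" for n
        unfolding F_def by (intro closed_Collect_le continuous_intros)
      show "\<exists>F U. closed F \<and> open U \<and> F \<subseteq> B \<and> B \<subseteq> U \<and> measure M (U - F) < e"
      proof (cases "B = UNIV")
        case True
        with \<open>0 < e\<close> show ?thesis by (intro exI[of _ UNIV]) auto
      next
        case False
        have FB: "F n \<subseteq> B" for n
        proof
          fix x assume "x \<in> F n"
          then have "infdist x (- B) > 0"
            unfolding F_def by (simp add: less_le_trans[of 0 "inverse (1 + real n)"])
          then show "x \<in> B" by (metis ComplI infdist_zero order_less_irrefl)
        qed
        have "(\<Inter>n. B - F n) = {}"
        proof (rule equals0I)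
          fix x assume "x \<in> (\<Inter>n. B - F n)"
          then have x: "x \<in> B" "\<forall>n. x \<notin> F n" by auto
          have "infdist x (- B) \<noteq> 0"
            using x(1) opn False in_closed_iff_infdist_zero[of "- B" x] by auto
          then have "infdist x (- B) > 0" using infdist_nonneg[of x "- B"] by simp
          then obtain n where "inverse (real (Suc n)) < infdist x (- B)"
            using reals_Archimedean by blast
          then have "x \<in> F n" by (simp add: F_def)
          with x(2) show False by blast
        qed
        moreover have "(\<lambda>n. measure M (B - F n)) \<longlonglongrightarrow> measure M (\<Inter>n. B - F n)"
        proof (rule finite_Lim_measure_decseq)
          show "range (\<lambda>n. B - F n) \<subseteq> sets M" using opn cF by (auto intro!: borel_open borel_closed sets.Diff)
          show "decseq (\<lambda>n. B - F n)"
          proof (rule decseq_SucI, rule Diff_mono, simp)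
            fix n
            have "inverse (real (Suc (Suc n))) \<le> inverse (real (Suc n))" by (intro le_imp_inverse_le) auto
            then show "F n \<subseteq> F (Suc n)" unfolding F_def by (blast intro: order_trans)
          qed
        qed
        ultimately have "(\<lambda>n. measure M (B - F n)) \<longlonglongrightarrow> 0" by (metis measure_empty)
        from LIMSEQ_D[OF this \<open>0 < e\<close>] obtain n where "measure M (B - F n) < e" by auto
        with cF FB opn show ?thesis by blast
      qed
    qed
  next
    case Empty
    show ?case
    proof (intro allI impI exI conjI)
      show "measure M ({} - {}) < e" if "0 < e" for e using that by simp
    qed auto
  next
    case (Compl B)
    show ?case
    proof (intro allI impI)
      fix e :: real assume "0 < e"
      then obtain F U where FU: "closed F" "open U" "F \<subseteq> B" "B \<subseteq> U" "measure M (U - F) < e"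
        using Compl.IH by auto
      have eq: "(- F) - (- U) = U - F" by auto
      show "\<exists>F U. closed F \<and> open U \<and> F \<subseteq> UNIV - B \<and> UNIV - B \<subseteq> U \<and> measure M (U - F) < e"
      proof (intro exI conjI)
        show "measure M ((- F) - (- U)) < e" unfolding eq by fact
      qed (use FU in auto)
    qed
  next
    case (Union B)
    show ?case
    proof (intro allI impI)
      fix e :: real assume "0 < e"
      have "\<exists>F U. closed F \<and> open U \<and> F \<subseteq> B i \<and> B i \<subseteq> U \<and> measure M (U - F) < e / 2 * (1 / 2) ^ Suc i" for i
        by (rule Union.IH[of i, rule_format]) (use \<open>0 < e\<close> in simp)
      then obtain F U where F: "\<And>i. closed (F i)" "\<And>i. F i \<subseteq> B i"
        and U: "\<And>i. open (U i)" "\<And>i. B i \<subseteq> U i"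
        and m: "\<And>i. measure M (U i - F i) < e / 2 * (1 / 2) ^ Suc i" by metis
      have [measurable]: "F i \<in> sets M" "U i \<in> sets M" for i using F U by auto
      let ?U = "\<Union>i. U i" and ?G = "\<lambda>n. \<Union>i<n. F i"
      have sm: "summable (\<lambda>i. e / 2 * (1 / 2 :: real) ^ Suc i)"
        by (intro summable_mult) (simp add: summable_Suc_iff summable_geometric)
      have "measure M (?U - (\<Union>i. F i)) \<le> measure M (\<Union>i. U i - F i)"
        by (intro finite_measure_mono) auto
      also have "\<dots> \<le> (\<Sum>i. measure M (U i - F i))"
        using m by (intro finite_measure_subadditive_countably summable_comparison_test'[OF sm, of 0])
          (auto intro: less_imp_le simp del: power_Suc)
      also have "\<dots> \<le> (\<Sum>i. e / 2 * (1 / 2 :: real) ^ Suc i)"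
        using m by (intro suminf_le summable_comparison_test'[OF sm, of 0] sm)
          (auto intro: less_imp_le simp del: power_Suc)
      also have "\<dots> = e / 2" using sums_mult[OF power_half_series, of "e / 2"] by (simp add: sums_iff)
      finally have less: "measure M (?U - (\<Union>i. F i)) < e" using \<open>0 < e\<close> by simp
      have "(\<lambda>n. measure M (?U - ?G n)) \<longlonglongrightarrow> measure M (\<Inter>n. ?U - ?G n)"
        by (rule finite_Lim_measure_decseq) (auto simp: decseq_def intro: less_le_trans)
      also have "(\<Inter>n. ?U - ?G n) = ?U - (\<Union>i. F i)" by auto
      finally have "eventually (\<lambda>n. measure M (?U - ?G n) < e) sequentially"
        using less by (rule order_tendstoD)
      then obtain n where "measure M (?U - ?G n) < e" by (auto simp: eventually_sequentially)
      then show "\<exists>F U. closed F \<and> open U \<and> F \<subseteq> (\<Union>i. B i) \<and> (\<Union>i. B i) \<subseteq> U \<and> measure M (U - F) < e"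
      proof (intro exI conjI)
        show "?G n \<subseteq> (\<Union>i. B i)" using F(2) by blast
        show "(\<Union>i. B i) \<subseteq> ?U" using U(2) by blast
      qed (use F U in auto)
    qed
  qed
qed

text \<open>The finite case is applied on balls of radius \<open>n\<close> with error e / 2^(n+1),
  and the open sets are cut down to these balls before they are united. Stating \<open>hull\<close>
  as a hypothesis covers both Borel sets and sets that are measurable only in the sense of
  Caratheodory.\<close>

lemma open_superset_measure_le:
  fixes M :: "'a::metric_space measure"
  assumes borel: "sets borel \<subseteq> sets M" and sp: "space M = UNIV"
    and fin: "\<And>x r. emeasure M (ball x r) < \<infinity>"
    and A: "A \<in> sets M" and hull: "\<exists>B\<in>sets borel. A \<subseteq> B \<and> emeasure M (B - A) = 0"
    and e: "0 < (e::real)"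
  obtains U where "open U" "A \<subseteq> U" "emeasure M (U - A) \<le> ennreal e"
proof -
  obtain B where B: "B \<in> sets borel" "A \<subseteq> B" "emeasure M (B - A) = 0" using hull by blast
  fix x0 :: 'a
  note [measurable] = A B(1)
  have [simp]: "S \<in> sets M" if "S \<in> sets borel" for S using that borel by blast
  \<comment> \<open>The density restricts \<open>M\<close> to a ball, and the image under the
    identity forgets the sets that are not Borel, since the finite case concerns measures on exactly
    the Borel sets.\<close>
  define N where "N n = distr (density M (indicator (ball x0 (real n)))) borel (\<lambda>x. x)" for n
  have id: "(\<lambda>x. x) \<in> measurable M borel" using borel sp by (auto intro!: measurableI)
  have emN: "emeasure (N n) S = emeasure M (ball x0 (real n) \<inter> S)" if "S \<in> sets borel" for n S
  proof -
    have "emeasure (N n) S = (\<integral>\<^sup>+x. indicator (ball x0 (real n)) x * indicator S x \<partial>M)"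
      using that id by (simp add: N_def emeasure_distr sp emeasure_density[OF borel_measurable_indicator])
    also have "\<dots> = (\<integral>\<^sup>+x. indicator (ball x0 (real n) \<inter> S) x \<partial>M)"
      by (simp add: indicator_inter_arith)
    finally show ?thesis using that by simp
  qed
  have finN: "finite_measure (N n)" for n
  proof (rule finite_measureI)
    have "space (N n) = UNIV" by (simp add: N_def)
    then show "emeasure (N n) (space (N n)) \<noteq> \<infinity>" using fin[of x0 "real n"] by (simp add: emN)
  qed
  have "\<exists>U. open U \<and> B \<subseteq> U \<and> measure (N n) (U - B) < e * (1 / 2) ^ Suc n" for n
  proof -
    have "0 < e * (1 / 2) ^ Suc n" using e by simp
    then obtain F U where FU: "closed F" "open U" "F \<subseteq> B" "B \<subseteq> U" "measure (N n) (U - F) < e * (1 / 2) ^ Suc n"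
      using finite_borel_closed_open_approx[OF finN[of n] _ B(1)] by (auto simp: N_def simp del: power_Suc)
    have "measure (N n) (U - B) \<le> measure (N n) (U - F)"
      using FU by (intro finite_measure.finite_measure_mono[OF finN]) (auto simp: N_def)
    with FU show ?thesis by (metis order_le_less_trans)
  qed
  then obtain U where U: "\<And>n. open (U n)" "\<And>n. B \<subseteq> U n"
    "\<And>n. measure (N n) (U n - B) < e * (1 / 2) ^ Suc n" by metis
  have mU: "emeasure M (ball x0 (real n) \<inter> (U n - B)) \<le> ennreal (e * (1 / 2) ^ Suc n)" for n
  proof -
    have "emeasure M (ball x0 (real n) \<inter> (U n - B)) = emeasure (N n) (U n - B)"
      using emN[of "U n - B" n] U(1)[of n] B(1) by auto
    also have "\<dots> = ennreal (measure (N n) (U n - B))"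
      by (rule finite_measure.emeasure_eq_measure[OF finN])
    finally show ?thesis using U(3)[of n] by (simp add: ennreal_leI less_imp_le del: power_Suc)
  qed
  let ?U = "\<Union>n. U n \<inter> ball x0 (real n)"
  show ?thesis
  proof
    show "open ?U" using U by auto
    show "A \<subseteq> ?U"
    proof
      fix x assume "x \<in> A"
      moreover obtain n :: nat where "dist x0 x < real n" using reals_Archimedean2 by blast
      ultimately show "x \<in> ?U" using B(2) U(2) by auto
    qed
    have UM: "U n \<in> sets M" for n using U(1)[of n] by auto
    have S: "ball x0 (real n) \<inter> (U n - B) \<in> sets M" for n
      by (intro sets.Int sets.Diff UM) (use B borel in auto)
    have S': "(\<Union>n. ball x0 (real n) \<inter> (U n - B)) \<in> sets M"
      by (rule sets.countable_UN) (use S in blast)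
    have BA: "B - A \<in> sets M" using A B borel by auto
    have "emeasure M (?U - A) \<le> emeasure M ((B - A) \<union> (\<Union>n. ball x0 (real n) \<inter> (U n - B)))"
      using B(2) by (intro emeasure_mono sets.Un S' BA) blast
    also have "\<dots> \<le> emeasure M (B - A) + emeasure M (\<Union>n. ball x0 (real n) \<inter> (U n - B))"
      by (intro emeasure_subadditive S' BA)
    also have "\<dots> \<le> (\<Sum>n. emeasure M (ball x0 (real n) \<inter> (U n - B)))"
      unfolding B(3) add_0 using S by (intro emeasure_subadditive_countably) blast
    also have "\<dots> \<le> (\<Sum>n. ennreal (e * (1 / 2) ^ Suc n))"
      using mU by (intro suminf_le) auto
    also have "\<dots> = ennreal e"
      using sums_mult[OF power_half_series, of e] e
      by (intro suminf_ennreal_eq) (auto simp del: power_Suc)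
    finally show "emeasure M (?U - A) \<le> ennreal e" .
  qed
qed

text \<open>Borel regularity gives hulls of equal measure, and these differ from the set by a null
  set only where the measure is finite. Hence hulls are taken of the parts in balls and then
  united.\<close>

lemma borel_hull_null:
  fixes \<mu> :: "'a::metric_space set \<Rightarrow> ennreal"
  assumes \<mu>: "borel_regular_outer_measure \<mu>" and fin: "finite_on_balls \<mu>"
    and A: "A \<in> sets (caratheodory_measure \<mu>)"
  shows "\<exists>B\<in>sets borel. A \<subseteq> B \<and> emeasure (caratheodory_measure \<mu>) (B - A) = 0"
proof -
  let ?M = "caratheodory_measure \<mu>"
  fix x0 :: 'a
  have om: "outer_measure_space UNIV \<mu>" using \<mu> by (simp add: borel_regular_outer_measure_def)
  have bor: "sets borel \<subseteq> sets ?M"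
    using \<mu> by (simp add: borel_regular_outer_measure_def sets_caratheodory_measure[OF om])
  have A': "A \<inter> ball x0 (real n) \<in> sets ?M" for n using A bor by (auto intro!: sets.Int)
  have "\<exists>B\<in>sets borel. A \<inter> ball x0 (real n) \<subseteq> B \<and> \<mu> B = \<mu> (A \<inter> ball x0 (real n))" for n
    using \<mu> by (simp add: borel_regular_outer_measure_def)
  then obtain B where B: "\<And>n. B n \<in> sets borel" "\<And>n. A \<inter> ball x0 (real n) \<subseteq> B n"
    "\<And>n. \<mu> (B n) = \<mu> (A \<inter> ball x0 (real n))" by metis
  have BM: "B n \<in> sets ?M" for n using B bor by blast
  have null: "emeasure ?M (B n - A \<inter> ball x0 (real n)) = 0" for n
  proof -
    have "emeasure ?M (A \<inter> ball x0 (real n)) \<le> emeasure ?M (ball x0 (real n))"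
      using bor by (intro emeasure_mono) auto
    also have "\<dots> < \<infinity>" using fin bor
      by (subst emeasure_caratheodory_measure[OF om]) (auto simp: finite_on_balls_def)
    finally have f: "emeasure ?M (A \<inter> ball x0 (real n)) \<noteq> \<infinity>" by simp
    have "emeasure ?M (B n - A \<inter> ball x0 (real n)) =
        emeasure ?M (B n) - emeasure ?M (A \<inter> ball x0 (real n))"
      using A' BM B f by (intro emeasure_Diff) auto
    also have "\<dots> = 0"
      using B(3)[of n] f emeasure_caratheodory_measure[OF om BM] emeasure_caratheodory_measure[OF om A']
      by (simp add: diff_eq_0_ennreal top.not_eq_extremum)
    finally show ?thesis .
  qed
  show ?thesis
  proof (intro bexI[of _ "\<Union>n. B n"] conjI)
    show "A \<subseteq> (\<Union>n. B n)"
    proof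
      fix x assume "x \<in> A"
      moreover obtain n :: nat where "dist x0 x < real n" using reals_Archimedean2 by blast
      ultimately show "x \<in> (\<Union>n. B n)" using B(2)[of n] by auto
    qed
    have D: "B n - A \<inter> ball x0 (real n) \<in> sets ?M" for n
      by (intro sets.Diff BM A')
    have "emeasure ?M ((\<Union>n. B n) - A) \<le> emeasure ?M (\<Union>n. B n - A \<inter> ball x0 (real n))"
      by (intro emeasure_mono sets.countable_UN) (use D in blast)+
    also have "\<dots> = 0"
      by (rule emeasure_UN_eq_0[OF null]) (use D in blast)
    finally show "emeasure ?M ((\<Union>n. B n) - A) = 0" by simp
  qed (use B in auto)
qed

section \<open>Curves\<close>

text \<open>Appending \<open>s\<close> and \<open>t\<close> to a partition of \<open>{0..s}\<close>
  gives an admissible list for \<open>{0..t}\<close>: the chord is added to the length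
  \<open>s\<close> and the total cannot exceed \<open>t\<close>.\<close>

lemma arc_length_curve_dist_le:
  assumes \<gamma>: "arc_length_curve H \<gamma> l" and st: "0 \<le> s" "s \<le> t" "t \<le> l"
  shows "dist (\<gamma> s) (\<gamma> t) \<le> t - s"
proof -
  let ?\<Sigma> = "\<lambda>ts. \<Sum>i<length ts - 1. ennreal (dist (\<gamma> (ts ! i)) (\<gamma> (ts ! Suc i)))"
  have len: "curve_length \<gamma> 0 s = ennreal s" "curve_length \<gamma> 0 t = ennreal t"
    using \<gamma> st by (auto simp: arc_length_curve_def)
  have "?\<Sigma> ts + ennreal (dist (\<gamma> s) (\<gamma> t)) \<le> ennreal t"
    if ts: "sorted ts" "set ts \<subseteq> {0..s}" for ts
  proof -
    have "?\<Sigma> ts + ennreal (dist (\<gamma> s) (\<gamma> t)) \<le> ?\<Sigma> (ts @ [s, t])"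
    proof (cases "ts = []")
      case True
      then show ?thesis by simp
    next
      case False
      define n where "n = length ts - 1"
      have n: "length ts = Suc n" using False by (simp add: n_def)
      have "?\<Sigma> (ts @ [s, t]) = (\<Sum>i<Suc (Suc n). ennreal (dist (\<gamma> ((ts @ [s, t]) ! i)) (\<gamma> ((ts @ [s, t]) ! Suc i))))"
        by (simp add: n)
      also have "\<dots> = ?\<Sigma> ts + ennreal (dist (\<gamma> (ts ! n)) (\<gamma> s)) + ennreal (dist (\<gamma> s) (\<gamma> t))"
        by (simp add: n nth_append)
      finally show ?thesis by (simp add: add.commute add_left_mono add_increasing2)
    qed
    also have "\<dots> \<le> curve_length \<gamma> 0 t"
      unfolding curve_length_def using ts st
      by (intro SUP_upper) (fastforce simp: sorted_append)
    finally show ?thesis using len by simp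
  qed
  then have "(SUP ts\<in>{ts. sorted ts \<and> set ts \<subseteq> {0..s}}. ?\<Sigma> ts + ennreal (dist (\<gamma> s) (\<gamma> t))) \<le> ennreal t"
    by (intro SUP_least) auto
  also have "(SUP ts\<in>{ts. sorted ts \<and> set ts \<subseteq> {0..s}}. ?\<Sigma> ts + ennreal (dist (\<gamma> s) (\<gamma> t))) =
      (SUP ts\<in>{ts. sorted ts \<and> set ts \<subseteq> {0..s}}. ?\<Sigma> ts) + ennreal (dist (\<gamma> s) (\<gamma> t))"
    by (rule ennreal_SUP_add_left) (auto intro: exI[of _ "[]"])
  finally have "ennreal s + ennreal (dist (\<gamma> s) (\<gamma> t)) \<le> ennreal t"
    using len by (simp add: curve_length_def)
  then have "ennreal (s + dist (\<gamma> s) (\<gamma> t)) \<le> ennreal t" using st by (simp add: ennreal_plus)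
  then have "s + dist (\<gamma> s) (\<gamma> t) \<le> t" using st by (subst (asm) ennreal_le_iff) auto
  then show ?thesis by simp
qed

text \<open>Supplies the two distinct points that make \<open>controls\<close> applicable to the
  curve at all sufficiently small scales.\<close>

lemma arc_length_curve_nonconstant:
  assumes \<gamma>: "arc_length_curve H \<gamma> l" and l: "0 < l"
  shows "\<exists>s\<in>{0..l}. \<exists>t\<in>{0..l}. \<gamma> s \<noteq> \<gamma> t"
proof (rule ccontr)
  assume "\<not> ?thesis"
  then have const: "\<gamma> s = \<gamma> t" if "s \<in> {0..l}" "t \<in> {0..l}" for s t
    using that by blast
  have "curve_length \<gamma> 0 l \<le> 0"
    unfolding curve_length_def
  proof (intro SUP_least)
    fix ts assume "ts \<in> {ts. sorted ts \<and> set ts \<subseteq> {0..l}}"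
    then have ts: "ts ! i \<in> {0..l}" if "i < length ts" for i using that nth_mem by blast
    show "(\<Sum>i<length ts - 1. ennreal (dist (\<gamma> (ts ! i)) (\<gamma> (ts ! Suc i)))) \<le> 0"
    proof (intro eq_refl sum.neutral ballI)
      fix i assume "i \<in> {..<length ts - 1}"
      then have "i < length ts" "Suc i < length ts" by auto
      then have "\<gamma> (ts ! i) = \<gamma> (ts ! Suc i)" by (intro const ts)
      then show "ennreal (dist (\<gamma> (ts ! i)) (\<gamma> (ts ! Suc i))) = 0" by simp
    qed
  qed
  moreover have "curve_length \<gamma> 0 l = ennreal l" using \<gamma> l by (simp add: arc_length_curve_def)
  ultimately show False using l by simp
qed

lemma borel_measurable_comp_arc_length_curve:
  assumes \<gamma>: "arc_length_curve H \<gamma> l" and G: "G \<in> borel_measurable borel"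
  shows "(\<lambda>u. G (\<gamma> u) * indicator {0..l} u :: ennreal) \<in> borel_measurable lborel"
proof -
  \<comment> \<open>Clamping the parameter extends the curve continuously to the whole line and does
    not change it where the indicator is nonzero.\<close>
  have "continuous_on UNIV (\<lambda>u. \<gamma> (max 0 (min l u)))"
  proof (rule continuous_on_compose2[of "{0..l}" \<gamma>])
    show "continuous_on {0..l} \<gamma>" using \<gamma> by (simp add: arc_length_curve_def)
    show "continuous_on UNIV (\<lambda>u. max 0 (min l u))" by (intro continuous_intros)
    show "(\<lambda>u. max 0 (min l u)) ` UNIV \<subseteq> {0..l}" using \<gamma> by (auto simp: arc_length_curve_def)
  qed
  then have [measurable]: "(\<lambda>u. \<gamma> (max 0 (min l u))) \<in> borel_measurable borel"
    by (rule borel_measurable_continuous_onI)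
  note [measurable] = G
  have "(\<lambda>u. G (\<gamma> u) * indicator {0..l} u) = (\<lambda>u. G (\<gamma> (max 0 (min l u))) * indicator {0..l} u)"
    by (auto split: split_indicator)
  then show ?thesis by simp
qed

section \<open>Functions controlling the variation of \<open>f\<close> along curves\<close>

text \<open>The traversal of \<open>A\<close> by \<open>f\<close> along a curve is measured after composing with a distance
  function, so that only one-dimensional Lebesgue outer measure is involved.\<close>

definition controls ::
    "'a::metric_space set \<Rightarrow> ('a \<Rightarrow> 'b::metric_space) \<Rightarrow> real \<Rightarrow> 'a set \<Rightarrow> ('a \<Rightarrow> ennreal) \<Rightarrow> bool" where
  "controls \<Omega> f \<delta> A G \<longleftrightarrow>
     (\<forall>\<gamma> l s t y. arc_length_curve \<Omega> \<gamma> l \<and> s \<in> {0..l} \<and> t \<in> {0..l} \<and> 4 * \<delta> \<le> dist (\<gamma> s) (\<gamma> t) \<longrightarrow>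
        outer_measure_of lborel ((\<lambda>u. dist y (f (\<gamma> u))) ` {u \<in> {0..l}. \<gamma> u \<in> A})
          \<le> (\<integral>\<^sup>+u\<in>{0..l}. G (\<gamma> u) \<partial>lborel))"

lemma controlsI:
  assumes "\<And>\<gamma> l s t y. arc_length_curve \<Omega> \<gamma> l \<Longrightarrow> s \<in> {0..l} \<Longrightarrow> t \<in> {0..l} \<Longrightarrow>
      4 * \<delta> \<le> dist (\<gamma> s) (\<gamma> t) \<Longrightarrow>
      outer_measure_of lborel ((\<lambda>u. dist y (f (\<gamma> u))) ` {u \<in> {0..l}. \<gamma> u \<in> A})
        \<le> (\<integral>\<^sup>+u\<in>{0..l}. G (\<gamma> u) \<partial>lborel)"
  shows "controls \<Omega> f \<delta> A G"
  using assms by (auto simp: controls_def)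

lemma controlsD:
  assumes "controls \<Omega> f \<delta> A G" "arc_length_curve \<Omega> \<gamma> l" "s \<in> {0..l}" "t \<in> {0..l}"
    "4 * \<delta> \<le> dist (\<gamma> s) (\<gamma> t)"
  shows "outer_measure_of lborel ((\<lambda>u. dist y (f (\<gamma> u))) ` {u \<in> {0..l}. \<gamma> u \<in> A})
    \<le> (\<integral>\<^sup>+u\<in>{0..l}. G (\<gamma> u) \<partial>lborel)"
  using assms unfolding controls_def by blast

lemma controls_mono:
  assumes "controls \<Omega> f \<delta>' A' G'" "\<delta>' \<le> \<delta>" "A \<inter> \<Omega> \<subseteq> A'" "\<And>x. G' x \<le> G x"
  shows "controls \<Omega> f \<delta> A G"
proof (rule controlsI)
  fix \<gamma> l s t y
  assume *: "arc_length_curve \<Omega> \<gamma> l" "s \<in> {0..l}" "t \<in> {0..l}" "4 * \<delta> \<le> dist (\<gamma> s) (\<gamma> t)"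
  have "4 * \<delta>' \<le> dist (\<gamma> s) (\<gamma> t)" using * assms(2) by simp
  have "outer_measure_of lborel ((\<lambda>u. dist y (f (\<gamma> u))) ` {u \<in> {0..l}. \<gamma> u \<in> A}) \<le>
     outer_measure_of lborel ((\<lambda>u. dist y (f (\<gamma> u))) ` {u \<in> {0..l}. \<gamma> u \<in> A'})"
    using *(1) assms(3) unfolding arc_length_curve_def
    by (intro outer_measure_of_mono image_mono) blast
  also have "\<dots> \<le> (\<integral>\<^sup>+u\<in>{0..l}. G' (\<gamma> u) \<partial>lborel)"
    by (rule controlsD[OF assms(1) *(1,2,3)]) fact
  also have "\<dots> \<le> (\<integral>\<^sup>+u\<in>{0..l}. G (\<gamma> u) \<partial>lborel)"
    by (intro nn_integral_mono mult_right_mono assms) auto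
  finally show "outer_measure_of lborel ((\<lambda>u. dist y (f (\<gamma> u))) ` {u \<in> {0..l}. \<gamma> u \<in> A}) \<le>
    (\<integral>\<^sup>+u\<in>{0..l}. G (\<gamma> u) \<partial>lborel)" .
qed

text \<open>Sums are written as integrals over \<open>count_space\<close> because the covers below
  are indexed by their centres, an arbitrary countable set of points; exchanging such a sum with an
  integral is then an exchange of two integrals.\<close>

lemma outer_measure_of_countable_UN_le:
  assumes "countable I" "space D = UNIV"
  shows "outer_measure_of D (\<Union>i\<in>I. A i) \<le> (\<integral>\<^sup>+i. outer_measure_of D (A i) \<partial>count_space I)"
proof -
  have "\<exists>E\<in>sets D. A i \<subseteq> E \<and> outer_measure_of D (A i) = emeasure D E" for i
    using outer_measure_of_attain[of "A i" D] assms by auto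
  then obtain E where E: "\<And>n. E n \<in> sets D" "\<And>n. A n \<subseteq> E n"
    "\<And>n. outer_measure_of D (A n) = emeasure D (E n)" by metis
  have UE: "(\<Union>i\<in>I. E i) \<in> sets D" using E assms by (intro sets.countable_UN') auto
  have "outer_measure_of D (\<Union>i\<in>I. A i) \<le> outer_measure_of D (\<Union>i\<in>I. E i)"
    using E by (intro outer_measure_of_mono) auto
  also have "\<dots> = emeasure D (\<Union>i\<in>I. E i)"
    using UE by (rule outer_measure_of_eq)
  also have "\<dots> = (\<integral>\<^sup>+x. indicator (\<Union>i\<in>I. E i) x \<partial>D)" using UE by simp
  also have "\<dots> \<le> (\<integral>\<^sup>+x. \<integral>\<^sup>+i. indicator (E i) x \<partial>count_space I \<partial>D)"
  proof (rule nn_integral_mono)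
    fix x
    show "indicator (\<Union>i\<in>I. E i) x \<le> (\<integral>\<^sup>+i. indicator (E i) x \<partial>count_space I)"
    proof (cases "x \<in> (\<Union>i\<in>I. E i)")
      case True
      then obtain i where "i \<in> I" "x \<in> E i" by auto
      then have "indicator (\<Union>i\<in>I. E i) x = (\<integral>\<^sup>+j. indicator {i} j \<partial>count_space I)"
        using True by (simp add: emeasure_count_space)
      also have "\<dots> \<le> (\<integral>\<^sup>+i. indicator (E i) x \<partial>count_space I)"
        using \<open>x \<in> E i\<close> by (intro nn_integral_mono) (auto split: split_indicator)
      finally show ?thesis .
    qed simp
  qed
  also have "\<dots> = (\<integral>\<^sup>+i. \<integral>\<^sup>+x. indicator (E i) x \<partial>D \<partial>count_space I)"
    using E assms by (intro nn_integral_count_space_nn_integral) auto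
  also have "\<dots> = (\<integral>\<^sup>+i. outer_measure_of D (A i) \<partial>count_space I)"
    using E by simp
  finally show ?thesis .
qed

text \<open>Countable subadditivity of outer measure does the work. This is why
  \<open>controls\<close> speaks of the image of a part of the curve: the pieces \<open>A i\<close>
  may be arbitrary sets, and measurability concerns only the functions \<open>G i\<close>.\<close>

lemma controls_UN:
  assumes I: "countable I" and meas: "\<And>i. i \<in> I \<Longrightarrow> G i \<in> borel_measurable borel"
    and c: "\<And>i. i \<in> I \<Longrightarrow> controls \<Omega> f \<delta> (A i) (G i)"
  shows "controls \<Omega> f \<delta> (\<Union>i\<in>I. A i) (\<lambda>x. \<integral>\<^sup>+i. G i x \<partial>count_space I)"
proof (rule controlsI)
  fix \<gamma> l s t y
  assume *: "arc_length_curve \<Omega> \<gamma> l" "s \<in> {0..l}" "t \<in> {0..l}" "4 * \<delta> \<le> dist (\<gamma> s) (\<gamma> t)"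
  let ?S = "\<lambda>i. (\<lambda>u. dist y (f (\<gamma> u))) ` {u \<in> {0..l}. \<gamma> u \<in> A i}"
  have "(\<lambda>u. dist y (f (\<gamma> u))) ` {u \<in> {0..l}. \<gamma> u \<in> (\<Union>i\<in>I. A i)} = (\<Union>i\<in>I. ?S i)" by auto
  then have "outer_measure_of lborel ((\<lambda>u. dist y (f (\<gamma> u))) ` {u \<in> {0..l}. \<gamma> u \<in> (\<Union>i\<in>I. A i)}) \<le>
      (\<integral>\<^sup>+i. outer_measure_of lborel (?S i) \<partial>count_space I)"
    using outer_measure_of_countable_UN_le[OF I, of lborel ?S] by simp
  also have "\<dots> \<le> (\<integral>\<^sup>+i. (\<integral>\<^sup>+u\<in>{0..l}. G i (\<gamma> u) \<partial>lborel) \<partial>count_space I)"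
    using controlsD[OF c *] by (intro nn_integral_mono) auto
  also have "\<dots> = (\<integral>\<^sup>+u. (\<integral>\<^sup>+i. G i (\<gamma> u) * indicator {0..l} u \<partial>count_space I) \<partial>lborel)"
    using I borel_measurable_comp_arc_length_curve[OF *(1) meas]
    by (intro nn_integral_count_space_nn_integral[symmetric]) auto
  also have "\<dots> = (\<integral>\<^sup>+u\<in>{0..l}. (\<integral>\<^sup>+i. G i (\<gamma> u) \<partial>count_space I) \<partial>lborel)"
    by (simp add: nn_integral_multc)
  finally show "outer_measure_of lborel ((\<lambda>u. dist y (f (\<gamma> u))) ` {u \<in> {0..l}. \<gamma> u \<in> (\<Union>i\<in>I. A i)})
      \<le> (\<integral>\<^sup>+u\<in>{0..l}. (\<integral>\<^sup>+i. G i (\<gamma> u) \<partial>count_space I) \<partial>lborel)" .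
qed

lemma controls_Un:
  assumes "G \<in> borel_measurable borel" "H \<in> borel_measurable borel"
    and "controls \<Omega> f \<delta> A G" "controls \<Omega> f \<delta> B H"
  shows "controls \<Omega> f \<delta> (A \<union> B) (\<lambda>x. G x + H x)"
proof -
  let ?A = "\<lambda>i. if i then A else B" and ?G = "\<lambda>i. if i then G else H"
  have "controls \<Omega> f \<delta> (\<Union>i\<in>UNIV. ?A i) (\<lambda>x. \<integral>\<^sup>+i. ?G i x \<partial>count_space UNIV)"
    by (rule controls_UN) (use assms in simp_all)
  moreover have "(\<Union>i\<in>UNIV. ?A i) = A \<union> B" by (auto simp: UNIV_bool)
  moreover have "(\<integral>\<^sup>+i. ?G i x \<partial>count_space UNIV) = G x + H x" for x
    by (subst nn_integral_count_space_finite) (simp_all add: UNIV_bool add.commute)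
  ultimately show ?thesis by simp
qed

lemma controls_UN_small:
  fixes T :: "nat \<Rightarrow> 'a::metric_space set" and f :: "'a \<Rightarrow> 'b::metric_space" and e :: real
  assumes M: "sets M = sets borel" and e: "0 < e" and A: "A \<subseteq> (\<Union>k. T k)"
    and ex: "\<And>k e'. 0 < e' \<Longrightarrow>
      \<exists>G\<in>borel_measurable borel. controls \<Omega> f \<delta> (T k) G \<and> (\<integral>\<^sup>+x. G x \<partial>M) \<le> ennreal e'"
  shows "\<exists>G\<in>borel_measurable borel. controls \<Omega> f \<delta> A G \<and> (\<integral>\<^sup>+x. G x \<partial>M) \<le> ennreal e"
proof -
  have "\<exists>G\<in>borel_measurable borel. controls \<Omega> f \<delta> (T k) G \<and>
      (\<integral>\<^sup>+x. G x \<partial>M) \<le> ennreal (e * (1 / 2) ^ Suc k)" for k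
    by (rule ex) (use e in simp)
  then obtain G where G: "\<And>k. G k \<in> borel_measurable borel" "\<And>k. controls \<Omega> f \<delta> (T k) (G k)"
    "\<And>k. (\<integral>\<^sup>+x. G k x \<partial>M) \<le> ennreal (e * (1 / 2) ^ Suc k)" by metis
  have "controls \<Omega> f \<delta> (\<Union>k. T k) (\<lambda>x. \<integral>\<^sup>+k. G k x \<partial>count_space UNIV)"
    using G by (intro controls_UN) auto
  then have "controls \<Omega> f \<delta> A (\<lambda>x. \<integral>\<^sup>+k. G k x \<partial>count_space UNIV)"
    by (rule controls_mono) (use A in auto)
  then have 1: "controls \<Omega> f \<delta> A (\<lambda>x. \<Sum>k. G k x)" by (simp add: nn_integral_count_space_nat)
  have Gm: "G k \<in> borel_measurable M" for k
    by (subst measurable_cong_sets[OF M refl]) (rule G(1))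
  have "(\<integral>\<^sup>+x. (\<Sum>k. G k x) \<partial>M) = (\<Sum>k. \<integral>\<^sup>+x. G k x \<partial>M)"
    by (rule nn_integral_suminf[OF Gm])
  also have "\<dots> \<le> (\<Sum>k. ennreal (e * (1 / 2) ^ Suc k))"
    using G(3) by (intro suminf_le) auto
  also have "\<dots> = ennreal e"
    using sums_mult[OF power_half_series, of e] e
    by (intro suminf_ennreal_eq) (auto simp del: power_Suc)
  finally show ?thesis using 1 G(1) by (intro bexI[of _ "\<lambda>x. \<Sum>k. G k x"]) auto
qed

text \<open>A curve may meet \<open>A\<close> at uncountably many parameters, but the values taken
  there are among the countably many numbers \<open>dist y (f a)\<close> with
  \<open>a \<in> A\<close>.\<close>

lemma controls_countable:
  assumes "countable A"
  shows "controls \<Omega> f \<delta> (A :: 'a::metric_space set) (\<lambda>_. 0)"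
proof (rule controlsI)
  fix \<gamma> :: "real \<Rightarrow> 'a" and l s t :: real and y
  let ?S = "(\<lambda>u. dist y (f (\<gamma> u))) ` {u \<in> {0..l}. \<gamma> u \<in> A}"
  have "?S \<subseteq> (\<lambda>a. dist y (f a)) ` A" by (rule image_subsetI) simp
  then have "countable ?S" by (rule countable_subset) (intro countable_image assms)
  then have "?S \<in> null_sets lborel"
    by (rule countable_imp_null_set_lborel)
  then have "outer_measure_of lborel ?S = 0"
    by (simp add: null_sets_def)
  then show "outer_measure_of lborel ?S \<le> (\<integral>\<^sup>+u\<in>{0..l}. 0 \<partial>lborel)"
    by simp
qed

text \<open>If all parameters were within \<open>r\<close> of \<open>u\<close>, then \<gamma> s and
  \<gamma> t would be less than 2 r apart. So the parameter interval extends by \<open>r\<close> to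
  one side of \<open>u\<close>, and at speed at most 1 the curve stays in the doubled ball during
  that time.\<close>

lemma arc_length_curve_ball_integral:
  assumes \<gamma>: "arc_length_curve \<Omega> \<gamma> l" and st: "s \<in> {0..l}" "t \<in> {0..l}"
    and far: "4 * r \<le> dist (\<gamma> s) (\<gamma> t)" and r: "0 < r" and u: "u \<in> {0..l}" "\<gamma> u \<in> ball c r"
  shows "ennreal r \<le> (\<integral>\<^sup>+v\<in>{0..l}. indicator (ball c (2 * r)) (\<gamma> v) \<partial>lborel)"
proof -
  have lip: "dist (\<gamma> a) (\<gamma> b) \<le> \<bar>a - b\<bar>" if "a \<in> {0..l}" "b \<in> {0..l}" for a b
    using arc_length_curve_dist_le[OF \<gamma>, of a b] arc_length_curve_dist_le[OF \<gamma>, of b a] that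
    by (cases "a \<le> b") (auto simp: dist_commute)
  have "\<exists>v\<in>{0..l}. r \<le> \<bar>v - u\<bar>"
  proof (rule ccontr)
    assume "\<not> ?thesis"
    then have "\<bar>s - u\<bar> < r" "\<bar>t - u\<bar> < r" using st by (meson not_le)+
    then have "dist (\<gamma> s) (\<gamma> u) < r" "dist (\<gamma> t) (\<gamma> u) < r"
      using lip[OF st(1) u(1)] lip[OF st(2) u(1)] by linarith+
    with far r dist_triangle2[of "\<gamma> s" "\<gamma> t" "\<gamma> u"] show False by linarith
  qed
  then obtain v where v: "v \<in> {0..l}" "r \<le> \<bar>v - u\<bar>" by blast
  have near: "\<gamma> a \<in> ball c (2 * r)" if "a \<in> {0..l}" "\<bar>a - u\<bar> \<le> r" for a
    using lip[OF that(1) u(1)] that(2) u(2) dist_triangle[of c "\<gamma> a" "\<gamma> u"]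
    by (simp add: dist_commute)
  obtain a where a: "{a..a + r} \<subseteq> {0..l}" "\<And>b. b \<in> {a..a + r} \<Longrightarrow> \<bar>b - u\<bar> \<le> r"
  proof (cases "v \<ge> u")
    case True
    then show ?thesis using v u(1) r by (intro that[of u]) auto
  next
    case False
    then show ?thesis using v u(1) r by (intro that[of "u - r"]) auto
  qed
  have "ennreal r = (\<integral>\<^sup>+b. indicator {a..a + r} b \<partial>lborel)" using r by simp
  also have "\<dots> \<le> (\<integral>\<^sup>+v\<in>{0..l}. indicator (ball c (2 * r)) (\<gamma> v) \<partial>lborel)"
    using a near by (intro nn_integral_mono) (auto split: split_indicator simp: subset_iff)
  finally show ?thesis .
qed

text \<open>On the ball the values of the distance function lie in an interval of length
  \<open>2 * m\<close>, while a long curve that meets the ball spends length at least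
  \<open>r\<close> in the doubled ball. The doubled ball is also the one in the codimension one
  measure.\<close>

lemma controls_ball:
  assumes r: "0 < r" "r \<le> \<delta>" and osc: "\<And>x. x \<in> \<Omega> \<inter> ball c r \<Longrightarrow> dist (f x) z \<le> m" and m: "0 \<le> m"
  shows "controls \<Omega> f \<delta> (ball c r) (\<lambda>x. ennreal (2 * m / r) * indicator (ball c (2 * r)) x)"
proof (rule controlsI)
  fix \<gamma> l s t y
  assume *: "arc_length_curve \<Omega> \<gamma> l" "s \<in> {0..l}" "t \<in> {0..l}" "4 * \<delta> \<le> dist (\<gamma> s) (\<gamma> t)"
  let ?S = "(\<lambda>u. dist y (f (\<gamma> u))) ` {u \<in> {0..l}. \<gamma> u \<in> ball c r}"
  show "outer_measure_of lborel ?S \<le>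
    (\<integral>\<^sup>+u\<in>{0..l}. ennreal (2 * m / r) * indicator (ball c (2 * r)) (\<gamma> u) \<partial>lborel)"
  proof (cases "?S = {}")
    case False
    then obtain u where u: "u \<in> {0..l}" "\<gamma> u \<in> ball c r" by blast
    have "?S \<subseteq> {dist y z - m..dist y z + m}"
    proof
      fix v assume "v \<in> ?S"
      then obtain u where u: "u \<in> {0..l}" "\<gamma> u \<in> ball c r" "v = dist y (f (\<gamma> u))" by blast
      then have "\<gamma> u \<in> \<Omega>" using *(1) by (auto simp: arc_length_curve_def)
      then have "dist (f (\<gamma> u)) z \<le> m" using u by (intro osc) auto
      then show "v \<in> {dist y z - m..dist y z + m}"
        using u dist_triangle[of y z "f (\<gamma> u)"] dist_triangle2[of y "f (\<gamma> u)" z]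
        by (auto simp: dist_commute)
    qed
    then have "outer_measure_of lborel ?S \<le> outer_measure_of lborel {dist y z - m..dist y z + m}"
      by (rule outer_measure_of_mono)
    also have "\<dots> = ennreal (2 * m)" using m by simp
    also have "\<dots> = ennreal (2 * m / r) * ennreal r" using r m by (simp flip: ennreal_mult)
    also have "\<dots> \<le> ennreal (2 * m / r) * (\<integral>\<^sup>+v\<in>{0..l}. indicator (ball c (2 * r)) (\<gamma> v) \<partial>lborel)"
      using * r u by (intro mult_left_mono arc_length_curve_ball_integral[of \<Omega> \<gamma> l s t]) auto
    also have "\<dots> = (\<integral>\<^sup>+u\<in>{0..l}. ennreal (2 * m / r) * indicator (ball c (2 * r)) (\<gamma> u) \<partial>lborel)"
      unfolding mult.assoc using m r
      by (intro nn_integral_cmult[symmetric] borel_measurable_comp_arc_length_curve[OF *(1)]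
          borel_measurable_indicator) auto
    finally show ?thesis .
  next
    case True
    show ?thesis unfolding True by simp
  qed
qed

text \<open>With \<open>y = f (\<gamma> 0)\<close> the distance function starts at 0, so by the
  intermediate value theorem its image contains an interval as long as the distance of the end
  values.\<close>

lemma controls_dist_le:
  assumes c: "controls \<Omega> f \<delta> \<Omega> G" and f: "continuous_on \<Omega> f"
    and \<gamma>: "arc_length_curve \<Omega> \<gamma> l" "s \<in> {0..l}" "t \<in> {0..l}" "4 * \<delta> \<le> dist (\<gamma> s) (\<gamma> t)"
  shows "ennreal (dist (f (\<gamma> 0)) (f (\<gamma> l))) \<le> (\<integral>\<^sup>+u\<in>{0..l}. G (\<gamma> u) \<partial>lborel)"
proof -
  let ?\<phi> = "\<lambda>u. dist (f (\<gamma> 0)) (f (\<gamma> u))"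
  have \<gamma>': "0 \<le> l" "continuous_on {0..l} \<gamma>" "\<gamma> ` {0..l} \<subseteq> \<Omega>"
    using \<gamma>(1) by (auto simp: arc_length_curve_def)
  then have "continuous_on {0..l} ?\<phi>"
    by (intro continuous_intros continuous_on_compose2[OF f]) auto
  then have "{0..?\<phi> l} \<subseteq> ?\<phi> ` {0..l}"
  proof (intro subsetI)
    fix v assume v: "v \<in> {0..?\<phi> l}"
    have "\<exists>u\<ge>0. u \<le> l \<and> ?\<phi> u = v"
      by (rule IVT') (use v \<gamma>'(1) \<open>continuous_on {0..l} ?\<phi>\<close> in auto)
    then show "v \<in> ?\<phi> ` {0..l}" by auto
  qed
  also have "\<dots> = ?\<phi> ` {u \<in> {0..l}. \<gamma> u \<in> \<Omega>}" using \<gamma>'(3) by (intro arg_cong2[where f = image] refl) blast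
  finally have "outer_measure_of lborel {0..?\<phi> l} \<le> outer_measure_of lborel (?\<phi> ` {u \<in> {0..l}. \<gamma> u \<in> \<Omega>})"
    by (rule outer_measure_of_mono)
  also have "\<dots> \<le> (\<integral>\<^sup>+u\<in>{0..l}. G (\<gamma> u) \<partial>lborel)" by (rule controlsD[OF c \<gamma>])
  finally show ?thesis by simp
qed

section \<open>Sets of finite codimension one Hausdorff measure\<close>

lemma codim1_content_le:
  fixes J :: "nat set"
  assumes "\<forall>j\<in>J. 0 < r j \<and> r j \<le> \<rho>" "A \<subseteq> (\<Union>j\<in>J. ball (c j) (r j))"
  shows "codim1_content \<mu> \<rho> A \<le> (\<Sum>\<^sub>\<infinity>j\<in>J. \<mu> (ball (c j) (2 * r j)) / ennreal (r j))"
  unfolding codim1_content_def using assms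
  by (intro Inf_lower CollectI exI[of _ J] exI[of _ c] exI[of _ r] conjI refl)

lemma codim1_content_greatest:
  assumes "\<And>(J :: nat set) c r. \<forall>j\<in>J. 0 < r j \<and> r j \<le> \<rho> \<Longrightarrow> A \<subseteq> (\<Union>j\<in>J. ball (c j) (r j)) \<Longrightarrow>
      b \<le> (\<Sum>\<^sub>\<infinity>j\<in>J. \<mu> (ball (c j) (2 * r j)) / ennreal (r j))"
  shows "b \<le> codim1_content \<mu> \<rho> A"
  unfolding codim1_content_def
proof (rule Inf_greatest, unfold mem_Collect_eq, elim exE conjE)
  fix v :: ennreal and J :: "nat set" and c and r :: "nat \<Rightarrow> real"
  assume "v = (\<Sum>\<^sub>\<infinity>j\<in>J. \<mu> (ball (c j) (2 * r j)) / ennreal (r j))"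
    "\<forall>j\<in>J. 0 < r j \<and> r j \<le> \<rho>" "A \<subseteq> (\<Union>j\<in>J. ball (c j) (r j))"
  then show "b \<le> v" using assms[of J r c] by simp
qed

lemma codim1_content_antimono:
  assumes "\<rho> \<le> \<rho>'" shows "codim1_content \<mu> \<rho>' A \<le> codim1_content \<mu> \<rho> A"
proof (rule codim1_content_greatest)
  fix J :: "nat set" and c and r :: "nat \<Rightarrow> real"
  assume r: "\<forall>j\<in>J. 0 < r j \<and> r j \<le> \<rho>" and A: "A \<subseteq> (\<Union>j\<in>J. ball (c j) (r j))"
  from r have "\<forall>j\<in>J. 0 < r j \<and> r j \<le> \<rho>'" using assms by force
  then show "codim1_content \<mu> \<rho>' A \<le> (\<Sum>\<^sub>\<infinity>j\<in>J. \<mu> (ball (c j) (2 * r j)) / ennreal (r j))"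
    using A by (rule codim1_content_le)
qed

text \<open>The contents increase as \<rho> decreases, so the limit in the definition exists and is
  their supremum.\<close>

lemma codim1_content_le_hausdorff:
  assumes "0 < \<rho>" shows "codim1_content \<mu> \<rho> A \<le> codim1_hausdorff \<mu> A"
proof -
  let ?S = "SUP \<rho>\<in>{0<..}. codim1_content \<mu> \<rho> A"
  have "((\<lambda>\<rho>. codim1_content \<mu> \<rho> A) \<longlongrightarrow> ?S) (at_right 0)"
  proof (rule order_tendstoI)
    fix a assume "a < ?S"
    then obtain \<rho>0 where \<rho>0: "0 < \<rho>0" "a < codim1_content \<mu> \<rho>0 A" by (auto simp: less_SUP_iff)
    have "eventually (\<lambda>\<rho>. \<rho> < \<rho>0) (at_right 0)"
      using \<rho>0(1) by (auto simp: eventually_at_right_field)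
    then show "eventually (\<lambda>\<rho>. a < codim1_content \<mu> \<rho> A) (at_right 0)"
    proof eventually_elim
      case (elim \<rho>)
      then show ?case
        using codim1_content_antimono[of \<rho> \<rho>0 \<mu> A] \<rho>0(2) by (auto intro: less_le_trans)
    qed
  next
    fix a assume a: "?S < a"
    show "eventually (\<lambda>\<rho>. codim1_content \<mu> \<rho> A < a) (at_right 0)"
      using eventually_at_right_less[of "0::real"]
    proof eventually_elim
      case (elim \<rho>)
      then have "codim1_content \<mu> \<rho> A \<le> ?S" by (intro SUP_upper) auto
      then show ?case using a by (rule le_less_trans)
    qed
  qed
  then have "codim1_hausdorff \<mu> A = ?S"
    unfolding codim1_hausdorff_def by (intro tendsto_Lim) auto
  then show ?thesis using assms by (auto intro: SUP_upper)
qed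

lemma nn_integral_count_space_le_infsum:
  fixes h :: "nat \<Rightarrow> ennreal"
  shows "(\<integral>\<^sup>+j. h j \<partial>count_space J) \<le> (\<Sum>\<^sub>\<infinity>j\<in>J. h j)"
proof -
  have "(\<integral>\<^sup>+j. h j \<partial>count_space J) = (\<Sum>j. h j * indicator J j)"
    by (simp add: nn_integral_count_space_indicator nn_integral_count_space_nat)
  also have "\<dots> \<le> (\<Sum>\<^sub>\<infinity>j\<in>J. h j)"
  proof (rule suminf_le_const)
    fix n
    have "(\<Sum>j<n. h j * indicator J j) = sum h (J \<inter> {..<n})"
      by (simp add: indicator_def sum.If_cases Int_commute)
    also have "\<dots> \<le> (SUP F\<in>{F. finite F \<and> F \<subseteq> J}. sum h F)"
      by (intro SUP_upper) auto
    also have "\<dots> = (\<Sum>\<^sub>\<infinity>j\<in>J. h j)" by (rule nonneg_infsum_complete[symmetric]) auto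
    finally show "(\<Sum>j<n. h j * indicator J j) \<le> (\<Sum>\<^sub>\<infinity>j\<in>J. h j)" .
  qed auto
  finally show ?thesis .
qed

text \<open>The argument for metric outer measures: a ball of radius at most \<rho> cannot meet two
  sets at distance at least \<open>2 * \<rho>\<close>, so one cover of \<open>S\<close> splits into
  disjoint families covering the different \<open>D k\<close>.\<close>

lemma sum_codim1_content_le:
  assumes K: "finite K" and sub: "\<And>k. k \<in> K \<Longrightarrow> D k \<subseteq> S"
    and sep: "\<And>k k' x y. k \<in> K \<Longrightarrow> k' \<in> K \<Longrightarrow> k \<noteq> k' \<Longrightarrow> x \<in> D k \<Longrightarrow> y \<in> D k' \<Longrightarrow> 2 * \<rho> \<le> dist x y"
  shows "(\<Sum>k\<in>K. codim1_content \<mu> \<rho> (D k)) \<le> codim1_content \<mu> \<rho> S"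
proof (rule codim1_content_greatest)
  fix J :: "nat set" and c and r :: "nat \<Rightarrow> real"
  assume r: "\<forall>j\<in>J. 0 < r j \<and> r j \<le> \<rho>" and cov: "S \<subseteq> (\<Union>j\<in>J. ball (c j) (r j))"
  let ?h = "\<lambda>j. \<mu> (ball (c j) (2 * r j)) / ennreal (r j)"
  define JJ where "JJ k = {j \<in> J. ball (c j) (r j) \<inter> D k \<noteq> {}}" for k
  have "(\<Sum>k\<in>K. codim1_content \<mu> \<rho> (D k)) \<le> (\<Sum>k\<in>K. \<Sum>\<^sub>\<infinity>j\<in>JJ k. ?h j)"
  proof (rule sum_mono)
    fix k assume "k \<in> K"
    show "codim1_content \<mu> \<rho> (D k) \<le> (\<Sum>\<^sub>\<infinity>j\<in>JJ k. ?h j)"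
    proof (rule codim1_content_le)
      show "D k \<subseteq> (\<Union>j\<in>JJ k. ball (c j) (r j))"
        using cov sub[OF \<open>k \<in> K\<close>] unfolding JJ_def by blast
    qed (use r in \<open>simp add: JJ_def\<close>)
  qed
  also have "\<dots> = (\<Sum>\<^sub>\<infinity>j\<in>(\<Union>k\<in>K. JJ k). ?h j)"
  proof (rule sum_infsum)
    fix k k' assume k: "k \<in> K" "k' \<in> K" "k \<noteq> k'"
    show "JJ k \<inter> JJ k' = {}"
    proof (rule ccontr)
      assume "JJ k \<inter> JJ k' \<noteq> {}"
      then obtain j x y where j: "j \<in> J" "x \<in> ball (c j) (r j)" "x \<in> D k" "y \<in> ball (c j) (r j)" "y \<in> D k'"
        by (auto simp: JJ_def)
      then have "dist x y < 2 * r j" using dist_triangle2[of x y "c j"] by (simp add: dist_commute)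
      moreover have "r j \<le> \<rho>" using r j by auto
      ultimately show False using sep[OF k j(3,5)] by linarith
    qed
  next
    show "?h summable_on JJ k" for k by (rule nonneg_summable_on_complete) simp
  qed (use K in auto)
  also have "\<dots> \<le> (\<Sum>\<^sub>\<infinity>j\<in>J. ?h j)"
    by (rule infsum_mono_neutral) (auto simp: JJ_def intro: nonneg_summable_on_complete)
  finally show "(\<Sum>k\<in>K. codim1_content \<mu> \<rho> (D k)) \<le> (\<Sum>\<^sub>\<infinity>j\<in>J. ?h j)" .
qed

text \<open>Near \<open>D\<close> the function oscillates by at most \<epsilon> at scale \<rho>, so
  each ball of an efficient cover costs \<open>2 * \<epsilon>\<close> times its term in the content.
  The extra \<open>e\<close> is the slack for picking a cover close to the infimum.\<close>

lemma codim1_small_controls_aux: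
  fixes M :: "'a::metric_space measure"
  assumes M: "sets M = sets borel" "\<And>c r. emeasure M (ball c r) \<le> \<mu> (ball c r)"
    and \<rho>: "0 < \<rho>" "\<rho> \<le> \<delta>" and fin: "codim1_content \<mu> \<rho> D < \<infinity>" and \<epsilon>: "0 < \<epsilon>"
    and osc: "\<And>x y z. x \<in> D \<Longrightarrow> y \<in> \<Omega> \<Longrightarrow> z \<in> \<Omega> \<Longrightarrow> dist x y < 2 * \<rho> \<Longrightarrow> dist x z < 2 * \<rho> \<Longrightarrow>
      dist (f y) (f z) \<le> \<epsilon>"
    and e: "0 < (e::real)" and D: "D \<subseteq> \<Omega>"
  shows "\<exists>G\<in>borel_measurable borel. controls \<Omega> f \<delta> D G \<and>
    (\<integral>\<^sup>+x. G x \<partial>M) \<le> ennreal (2 * \<epsilon>) * (codim1_content \<mu> \<rho> D + ennreal e)"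
proof -
  have "codim1_content \<mu> \<rho> D < codim1_content \<mu> \<rho> D + ennreal e"
    using fin e by (cases "codim1_content \<mu> \<rho> D")
      (auto simp: ennreal_plus[symmetric] ennreal_less_iff simp del: ennreal_plus)
  then obtain J :: "nat set" and c and r :: "nat \<Rightarrow> real"
    where r: "\<forall>j\<in>J. 0 < r j \<and> r j \<le> \<rho>" and cov: "D \<subseteq> (\<Union>j\<in>J. ball (c j) (r j))"
      and less: "(\<Sum>\<^sub>\<infinity>j\<in>J. \<mu> (ball (c j) (2 * r j)) / ennreal (r j)) < codim1_content \<mu> \<rho> D + ennreal e"
    using codim1_content_greatest[of \<rho> D "codim1_content \<mu> \<rho> D + ennreal e" \<mu>]
    by (meson linorder_not_le)
  \<comment> \<open>Balls missing \<open>D\<close> are discarded: the oscillation bound is known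
    only near points of \<open>D\<close>.\<close>
  define I where "I = {j \<in> J. ball (c j) (r j) \<inter> D \<noteq> {}}"
  define g where "g j x = ennreal (2 * \<epsilon> / r j) * indicator (ball (c j) (2 * r j)) x" for j x
  have [measurable]: "g j \<in> borel_measurable borel" for j
  proof -
    have [measurable]: "ball (c j) (2 * r j) \<in> sets borel" by simp
    show ?thesis unfolding g_def[abs_def] by measurable
  qed
  have ctrl: "controls \<Omega> f \<delta> (ball (c j) (r j)) (g j)" if j: "j \<in> I" for j
  proof -
    obtain x where x: "x \<in> ball (c j) (r j)" "x \<in> D" using j by (auto simp: I_def)
    have rj: "0 < r j" "r j \<le> \<rho>" using r j by (auto simp: I_def)
    have "dist (f y) (f x) \<le> \<epsilon>" if "y \<in> \<Omega> \<inter> ball (c j) (r j)" for y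
    proof (rule osc[OF x(2)])
      show "dist x y < 2 * \<rho>"
        using x(1) that rj dist_triangle2[of x y "c j"] by (simp add: dist_commute)
    qed (use that x D \<rho> in auto)
    then show ?thesis
      unfolding g_def[abs_def] using rj \<rho> \<epsilon> by (intro controls_ball) auto
  qed
  have "controls \<Omega> f \<delta> (\<Union>j\<in>I. ball (c j) (r j)) (\<lambda>x. \<integral>\<^sup>+j. g j x \<partial>count_space I)"
    using ctrl by (intro controls_UN) auto
  then have 1: "controls \<Omega> f \<delta> D (\<lambda>x. \<integral>\<^sup>+j. g j x \<partial>count_space I)"
  proof (rule controls_mono)
    show "D \<inter> \<Omega> \<subseteq> (\<Union>j\<in>I. ball (c j) (r j))" using cov unfolding I_def by blast
  qed auto
  have gM: "g j \<in> borel_measurable M" for j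
    by (subst measurable_cong_sets[OF M(1) refl]) simp
  have "(\<integral>\<^sup>+x. (\<integral>\<^sup>+j. g j x \<partial>count_space I) \<partial>M) = (\<integral>\<^sup>+j. (\<integral>\<^sup>+x. g j x \<partial>M) \<partial>count_space I)"
    by (rule nn_integral_count_space_nn_integral[OF _ gM]) simp
  also have "\<dots> \<le> (\<integral>\<^sup>+j. ennreal (2 * \<epsilon>) * (\<mu> (ball (c j) (2 * r j)) / ennreal (r j)) \<partial>count_space I)"
  proof (intro nn_integral_mono)
    fix j assume "j \<in> space (count_space I)"
    then have "0 < r j" using r by (auto simp: I_def)
    have "(\<integral>\<^sup>+x. g j x \<partial>M) = ennreal (2 * \<epsilon> / r j) * emeasure M (ball (c j) (2 * r j))"
      unfolding g_def by (subst nn_integral_cmult_indicator) (auto simp: M(1))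
    also have "\<dots> \<le> ennreal (2 * \<epsilon> / r j) * \<mu> (ball (c j) (2 * r j))"
      by (intro mult_left_mono M) auto
    also have "\<dots> = ennreal (2 * \<epsilon>) * (\<mu> (ball (c j) (2 * r j)) / ennreal (r j))"
      using \<open>0 < r j\<close> \<epsilon> by (simp add: divide_ennreal[symmetric] divide_ennreal_def mult_ac)
    finally show "(\<integral>\<^sup>+x. g j x \<partial>M) \<le> ennreal (2 * \<epsilon>) * (\<mu> (ball (c j) (2 * r j)) / ennreal (r j))" .
  qed
  also have "\<dots> = ennreal (2 * \<epsilon>) * (\<integral>\<^sup>+j. \<mu> (ball (c j) (2 * r j)) / ennreal (r j) \<partial>count_space I)"
    by (rule nn_integral_cmult) auto
  also have "\<dots> \<le> ennreal (2 * \<epsilon>) * (\<Sum>\<^sub>\<infinity>j\<in>I. \<mu> (ball (c j) (2 * r j)) / ennreal (r j))"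
    by (intro mult_left_mono nn_integral_count_space_le_infsum) auto
  also have "\<dots> \<le> ennreal (2 * \<epsilon>) * (\<Sum>\<^sub>\<infinity>j\<in>J. \<mu> (ball (c j) (2 * r j)) / ennreal (r j))"
    by (intro mult_left_mono infsum_mono_neutral) (auto simp: I_def intro: nonneg_summable_on_complete)
  also have "\<dots> \<le> ennreal (2 * \<epsilon>) * (codim1_content \<mu> \<rho> D + ennreal e)"
    using less by (intro mult_left_mono) auto
  finally have 2: "(\<integral>\<^sup>+x. (\<integral>\<^sup>+j. g j x \<partial>count_space I) \<partial>M) \<le>
    ennreal (2 * \<epsilon>) * (codim1_content \<mu> \<rho> D + ennreal e)" .
  have "(\<lambda>x. \<integral>\<^sup>+j. g j x \<partial>count_space I) \<in> borel_measurable borel"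
    by (simp add: nn_integral_count_space_indicator nn_integral_count_space_nat)
  with 1 2 show ?thesis by blast
qed

text \<open>The layers \<open>D k\<close> collect the points at which the oscillation of \<open>f\<close> becomes small
  exactly at scale \<open>2 ^ - k\<close>. Layers of the same parity are a positive distance apart, so their
  contents add up although \<open>S\<close> need not be measurable.\<close>

lemma codim1_small_controls:
  fixes M :: "'a::metric_space measure" and f :: "'a \<Rightarrow> 'b::metric_space"
  assumes M: "sets M = sets borel" "\<And>c r. emeasure M (ball c r) \<le> \<mu> (ball c r)"
    and fin: "codim1_hausdorff \<mu> S < \<infinity>" and S: "S \<subseteq> \<Omega>" and f: "continuous_on \<Omega> f"
    and \<delta>: "0 < \<delta>" and e: "0 < (e::real)"
  shows "\<exists>G\<in>borel_measurable borel. controls \<Omega> f \<delta> S G \<and> (\<integral>\<^sup>+x. G x \<partial>M) \<le> ennreal e"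
proof -
  obtain H where H: "codim1_hausdorff \<mu> S = ennreal H" "0 \<le> H"
    using fin by (cases "codim1_hausdorff \<mu> S") auto
  \<comment> \<open>The contents of the layers will sum to at most 2 H, H for each parity, and the
    slacks to 1; this choice gives \<open>2 * \<epsilon> * (2 * H + 1) \<le> e\<close>.\<close>
  define \<epsilon> where "\<epsilon> = e / (4 * (H + 1))"
  have \<epsilon>: "0 < \<epsilon>" using e H by (simp add: \<epsilon>_def)
  define good where "good k x \<longleftrightarrow> (\<forall>y\<in>\<Omega>. \<forall>z\<in>\<Omega>. dist x y < (1 / 2) ^ k \<longrightarrow> dist x z < (1 / 2) ^ k \<longrightarrow>
      dist (f y) (f z) \<le> \<epsilon>)" for k :: nat and x
  have ex: "\<exists>k. good k x" if "x \<in> S" for x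
  proof -
    have "x \<in> \<Omega>" "0 < \<epsilon> / 2" using S that \<epsilon> by auto
    with f have "\<exists>d>0. \<forall>y\<in>\<Omega>. dist y x < d \<longrightarrow> dist (f y) (f x) < \<epsilon> / 2"
      unfolding continuous_on_iff by blast
    then obtain d where d: "0 < d" "\<And>y. y \<in> \<Omega> \<Longrightarrow> dist y x < d \<Longrightarrow> dist (f y) (f x) < \<epsilon> / 2"
      by blast
    obtain k where k: "(1 / 2 :: real) ^ k < d"
      using real_arch_pow_inv[OF d(1), of "1 / 2"] by auto
    have "good k x"
      unfolding good_def
    proof (intro ballI impI)
      fix y z assume "y \<in> \<Omega>" "z \<in> \<Omega>" "dist x y < (1 / 2) ^ k" "dist x z < (1 / 2) ^ k"
      then have "dist (f y) (f x) < \<epsilon> / 2" "dist (f z) (f x) < \<epsilon> / 2"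
        using k d(2)[of y] d(2)[of z] by (auto simp: dist_commute)
      then show "dist (f y) (f z) \<le> \<epsilon>" using dist_triangle2[of "f y" "f z" "f x"] by linarith
    qed
    then show ?thesis ..
  qed
  define D where "D k = {x \<in> S. good k x \<and> (\<forall>j<k. \<not> good j x)}" for k
  have SD: "S = (\<Union>k. D k)"
  proof
    show "S \<subseteq> (\<Union>k. D k)"
    proof
      fix x assume x: "x \<in> S"
      have "x \<in> D (LEAST k. good k x)"
        using x LeastI_ex[OF ex[OF x]] not_less_Least by (auto simp: D_def)
      then show "x \<in> (\<Union>k. D k)" by blast
    qed
  qed (auto simp: D_def)
  \<comment> \<open>Were \<open>y\<close> closer to \<open>x\<close> than this, its ball of radius
    2^-(k+1) would lie in the good ball of \<open>x\<close>, and \<open>y\<close> would already be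
    good at level k + 1, before its own level k'.\<close>
  have sep1: "(1 / 2) ^ Suc k \<le> dist x y" if "x \<in> D k" "y \<in> D k'" "Suc (Suc k) \<le> k'" for k k' x y
  proof (rule ccontr)
    assume *: "\<not> ?thesis"
    have "good (Suc k) y"
      unfolding good_def
    proof (intro ballI impI)
      fix u v assume uv: "u \<in> \<Omega>" "v \<in> \<Omega>" "dist y u < (1 / 2) ^ Suc k" "dist y v < (1 / 2) ^ Suc k"
      have "dist x u < (1 / 2) ^ k" "dist x v < (1 / 2) ^ k"
        using * uv dist_triangle[of x u y] dist_triangle[of x v y] by auto
      then show "dist (f u) (f v) \<le> \<epsilon>" using that(1) uv by (auto simp: D_def good_def)
    qed
    moreover have "Suc k < k'" using that by simp
    ultimately show False using that(2) by (auto simp: D_def)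
  qed
  \<comment> \<open>Twice this radius is at most 2^-k, so goodness at level \<open>k\<close> covers
    every ball of radius \<open>\<rho> k\<close> that meets the layer.\<close>
  define \<rho> where "\<rho> k = min \<delta> ((1 / 2) ^ Suc k)" for k
  have \<rho>: "0 < \<rho> k" for k using \<delta> by (simp add: \<rho>_def)
  have parity: "(\<Sum>k\<in>K. codim1_content \<mu> (\<rho> k) (D k)) \<le> ennreal H"
    if K: "finite K" "\<And>k k'. k \<in> K \<Longrightarrow> k' \<in> K \<Longrightarrow> even (k + k')" for K
  proof -
    obtain m where m: "\<And>k. k \<in> K \<Longrightarrow> k \<le> m" using K(1) by (meson finite_nat_set_iff_bounded_le)
    \<comment> \<open>One scale for all of \<open>K\<close>: below every \<open>\<rho> k\<close>,
      and with 2 \<sigma> at most the separation 2^-(k+1) of distinct layers of equal parity up to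
      level \<open>m\<close>.\<close>
    define \<sigma> where "\<sigma> = min \<delta> ((1 / 2) ^ (Suc (Suc m)))"
    have \<sigma>: "0 < \<sigma>" using \<delta> by (simp add: \<sigma>_def)
    have pow: "(1 / 2 :: real) ^ (Suc m) \<le> (1 / 2) ^ Suc k" if "k \<in> K" for k
      using m[OF that] by (intro power_decreasing) auto
    have \<sigma>m: "2 * \<sigma> \<le> (1 / 2) ^ Suc m" by (auto simp: \<sigma>_def)
    have "\<sigma> \<le> \<rho> k" if "k \<in> K" for k
    proof -
      have "(1 / 2 :: real) ^ (Suc (Suc m)) \<le> (1 / 2) ^ Suc m" by simp
      then show ?thesis using pow[OF that] unfolding \<sigma>_def \<rho>_def by linarith
    qed
    then have "(\<Sum>k\<in>K. codim1_content \<mu> (\<rho> k) (D k)) \<le> (\<Sum>k\<in>K. codim1_content \<mu> \<sigma> (D k))"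
      by (intro sum_mono codim1_content_antimono)
    also have "\<dots> \<le> codim1_content \<mu> \<sigma> S"
    proof (rule sum_codim1_content_le[OF K(1)])
      fix k k' x y assume k: "k \<in> K" "k' \<in> K" "k \<noteq> k'" and xy: "x \<in> D k" "y \<in> D k'"
      have *: "2 * \<sigma> \<le> dist u v" if "u \<in> D i" "v \<in> D j" "i \<in> K" "j \<in> K" "i < j" for u v i j
      proof -
        have "even (i + j)" using K(2) that by blast
        then have "Suc (Suc i) \<le> j" using that(5) by presburger
        then show ?thesis using sep1[OF that(1,2)] pow[OF that(3)] \<sigma>m by linarith
      qed
      show "2 * \<sigma> \<le> dist x y"
        using *[OF xy k(1,2)] *[OF xy(2,1) k(2,1)] k(3) by (cases "k < k'") (auto simp: dist_commute)
    qed (auto simp: D_def)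
    also have "\<dots> \<le> ennreal H" using codim1_content_le_hausdorff[OF \<sigma>, of \<mu> S] H by simp
    finally show ?thesis .
  qed
  have tot: "(\<Sum>k. codim1_content \<mu> (\<rho> k) (D k)) \<le> ennreal (2 * H)"
  proof (rule suminf_le_const)
    fix n :: nat
    let ?c = "\<lambda>k. codim1_content \<mu> (\<rho> k) (D k)"
    have "sum ?c {..<n} = sum ?c {k. k < n \<and> even k} + sum ?c {k. k < n \<and> odd k}"
      by (subst sum.union_disjoint[symmetric]) (auto intro!: sum.cong)
    also have "\<dots> \<le> ennreal H + ennreal H"
      by (intro add_mono parity) auto
    also have "\<dots> = ennreal (2 * H)" using H by (simp add: ennreal_plus[symmetric] del: ennreal_plus)
    finally show "sum ?c {..<n} \<le> ennreal (2 * H)" .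
  qed auto
  have "\<exists>G\<in>borel_measurable borel. controls \<Omega> f \<delta> (D k) G \<and>
    (\<integral>\<^sup>+x. G x \<partial>M) \<le> ennreal (2 * \<epsilon>) * (codim1_content \<mu> (\<rho> k) (D k) + ennreal ((1 / 2) ^ Suc k))" for k
  proof (rule codim1_small_controls_aux[OF M])
    have "codim1_content \<mu> (\<rho> k) (D k) \<le> ennreal H" using parity[of "{k}"] by simp
    then show "codim1_content \<mu> (\<rho> k) (D k) < \<infinity>" by (auto intro: le_less_trans)
    fix x y z assume *: "x \<in> D k" "y \<in> \<Omega>" "z \<in> \<Omega>" "dist x y < 2 * \<rho> k" "dist x z < 2 * \<rho> k"
    have "2 * \<rho> k \<le> (1 / 2) ^ k" by (auto simp: \<rho>_def)
    then show "dist (f y) (f z) \<le> \<epsilon>" using * by (auto simp: D_def good_def)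
  qed (use \<rho> \<epsilon> S in \<open>auto simp: \<rho>_def D_def\<close>)
  then obtain G where G: "\<And>k. G k \<in> borel_measurable borel" "\<And>k. controls \<Omega> f \<delta> (D k) (G k)"
    "\<And>k. (\<integral>\<^sup>+x. G k x \<partial>M) \<le> ennreal (2 * \<epsilon>) * (codim1_content \<mu> (\<rho> k) (D k) + ennreal ((1 / 2) ^ Suc k))"
    by metis
  note [measurable] = G(1)
  have "controls \<Omega> f \<delta> S (\<lambda>x. \<integral>\<^sup>+k. G k x \<partial>count_space UNIV)"
    unfolding SD using G by (intro controls_UN) auto
  then have 1: "controls \<Omega> f \<delta> S (\<lambda>x. \<Sum>k. G k x)" by (simp add: nn_integral_count_space_nat)
  have GM: "G k \<in> borel_measurable M" for k
    by (subst measurable_cong_sets[OF M(1) refl]) simp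
  have "(\<integral>\<^sup>+x. (\<Sum>k. G k x) \<partial>M) = (\<Sum>k. \<integral>\<^sup>+x. G k x \<partial>M)"
    by (rule nn_integral_suminf[OF GM])
  also have "\<dots> \<le> (\<Sum>k. ennreal (2 * \<epsilon>) * (codim1_content \<mu> (\<rho> k) (D k) + ennreal ((1 / 2) ^ Suc k)))"
    using G(3) by (intro suminf_le) auto
  also have "\<dots> = ennreal (2 * \<epsilon>) * ((\<Sum>k. codim1_content \<mu> (\<rho> k) (D k)) + (\<Sum>k. ennreal ((1 / 2) ^ Suc k)))"
    by (subst suminf_add) auto
  also have "(\<Sum>k. ennreal ((1 / 2) ^ Suc k)) = ennreal 1"
    by (rule suminf_ennreal_eq[OF _ power_half_series]) auto
  also have "ennreal (2 * \<epsilon>) * ((\<Sum>k. codim1_content \<mu> (\<rho> k) (D k)) + ennreal 1) \<le>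
      ennreal (2 * \<epsilon>) * (ennreal (2 * H) + ennreal 1)"
    using tot by (intro mult_left_mono add_mono) auto
  also have "\<dots> = ennreal (2 * \<epsilon> * (2 * H + 1))"
    using H \<epsilon> by (simp add: ennreal_mult ennreal_plus)
  also have "2 * \<epsilon> * (2 * H + 1) \<le> e"
    using H e by (simp add: \<epsilon>_def field_simps)
  finally have "(\<integral>\<^sup>+x. (\<Sum>k. G k x) \<partial>M) \<le> ennreal e" by (simp add: ennreal_leI)
  with 1 show ?thesis by (intro bexI[of _ "\<lambda>x. \<Sum>k. G k x"]) auto
qed

section \<open>Covers adapted to the dilatation\<close>

text \<open>Whether \<open>x\<close> is chosen depends only on choices already made at R-smaller
  elements, so the greedy rule is a legitimate well-founded recursion, transfinite if
  necessary.\<close>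

lemma wf_greedy_selection:
  assumes "wf R"
  shows "\<exists>S. \<forall>x. x \<in> S \<longleftrightarrow> x \<in> A \<and> (\<forall>y\<in>S. (y, x) \<in> R \<longrightarrow> P y x)"
proof -
  define F where "F = (\<lambda>(g :: 'a \<Rightarrow> bool) x. x \<in> A \<and> (\<forall>y. (y, x) \<in> R \<longrightarrow> g y \<longrightarrow> P y x))"
  define S where "S = {x. wfrec R F x}"
  have eq: "wfrec R F x = F (cut (wfrec R F) R x) x" for x by (rule wfrec[OF assms])
  have "wfrec R F x \<longleftrightarrow> x \<in> A \<and> (\<forall>y. (y, x) \<in> R \<longrightarrow> wfrec R F y \<longrightarrow> P y x)" for x
    by (subst eq) (simp add: F_def cut_apply)
  then have "x \<in> S \<longleftrightarrow> x \<in> A \<and> (\<forall>y\<in>S. (y, x) \<in> R \<longrightarrow> P y x)" for x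
    unfolding S_def mem_Collect_eq Ball_def by blast
  then show ?thesis by blast
qed

text \<open>Radii are compared only up to a factor \<open>2\<close>, by grouping them into dyadic classes; this
  makes a greedy choice in order of decreasing radius well-founded.\<close>

lemma greedy_ball_cover:
  fixes A :: "'a::metric_space set" and r :: "'a \<Rightarrow> real"
  assumes r: "\<And>x. x \<in> A \<Longrightarrow> 0 < r x \<and> r x \<le> R"
  shows "\<exists>S. S \<subseteq> A \<and> A \<subseteq> (\<Union>x\<in>S. ball x (r x)) \<and>
    (\<forall>x\<in>S. \<forall>y\<in>S. x \<noteq> y \<longrightarrow> max (r x) (r y) \<le> dist x y \<or>
       (r x \<le> 2 * r y \<and> r y \<le> 2 * r x \<and> max (r x) (r y) \<le> 2 * dist x y))"
proof -
  obtain W :: "('a \<times> 'a) set" where W: "Well_order W" "Field W = UNIV"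
    using well_ordering[where ?'a = 'a] by (elim exE conjE)
  then have wfW: "wf (W - Id)" and totW: "total W"
    by (auto simp: well_order_on_def linear_order_on_def)
  \<comment> \<open>The dyadic class of the radius: \<open>r x\<close> lies between half of R 2^-n
    and R 2^-n.\<close>
  define n where "n x = nat \<lfloor>log 2 (R / r x)\<rfloor>" for x
  have n: "r x \<le> R * 2 powr - real (n x)" "R * 2 powr - real (n x) < 2 * r x" if "x \<in> A" for x
  proof -
    have pos: "0 < r x" "r x \<le> R" using r[OF that] by auto
    then have "0 \<le> log 2 (R / r x)" by simp
    then have "real (n x) \<le> log 2 (R / r x)" "log 2 (R / r x) < real (n x) + 1"
      unfolding n_def by linarith+
    then have "2 powr real (n x) \<le> R / r x" "R / r x < 2 powr (real (n x) + 1)"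
      using pos by (auto simp: le_log_iff log_less_iff)
    then show "r x \<le> R * 2 powr - real (n x)" "R * 2 powr - real (n x) < 2 * r x"
      using pos by (auto simp: powr_add powr_minus field_simps)
  qed
  \<comment> \<open>Larger balls come first, since a smaller class number means a larger radius;
    within a class a well-order of the space decides. Balls that are not separated by the larger
    radius must then come from the same class.\<close>
  define T where "T = inv_image (less_than <*lex*> (W - Id)) (\<lambda>x. (n x, x))"
  have "wf T" unfolding T_def by (intro wf_inv_image wf_lex_prod wf_less_than wfW)
  from wf_greedy_selection[OF this, of A "\<lambda>y x. r y \<le> dist y x"]
  obtain S where *: "\<forall>x. x \<in> S \<longleftrightarrow> x \<in> A \<and> (\<forall>y\<in>S. (y, x) \<in> T \<longrightarrow> r y \<le> dist y x)" ..
  have S: "x \<in> S \<longleftrightarrow> x \<in> A \<and> (\<forall>y\<in>S. (y, x) \<in> T \<longrightarrow> r y \<le> dist y x)" for x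
    by (rule spec[OF *])
  show ?thesis
  proof (intro exI[of _ S] conjI ballI impI)
    show "S \<subseteq> A" using S by blast
    show "A \<subseteq> (\<Union>x\<in>S. ball x (r x))"
    proof
      fix x assume x: "x \<in> A"
      show "x \<in> (\<Union>x\<in>S. ball x (r x))"
      proof (cases "x \<in> S")
        case True
        then show ?thesis using r[OF x] by (intro UN_I[of x]) auto
      next
        case False
        then obtain y where "y \<in> S" "dist y x < r y" using S x not_le by blast
        then show ?thesis by auto
      qed
    qed
    fix x y assume xy: "x \<in> S" "y \<in> S" "x \<noteq> y"
    have main: "max (r x) (r y) \<le> dist x y \<or>
        (r x \<le> 2 * r y \<and> r y \<le> 2 * r x \<and> max (r x) (r y) \<le> 2 * dist x y)"
      if "x \<in> S" "y \<in> S" "(y, x) \<in> T" for x y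
    proof -
      have A: "x \<in> A" "y \<in> A" using that S by blast+
      have d: "r y \<le> dist x y" using S that by (metis dist_commute)
      have "n y < n x \<or> n y = n x" using that(3) by (auto simp: T_def)
      then show ?thesis
      proof
        assume "n y < n x"
        then have "R * 2 powr - real (n x) \<le> R * 2 powr (- real (n y) - 1)"
          using r[OF A(1)] by (intro mult_left_mono powr_mono) auto
        also have "\<dots> = R * 2 powr - real (n y) / 2" by (simp add: powr_diff)
        also have "\<dots> < r y" using n[OF A(2)] by simp
        finally have "r x \<le> r y" using n[OF A(1)] by simp
        then show ?thesis using d by simp
      next
        assume "n y = n x"
        then have "r x \<le> 2 * r y" "r y \<le> 2 * r x" using n[OF A(1)] n[OF A(2)] by auto
        then show ?thesis using d by auto
      qed
    qed
    have "(x, y) \<in> T \<or> (y, x) \<in> T"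
      using totW xy(3) W(2) by (auto simp: T_def total_on_def)
    then show "max (r x) (r y) \<le> dist x y \<or>
        (r x \<le> 2 * r y \<and> r y \<le> 2 * r x \<and> max (r x) (r y) \<le> 2 * dist x y)"
      using main[of x y] main[of y x] xy by (auto simp: dist_commute max.commute)
  qed
qed

lemma countable_disjoint_family_positive_measure:
  assumes fin: "emeasure M V < \<infinity>" and V: "V \<in> sets M"
    and B: "\<And>x. x \<in> S \<Longrightarrow> B x \<in> sets M \<and> B x \<subseteq> V \<and> 0 < emeasure M (B x)"
    and disj: "disjoint_family_on B S"
  shows "countable S"
proof -
  have le: "emeasure M (B x) \<le> emeasure M V" if "x \<in> S" for x
    using B[OF that] V by (intro emeasure_mono) auto
  have eq: "emeasure M (B x) = ennreal (measure M (B x))" if "x \<in> S" for x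
    using le[OF that] fin by (intro emeasure_eq_ennreal_measure) (auto simp: top_unique)
  have "(\<lambda>x. measure M (B x)) summable_on S"
  proof (rule nonneg_bdd_above_summable_on)
    show "bdd_above (sum (\<lambda>x. measure M (B x)) ` {F. F \<subseteq> S \<and> finite F})"
    proof (rule bdd_aboveI2)
      fix F assume "F \<in> {F. F \<subseteq> S \<and> finite F}"
      then have F: "F \<subseteq> S" "finite F" by auto
      have "ennreal (sum (\<lambda>x. measure M (B x)) F) = (\<Sum>x\<in>F. emeasure M (B x))"
        using F eq by (subst sum_ennreal[symmetric]) (auto intro!: sum.cong simp del: sum_ennreal)
      also have "\<dots> = emeasure M (\<Union>x\<in>F. B x)"
        using F B disj by (intro sum_emeasure) (auto intro: disjoint_family_on_mono)
      also have "\<dots> \<le> emeasure M V" using F B V by (intro emeasure_mono) auto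
      also have "\<dots> = ennreal (measure M V)" using fin by (intro emeasure_eq_ennreal_measure) auto
      finally show "sum (\<lambda>x. measure M (B x)) F \<le> measure M V"
        by (simp add: ennreal_le_iff)
    qed
  qed auto
  then have "countable {x \<in> S. measure M (B x) \<noteq> 0}" by (rule summable_countable_real)
  moreover have "measure M (B x) \<noteq> 0" if "x \<in> S" for x
    using B[OF that] eq[OF that] by auto
  ultimately show ?thesis by (metis (mono_tags, lifting) Collect_cong Collect_mem_eq)
qed

lemma emeasure_count_space_le:
  assumes "A \<subseteq> S" and "\<And>F. finite F \<Longrightarrow> F \<subseteq> A \<Longrightarrow> real (card F) \<le> N"
  shows "emeasure (count_space S) A \<le> ennreal N"
proof -
  have "finite A"
  proof (rule ccontr)
    assume "infinite A"
    then obtain F where "finite F" "F \<subseteq> A" "card F = Suc (nat \<lceil>N\<rceil>)"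
      by (meson infinite_arbitrarily_large)
    then show False using assms(2)[of F] by linarith
  qed
  then show ?thesis using assms by (simp add: emeasure_count_space ennreal_of_nat_eq_real_of_nat ennreal_leI)
qed

section \<open>The geometry and the mass of a single ball\<close>

lemma ball_subset_ballI: "dist x y + r \<le> s \<Longrightarrow> ball y r \<subseteq> ball x s"
proof
  fix z assume "dist x y + r \<le> s" "z \<in> ball y r"
  then show "z \<in> ball x s" using dist_triangle[of x z y] by simp
qed

text \<open>The case of large slope. The hypotheses \<open>L\<close> and \<open>big\<close> give r <
  a / (T P) with a = w h l; inserting this into r^(Q-1) trades the radius in the domain for the one
  in the image. The factor \<open>4 powr Q\<close> passes from \<open>l\<close> to
  \<open>l / 4\<close>, the radius for which the image balls overlap boundedly, and \<open>c\<close>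
  is kept so that the last factor is literally the lower bound for the image measure.\<close>

lemma selection_estimate:
  fixes Q w h P r T c D L l :: real
  assumes Q: "1 < Q" and pos: "0 < w" "0 < h" "0 < P" "0 < r" "0 < T" "0 < c" "0 < D" "0 \<le> l"
    and L: "L \<le> 2 * h * l" and big: "2 * T * P / w < L / r"
  shows "L / r * (D * w * r powr Q) \<le>
    2 * D * 4 powr Q / c * T powr (1 - Q) * (c * (w * h) powr Q / P powr (Q - 1) * (l / 4) powr Q)"
proof -
  define a where "a = w * h * l"
  have "w * (2 * T * P / w) < w * (L / r)" using big pos by (intro mult_strict_left_mono) auto
  then have "2 * (T * P * r) < w * L" using pos by (simp add: field_simps)
  also have "w * L \<le> w * (2 * h * l)" using L pos by (intro mult_left_mono) auto
  finally have a: "T * P * r < a" by (simp add: a_def)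
  have TPr: "0 < T * P * r" using pos by simp
  then have a0: "0 < a" using a by linarith
  then have l0: "0 < l" using pos by (auto simp: a_def zero_less_mult_iff)
  have "L / r * (D * w * r powr Q) = D * (w * L) * r powr (Q - 1)"
    using pos by (simp add: powr_diff field_simps)
  also have "\<dots> \<le> D * (2 * a) * r powr (Q - 1)"
    using \<open>w * L \<le> w * (2 * h * l)\<close> pos
    by (intro mult_right_mono mult_left_mono) (auto simp: a_def mult_ac)
  also have "r powr (Q - 1) \<le> (a / (T * P)) powr (Q - 1)"
    using a pos Q by (intro powr_mono2) (auto simp: field_simps)
  then have "D * (2 * a) * r powr (Q - 1) \<le> D * (2 * a) * (a / (T * P)) powr (Q - 1)"
    using pos a0 by (intro mult_left_mono) auto
  also have "(a / (T * P)) powr (Q - 1) = a powr Q / a * T powr (1 - Q) / P powr (Q - 1)"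
  proof -
    have "(a / (T * P)) powr (Q - 1) = a powr (Q - 1) / (T powr (Q - 1) * P powr (Q - 1))"
      using pos a0 by (simp add: powr_divide powr_mult)
    also have "T powr (1 - Q) = 1 / T powr (Q - 1)"
      using powr_minus_divide[of T "Q - 1"] by simp
    then have "a powr (Q - 1) / (T powr (Q - 1) * P powr (Q - 1)) = a powr (Q - 1) * T powr (1 - Q) / P powr (Q - 1)"
      by simp
    also have "a powr (Q - 1) = a powr Q / a" using a0 by (simp add: powr_diff)
    finally show ?thesis .
  qed
  also have "D * (2 * a) * (a powr Q / a * T powr (1 - Q) / P powr (Q - 1)) =
      2 * D * T powr (1 - Q) * a powr Q / P powr (Q - 1)"
    using a0 by (simp add: field_simps)
  also have "a powr Q = (w * h) powr Q * (4 powr Q * (l / 4) powr Q)"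
    using pos l0 unfolding a_def by (simp add: powr_mult powr_divide)
  also have "2 * D * T powr (1 - Q) * ((w * h) powr Q * (4 powr Q * (l / 4) powr Q)) / P powr (Q - 1) =
      2 * D * 4 powr Q / c * T powr (1 - Q) * (c * (w * h) powr Q / P powr (Q - 1) * (l / 4) powr Q)"
    using pos by simp
  finally show ?thesis .
qed

text \<open>A lower limit below \<open>2 * h\<close> gives ratios below \<open>2 * h\<close> at
  arbitrarily small radii, and continuity makes \<open>L\<close> small there. The last conclusion
  says that the preimage of the ball of radius \<open>l\<close> lies in the ball of radius
  \<open>r\<close>.\<close>

lemma dil_H_radius:
  fixes f :: "'a::metric_space \<Rightarrow> 'b::metric_space"
  assumes f: "continuous_on \<Omega> f" and x: "x \<in> \<Omega>"
    and h: "1 \<le> h" "dil_h \<Omega> f x < ennreal (2 * h)" and e: "0 < \<epsilon>" "0 < s"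
  obtains r L l where "0 < r" "r < \<epsilon>" "0 \<le> L" "L < s" "0 \<le> l" "l \<le> L" "L \<le> 2 * h * l"
    "\<And>y. y \<in> \<Omega> \<Longrightarrow> dist y x \<le> r \<Longrightarrow> dist (f y) (f x) \<le> L"
    "\<And>y. y \<in> \<Omega> \<Longrightarrow> dist (f y) (f x) < l \<Longrightarrow> dist y x < r"
proof -
  have "\<exists>d>0. \<forall>y\<in>\<Omega>. dist y x < d \<longrightarrow> dist (f y) (f x) < s / 2"
    using f x e unfolding continuous_on_iff by (meson half_gt_zero)
  then obtain d where d: "0 < d" "\<And>y. y \<in> \<Omega> \<Longrightarrow> dist y x < d \<Longrightarrow> dist (f y) (f x) < s / 2"
    by blast
  have "\<not> eventually (\<lambda>r. ennreal (2 * h) \<le> dil_H \<Omega> f x r) (at_right 0)"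
  proof
    assume "eventually (\<lambda>r. ennreal (2 * h) \<le> dil_H \<Omega> f x r) (at_right 0)"
    then have "ennreal (2 * h) \<le> dil_h \<Omega> f x" unfolding dil_h_def by (rule Liminf_bounded)
    with h(2) show False by simp
  qed
  then have "\<exists>\<^sub>F r in at_right 0. dil_H \<Omega> f x r < ennreal (2 * h)"
    by (simp add: frequently_def not_less)
  moreover have "eventually (\<lambda>r. 0 < r \<and> r < min \<epsilon> d) (at_right (0::real))"
    using e d by (auto simp: eventually_at_right_field intro!: exI[of _ "min \<epsilon> d"])
  ultimately have "\<exists>\<^sub>F r in at_right 0. dil_H \<Omega> f x r < ennreal (2 * h) \<and> 0 < r \<and> r < min \<epsilon> d"
    by (rule frequently_eventually_frequently)
  then obtain r where r: "dil_H \<Omega> f x r < ennreal (2 * h)" "0 < r" "r < \<epsilon>" "r < d"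
    by (auto dest: frequently_ex)
  let ?L = "dil_L \<Omega> f x r" and ?l = "dil_l \<Omega> f x r"
  have "?L \<le> ennreal (s / 2)"
    unfolding dil_L_def using d(2) r by (intro SUP_least ennreal_leI) (auto intro!: less_imp_le)
  then obtain L where L: "?L = ennreal L" "0 \<le> L" "L \<le> s / 2"
    using e by (cases ?L) (auto simp: top_unique ennreal_le_iff)
  have l0: "?l \<noteq> 0" using r(1) by (auto simp: dil_H_def)
  \<comment> \<open>\<open>dil_l\<close> is infinite when \<Omega> has no point at distance at least
    \<open>r\<close>. Capping it by \<open>dil_L\<close> makes it real; the ratio bound survives
    because \<open>1 \<le> h\<close>.\<close>
  define l where "l = enn2real (min ?l ?L)"
  have l: "ennreal l = min ?l (ennreal L)" unfolding l_def L(1) by (cases ?l) (auto simp: min_def top_unique)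
  have "?L \<le> ennreal (2 * h) * ?l"
  proof (cases "?l = \<infinity>")
    case True
    then show ?thesis using h by (simp add: ennreal_mult_top)
  next
    case False
    have "?L / ?l < ennreal (2 * h)" using r(1) l0 by (simp add: dil_H_def)
    then have "?L / ?l * ?l \<le> ennreal (2 * h) * ?l" by (intro mult_right_mono) auto
    also have "?L / ?l * ?l = ?L" using l0 False
      by (metis ennreal_divide_times ennreal_divide_self mult.right_neutral infinity_ennreal_def top.not_eq_extremum ennreal_times_divide mult.commute)
    finally show ?thesis .
  qed
  moreover have "?L \<le> ennreal (2 * h) * ?L"
  proof -
    have "ennreal 1 * ?L \<le> ennreal (2 * h) * ?L" using h by (intro mult_right_mono ennreal_leI) auto
    then show ?thesis by simp
  qed
  ultimately have "ennreal L \<le> ennreal (2 * h) * ennreal l"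
    unfolding l L(1) by (simp add: min_def)
  also have "\<dots> = ennreal (2 * h * l)" using h by (simp add: ennreal_mult l_def)
  finally have Ll: "L \<le> 2 * h * l" using h by (simp add: ennreal_le_iff l_def)
  show thesis
  proof (rule that[of r L l])
    have "ennreal l \<le> ennreal L" unfolding l by simp
    then show "l \<le> L" using L by (simp add: ennreal_le_iff)
    show "dist (f y) (f x) \<le> L" if "y \<in> \<Omega>" "dist y x \<le> r" for y
    proof -
      have "ennreal (dist (f y) (f x)) \<le> ?L" unfolding dil_L_def using that by (intro SUP_upper) auto
      then show ?thesis using L by (simp add: ennreal_le_iff)
    qed
    show "dist y x < r" if y: "y \<in> \<Omega>" "dist (f y) (f x) < l" for y
    proof (rule ccontr)
      assume "\<not> dist y x < r"
      then have "?l \<le> ennreal (dist (f y) (f x))" unfolding dil_l_def using y by (intro INF_lower) auto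
      moreover have "ennreal l \<le> ?l" unfolding l by simp
      ultimately have "ennreal l \<le> ennreal (dist (f y) (f x))" by (rule order_trans[rotated])
      then show False using y by (simp add: ennreal_le_iff)
    qed
  qed (use r L e Ll in \<open>auto simp: l_def\<close>)
qed

text \<open>Here \<open>t x\<close> is the slope L / r, \<open>v x\<close> the mass of an image
  ball, \<open>V\<close> the total image budget and \<open>U x\<close> a neighbourhood that has to
  contain the ball. The threshold T is quantified inside: one cover must serve every T, since
  uniform integrability chooses T after the cover. The bound on \<open>100 * r x\<close> leaves room
  to enlarge balls within the range of the Ahlfors estimates.\<close>

definition qc_cover ::
    "real \<Rightarrow> real \<Rightarrow> real \<Rightarrow> ennreal \<Rightarrow> real \<Rightarrow> real \<Rightarrow> 'a::metric_space measure \<Rightarrow> 'a set \<Rightarrow> ('a \<Rightarrow> 'b::metric_space) \<Rightarrow>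
      'a set \<Rightarrow> ('a \<Rightarrow> 'a set) \<Rightarrow> ('a \<Rightarrow> real) \<Rightarrow> ('a \<Rightarrow> real) \<Rightarrow>
      'a set \<Rightarrow> ('a \<Rightarrow> real) \<Rightarrow> ('a \<Rightarrow> real) \<Rightarrow> ('a \<Rightarrow> ennreal) \<Rightarrow> bool" where
  "qc_cover Q D C\<^sub>1 V \<delta> R\<^sub>0 m \<Omega> f A U w P S r t v \<longleftrightarrow>
     countable S \<and> S \<subseteq> A \<and> A \<subseteq> (\<Union>x\<in>S. ball x (r x)) \<and>
     (\<forall>x\<in>S. 0 < r x \<and> r x < \<delta> \<and> 100 * r x < R\<^sub>0 \<and> ball x (r x) \<subseteq> U x) \<and>
     (\<forall>x\<in>S. 0 \<le> t x) \<and>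
     (\<forall>x\<in>S. \<forall>y\<in>\<Omega> \<inter> ball x (r x). dist (f y) (f x) \<le> t x * r x) \<and>
     disjoint_family_on (\<lambda>x. ball x (r x / 5)) S \<and>
     (\<forall>x\<in>S. emeasure m (ball x (2 * r x)) \<le> ennreal (D * w x * r x powr Q)) \<and>
     (\<forall>x\<in>S. \<forall>T>0. 2 * T * P x / w x < t x \<longrightarrow>
        ennreal (t x) * emeasure m (ball x (2 * r x)) \<le> ennreal (C\<^sub>1 * T powr (1 - Q)) * v x) \<and>
     (\<integral>\<^sup>+x. v x \<partial>count_space S) \<le> V"

lemma qc_coverD:
  assumes "qc_cover Q D C\<^sub>1 V \<delta> R\<^sub>0 m \<Omega> f A U w P S r t v"
  shows "countable S" "S \<subseteq> A" "A \<subseteq> (\<Union>x\<in>S. ball x (r x))"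
    "\<And>x. x \<in> S \<Longrightarrow> 0 < r x \<and> r x < \<delta> \<and> 100 * r x < R\<^sub>0 \<and> ball x (r x) \<subseteq> U x"
    "\<And>x. x \<in> S \<Longrightarrow> 0 \<le> t x"
    "\<And>x y. x \<in> S \<Longrightarrow> y \<in> \<Omega> \<inter> ball x (r x) \<Longrightarrow> dist (f y) (f x) \<le> t x * r x"
    "disjoint_family_on (\<lambda>x. ball x (r x / 5)) S"
    "\<And>x. x \<in> S \<Longrightarrow> emeasure m (ball x (2 * r x)) \<le> ennreal (D * w x * r x powr Q)"
    "\<And>x T. x \<in> S \<Longrightarrow> 0 < T \<Longrightarrow> 2 * T * P x / w x < t x \<Longrightarrow>
      ennreal (t x) * emeasure m (ball x (2 * r x)) \<le> ennreal (C\<^sub>1 * T powr (1 - Q)) * v x"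
    "(\<integral>\<^sup>+x. v x \<partial>count_space S) \<le> V"
  using assms unfolding qc_cover_def by simp_all

text \<open>The smaller balls \<open>ball x (r x / 5)\<close> are disjoint, while the image balls carrying \<open>v x\<close>
  overlap boundedly: if two of them meet, then one of the centres lies in the domain ball of the
  other, so that their radii are comparable.\<close>

lemma quasiconformal_cover:
  fixes M\<^sub>0 m :: "'a::metric_space measure" and \<kappa> :: "'b::metric_space measure"
    and f :: "'a \<Rightarrow> 'b" and w h P :: "'a \<Rightarrow> real" and Q C\<^sub>0 R\<^sub>0 c \<delta> :: real
  defines "D \<equiv> 2 * C\<^sub>0 * 2 powr Q"
  assumes Q: "1 < Q" and C0: "1 \<le> C\<^sub>0" and R0: "0 < R\<^sub>0" and c: "0 < c" and \<delta>: "0 < \<delta>"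
    and low: "\<And>x r. 0 < r \<Longrightarrow> r < R\<^sub>0 \<Longrightarrow> ennreal (r powr Q / C\<^sub>0) \<le> emeasure M\<^sub>0 (ball x r)"
    and up: "\<And>x r. 0 < r \<Longrightarrow> r < R\<^sub>0 \<Longrightarrow> emeasure M\<^sub>0 (ball x r) \<le> ennreal (C\<^sub>0 * r powr Q)"
    and fin: "\<And>x r. emeasure M\<^sub>0 (ball x r) < \<infinity>"
    and M0: "sets borel \<subseteq> sets M\<^sub>0" and \<kappa>: "sets borel \<subseteq> sets \<kappa>"
    and f: "continuous_on \<Omega> f" and A: "A \<subseteq> \<Omega>" and bdd: "bounded \<Omega>"
    and pos: "\<And>x. x \<in> A \<Longrightarrow> 0 < w x \<and> 1 \<le> h x \<and> 0 < P x"
    and dens: "\<And>x. x \<in> A \<Longrightarrow> \<exists>r1>0. \<forall>r. 0 < r \<and> r < r1 \<longrightarrow>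
      emeasure m (ball x r) \<le> ennreal (2 * w x) * emeasure M\<^sub>0 (ball x r)"
    and dil: "\<And>x. x \<in> A \<Longrightarrow> dil_h \<Omega> f x < ennreal (2 * h x)"
    and im: "\<And>x. x \<in> A \<Longrightarrow> \<exists>s1>0. \<forall>s. 0 < s \<and> s < s1 \<longrightarrow>
      ennreal (c * (w x * h x) powr Q / P x powr (Q - 1) * s powr Q) \<le> emeasure \<kappa> (ball (f x) s)"
    and W: "open W" "f ` A \<subseteq> W" and U: "\<And>x. x \<in> A \<Longrightarrow> open (U x) \<and> x \<in> U x"
  shows "\<exists>S r t v. qc_cover Q D (2 * D * 4 powr Q / c) (ennreal (C\<^sub>0\<^sup>2 * 24 powr Q) * emeasure \<kappa> W)
    \<delta> R\<^sub>0 m \<Omega> f A U w P S r t v"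
proof -
  have D: "0 < D" using C0 by (simp add: D_def)
  define good where "good x r L l \<longleftrightarrow> 0 < r \<and> r < \<delta> \<and> 100 * r < R\<^sub>0 \<and> ball x r \<subseteq> U x \<and> 0 \<le> L \<and> 0 \<le> l \<and> L \<le> 2 * h x * l \<and>
      ball (f x) l \<subseteq> W \<and>
      emeasure m (ball x (2 * r)) \<le> ennreal (2 * w x) * emeasure M\<^sub>0 (ball x (2 * r)) \<and>
      (0 < l \<longrightarrow> ennreal (c * (w x * h x) powr Q / P x powr (Q - 1) * (l / 4) powr Q) \<le> emeasure \<kappa> (ball (f x) (l / 4))) \<and>
      (\<forall>y\<in>\<Omega>. dist y x \<le> r \<longrightarrow> dist (f y) (f x) \<le> L) \<and>
      (\<forall>y\<in>\<Omega>. dist (f y) (f x) < l \<longrightarrow> dist y x < r)" for x r L l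
  have "\<exists>r L l. good x r L l" if x: "x \<in> A" for x
  proof -
    obtain r1 where r1: "0 < r1" "\<And>r. 0 < r \<Longrightarrow> r < r1 \<Longrightarrow>
        emeasure m (ball x r) \<le> ennreal (2 * w x) * emeasure M\<^sub>0 (ball x r)"
      using dens[OF x] by blast
    obtain s1 where s1: "0 < s1" "\<And>s. 0 < s \<Longrightarrow> s < s1 \<Longrightarrow>
        ennreal (c * (w x * h x) powr Q / P x powr (Q - 1) * s powr Q) \<le> emeasure \<kappa> (ball (f x) s)"
      using im[OF x] by blast
    obtain u where u: "0 < u" "ball x u \<subseteq> U x" using U[OF x] by (meson open_contains_ball)
    have "f x \<in> W" using W(2) x by blast
    then obtain q where q: "0 < q" "ball (f x) q \<subseteq> W" using W(1) by (meson open_contains_ball)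
    have "0 < min (min \<delta> (R\<^sub>0 / 100)) (min u (r1 / 2))" using \<delta> R0 u r1 by simp
    moreover have "0 < min s1 q" using s1 q by simp
    moreover have "x \<in> \<Omega>" "1 \<le> h x" using A pos x by auto
    ultimately obtain r L l where rL: "0 < r" "r < min (min \<delta> (R\<^sub>0 / 100)) (min u (r1 / 2))"
      "0 \<le> L" "L < min s1 q" "0 \<le> l" "l \<le> L" "L \<le> 2 * h x * l"
      "\<And>y. y \<in> \<Omega> \<Longrightarrow> dist y x \<le> r \<Longrightarrow> dist (f y) (f x) \<le> L"
      "\<And>y. y \<in> \<Omega> \<Longrightarrow> dist (f y) (f x) < l \<Longrightarrow> dist y x < r"
      using dil_H_radius[OF f _ _ dil[OF x]] by metis
    have "ball x r \<subseteq> ball x u" using rL(2) by (intro subset_ball) simp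
    moreover have "ball (f x) l \<subseteq> ball (f x) q" using rL by (intro subset_ball) simp
    ultimately have "good x r L l"
      unfolding good_def using rL u(2) q(2) r1(2)[of "2 * r"] s1(2)[of "l / 4"] by (simp, blast)
    then show ?thesis by blast
  qed
  then have "\<forall>x. \<exists>r L l. x \<in> A \<longrightarrow> good x r L l" by blast
  then obtain r L l where G: "x \<in> A \<Longrightarrow> good x (r x) (L x) (l x)" for x
    by metis
  note G' = G[unfolded good_def]
  have rad: "0 < r x \<and> r x < \<delta> \<and> 100 * r x < R\<^sub>0 \<and> ball x (r x) \<subseteq> U x" if "x \<in> A" for x
    using G'[OF that] by simp
  have L: "0 \<le> L x \<and> 0 \<le> l x \<and> L x \<le> 2 * h x * l x" if "x \<in> A" for x
    using G'[OF that] by simp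
  have lW: "ball (f x) (l x) \<subseteq> W" if "x \<in> A" for x
    using G'[OF that] by simp
  have mass: "emeasure m (ball x (2 * r x)) \<le> ennreal (2 * w x) * emeasure M\<^sub>0 (ball x (2 * r x))"
    if "x \<in> A" for x
    using G'[OF that] by simp
  have vol: "ennreal (c * (w x * h x) powr Q / P x powr (Q - 1) * (l x / 4) powr Q)
      \<le> emeasure \<kappa> (ball (f x) (l x / 4))" if "x \<in> A" "0 < l x" for x
    using G'[OF that(1)] that(2) by (elim conjE) (erule mp)
  have fL: "dist (f y) (f x) \<le> L x" if "x \<in> A" "y \<in> \<Omega>" "dist y x \<le> r x" for x y
    using G'[OF that(1)] that(2,3) by (elim conjE) blast
  have fl: "dist y x < r x" if "x \<in> A" "y \<in> \<Omega>" "dist (f y) (f x) < l x" for x y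
    using G'[OF that(1)] that(2,3) by (elim conjE) blast
  have r': "0 < r x \<and> r x \<le> \<delta>" if "x \<in> A" for x using rad[OF that] by auto
  obtain S where S: "S \<subseteq> A" "A \<subseteq> (\<Union>x\<in>S. ball x (r x))"
    and sep: "\<And>x y. x \<in> S \<Longrightarrow> y \<in> S \<Longrightarrow> x \<noteq> y \<Longrightarrow> max (r x) (r y) \<le> dist x y \<or>
       (r x \<le> 2 * r y \<and> r y \<le> 2 * r x \<and> max (r x) (r y) \<le> 2 * dist x y)"
  proof -
    have "\<exists>S. S \<subseteq> A \<and> A \<subseteq> (\<Union>x\<in>S. ball x (r x)) \<and>
      (\<forall>x\<in>S. \<forall>y\<in>S. x \<noteq> y \<longrightarrow> max (r x) (r y) \<le> dist x y \<or>
         (r x \<le> 2 * r y \<and> r y \<le> 2 * r x \<and> max (r x) (r y) \<le> 2 * dist x y))"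
      by (rule greedy_ball_cover) (rule r')
    then show thesis by (elim exE conjE) (rule that, assumption+, blast)
  qed
  have SA: "x \<in> A" if "x \<in> S" for x using S that by blast
  have r0: "0 < r x" "r x < \<delta>" "100 * r x < R\<^sub>0" if "x \<in> S" for x using rad[OF SA[OF that]] by auto
  have disj: "disjoint_family_on (\<lambda>x. ball x (r x / 5)) S"
    unfolding disjoint_family_on_def
  proof (intro ballI impI)
    fix x y assume xy: "x \<in> S" "y \<in> S" "x \<noteq> y"
    have "max (r x) (r y) \<le> 2 * dist x y"
      using sep[OF xy] by (auto intro: order_trans[OF _ mult_right_mono[of 1 2 "dist x y"]])
    then have "r x / 5 + r y / 5 \<le> dist x y" using zero_le_dist[of x y] by linarith
    then show "ball x (r x / 5) \<inter> ball y (r y / 5) = {}"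
      using disjoint_ballI by blast
  qed
  obtain x0 a where a: "\<Omega> \<subseteq> ball x0 a"
    using bdd bounded_subset_ballD by blast
  have cS: "countable S"
  proof (rule countable_disjoint_family_positive_measure[OF _ _ _ disj])
    show "emeasure M\<^sub>0 (ball x0 (a + \<delta>)) < \<infinity>" by (rule fin)
    show "ball x0 (a + \<delta>) \<in> sets M\<^sub>0" using M0 by auto
    fix x assume x: "x \<in> S"
    have "ball x (r x / 5) \<subseteq> ball x0 (a + \<delta>)"
    proof (rule ball_subset_ballI)
      have "x \<in> ball x0 a" using a SA[OF x] A by blast
      then show "dist x0 x + r x / 5 \<le> a + \<delta>" using r0[OF x] by simp
    qed
    moreover have "0 < ennreal ((r x / 5) powr Q / C\<^sub>0)" using r0[OF x] C0 by simp
    then have "0 < emeasure M\<^sub>0 (ball x (r x / 5))"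
      by (rule less_le_trans) (use r0[OF x] in \<open>intro low; simp\<close>)
    ultimately show "ball x (r x / 5) \<in> sets M\<^sub>0 \<and> ball x (r x / 5) \<subseteq> ball x0 (a + \<delta>) \<and>
        0 < emeasure M\<^sub>0 (ball x (r x / 5))" using M0 by auto
  qed
  define v where "v x = emeasure \<kappa> (ball (f x) (l x / 4))" for x
  have overlap: "emeasure (count_space S) {x \<in> S. y \<in> ball (f x) (l x / 4)} \<le> ennreal (C\<^sub>0\<^sup>2 * 24 powr Q)" for y
  proof (rule emeasure_count_space_le)
    fix F assume F: "finite F" "F \<subseteq> {x \<in> S. y \<in> ball (f x) (l x / 4)}"
    have comp: "r x \<le> 2 * r z" "r z \<le> 2 * r x" "max (r x) (r z) \<le> 2 * dist x z" "dist x z < max (r x) (r z)"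
      if xz: "x \<in> F" "z \<in> F" "x \<noteq> z" for x z
    proof -
      have m: "x \<in> S" "z \<in> S" "dist (f x) y < l x / 4" "dist (f z) y < l z / 4" using F xz by auto
      have "dist (f x) (f z) < l x / 4 + l z / 4"
        using m dist_triangle2[of "f x" "f z" y] by linarith
      then have *: "dist (f x) (f z) < l x \<or> dist (f z) (f x) < l z"
        using L[OF SA[OF m(1)]] L[OF SA[OF m(2)]] by (auto simp: dist_commute)
      have xO: "x \<in> \<Omega>" "z \<in> \<Omega>" using A SA[OF m(1)] SA[OF m(2)] by auto
      show less: "dist x z < max (r x) (r z)"
        using * fl[OF SA[OF m(1)] xO(2)] fl[OF SA[OF m(2)] xO(1)] by (auto simp: dist_commute)
      \<comment> \<open>This excludes the first alternative of the greedy cover, and the second is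
        exactly comparability of the radii.\<close>
      then show "r x \<le> 2 * r z" "r z \<le> 2 * r x" "max (r x) (r z) \<le> 2 * dist x z"
        using sep[OF m(1,2) xz(3)] by auto
    qed
    show "real (card F) \<le> C\<^sub>0\<^sup>2 * 24 powr Q"
    proof (cases "F = {}")
      case True
      then show ?thesis by simp
    next
      case False
      then obtain x where x: "x \<in> F" by blast
      then have xS: "x \<in> S" using F by auto
      define \<rho> where "\<rho> = r x"
      have \<rho>: "0 < \<rho>" "100 * \<rho> < R\<^sub>0" using r0[OF xS] by (auto simp: \<rho>_def)
      have near: "ball z (\<rho> / 8) \<subseteq> ball x (3 * \<rho>)" if "z \<in> F" for z
      proof (cases "z = x")
        case True
        then show ?thesis using \<rho> by (auto intro!: subset_ball)
      next
        case False
        then have "dist x z < 2 * \<rho>" using comp[OF x that] \<rho> by (auto simp: \<rho>_def)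
        then show ?thesis using \<rho> by (intro ball_subset_ballI) simp
      qed
      have dF: "disjoint_family_on (\<lambda>z. ball z (\<rho> / 8)) F"
        unfolding disjoint_family_on_def
      proof (intro ballI impI)
        fix y z assume yz: "y \<in> F" "z \<in> F" "y \<noteq> z"
        have "\<rho> / 2 \<le> r y" using comp[OF x yz(1)] \<rho> by (cases "y = x") (auto simp: \<rho>_def)
        then have "\<rho> / 8 + \<rho> / 8 \<le> dist y z" using comp(3)[OF yz] by auto
        then show "ball y (\<rho> / 8) \<inter> ball z (\<rho> / 8) = {}" using disjoint_ballI by blast
      qed
      \<comment> \<open>A volume count: the balls of radius \<rho> / 8 about the points of
        \<open>F\<close> are disjoint and lie in a ball of radius 3 \<rho>, which is 24 times as
        large. The two Ahlfors bounds contribute the square of \<open>C\<^sub>0\<close>.\<close>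
      have "ennreal (real (card F) * ((\<rho> / 8) powr Q / C\<^sub>0)) = (\<Sum>z\<in>F. ennreal ((\<rho> / 8) powr Q / C\<^sub>0))"
        using C0 by (subst ennreal_mult) (auto simp: ennreal_of_nat_eq_real_of_nat)
      also have "\<dots> \<le> (\<Sum>z\<in>F. emeasure M\<^sub>0 (ball z (\<rho> / 8)))"
        using \<rho> by (intro sum_mono low) auto
      also have "\<dots> = emeasure M\<^sub>0 (\<Union>z\<in>F. ball z (\<rho> / 8))"
        using F M0 dF by (intro sum_emeasure) auto
      also have "\<dots> \<le> emeasure M\<^sub>0 (ball x (3 * \<rho>))"
        using near M0 by (intro emeasure_mono) auto
      also have "\<dots> \<le> ennreal (C\<^sub>0 * (3 * \<rho>) powr Q)" using \<rho> by (intro up) auto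
      finally have "real (card F) * ((\<rho> / 8) powr Q / C\<^sub>0) \<le> C\<^sub>0 * (3 * \<rho>) powr Q"
        using C0 by (simp add: ennreal_le_iff)
      then have "real (card F) * (\<rho> / 8) powr Q \<le> C\<^sub>0\<^sup>2 * (3 * \<rho>) powr Q"
        using C0 by (simp add: field_simps power2_eq_square)
      also have "(3 * \<rho>) powr Q = 24 powr Q * (\<rho> / 8) powr Q"
        using \<rho> by (subst powr_mult[symmetric]) auto
      finally show ?thesis using \<rho> by simp
    qed
  qed auto
  have vsum: "(\<integral>\<^sup>+x. v x \<partial>count_space S) \<le> ennreal (C\<^sub>0\<^sup>2 * 24 powr Q) * emeasure \<kappa> W"
  proof -
    have b: "ball (f x) (l x / 4) \<in> sets \<kappa>" for x using \<kappa> by auto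
    have WM: "W \<in> sets \<kappa>" using W(1) \<kappa> by auto
    have "(\<integral>\<^sup>+x. v x \<partial>count_space S) =
        (\<integral>\<^sup>+x. (\<integral>\<^sup>+y. indicator (ball (f x) (l x / 4)) y \<partial>\<kappa>) \<partial>count_space S)"
      using b by (simp add: v_def)
    also have "\<dots> = (\<integral>\<^sup>+y. (\<integral>\<^sup>+x. indicator (ball (f x) (l x / 4)) y \<partial>count_space S) \<partial>\<kappa>)"
      using b by (intro nn_integral_count_space_nn_integral[OF cS, symmetric] borel_measurable_indicator)
    also have "\<dots> \<le> (\<integral>\<^sup>+y. ennreal (C\<^sub>0\<^sup>2 * 24 powr Q) * indicator W y \<partial>\<kappa>)"
    proof (rule nn_integral_mono)
      fix y
      let ?J = "{x \<in> S. y \<in> ball (f x) (l x / 4)}"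
      have "(\<integral>\<^sup>+x. indicator (ball (f x) (l x / 4)) y \<partial>count_space S) = (\<integral>\<^sup>+x. indicator ?J x \<partial>count_space S)"
        by (intro nn_integral_cong) (auto split: split_indicator)
      also have "\<dots> = emeasure (count_space S) ?J" by (rule nn_integral_indicator) auto
      also have "\<dots> \<le> ennreal (C\<^sub>0\<^sup>2 * 24 powr Q) * indicator W y"
      proof (cases "?J = {}")
        case True
        show ?thesis unfolding True by simp
      next
        case False
        then obtain x where x: "x \<in> S" "y \<in> ball (f x) (l x / 4)" by blast
        have "ball (f x) (l x / 4) \<subseteq> ball (f x) (l x)"
          using L[OF SA[OF x(1)]] by (intro subset_ball) auto
        then have "y \<in> W" using x lW[OF SA[OF x(1)]] by blast
        then show ?thesis using overlap[of y] by simp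
      qed
      finally show "(\<integral>\<^sup>+x. indicator (ball (f x) (l x / 4)) y \<partial>count_space S) \<le>
          ennreal (C\<^sub>0\<^sup>2 * 24 powr Q) * indicator W y" .
    qed
    also have "\<dots> = ennreal (C\<^sub>0\<^sup>2 * 24 powr Q) * emeasure \<kappa> W"
      using WM by (rule nn_integral_cmult_indicator)
    finally show ?thesis .
  qed
  have massD: "emeasure m (ball x (2 * r x)) \<le> ennreal (D * w x * r x powr Q)" if x: "x \<in> S" for x
  proof -
    have wx: "0 < w x" using pos[OF SA[OF x]] by auto
    note mass[OF SA[OF x]]
    also have "ennreal (2 * w x) * emeasure M\<^sub>0 (ball x (2 * r x)) \<le>
        ennreal (2 * w x) * ennreal (C\<^sub>0 * (2 * r x) powr Q)"
      using r0[OF x] by (intro mult_left_mono up) auto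
    also have "\<dots> = ennreal (2 * w x * (C\<^sub>0 * (2 * r x) powr Q))"
      using wx C0 by (intro ennreal_mult[symmetric]) auto
    also have "2 * w x * (C\<^sub>0 * (2 * r x) powr Q) = D * w x * r x powr Q"
      using r0[OF x] by (simp add: D_def powr_mult)
    finally show ?thesis .
  qed
  have "qc_cover Q D (2 * D * 4 powr Q / c) (ennreal (C\<^sub>0\<^sup>2 * 24 powr Q) * emeasure \<kappa> W)
    \<delta> R\<^sub>0 m \<Omega> f A U w P S r (\<lambda>x. L x / r x) v"
    unfolding qc_cover_def
  proof (intro conjI[OF cS] conjI[OF S(1)] conjI[OF S(2)] conjI[OF ballI] conjI[OF disj] vsum ballI allI impI)
    show "0 < r x \<and> r x < \<delta> \<and> 100 * r x < R\<^sub>0 \<and> ball x (r x) \<subseteq> U x" if "x \<in> S" for x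
      by (rule rad[OF SA[OF that]])
    show "0 \<le> L x / r x" if "x \<in> S" for x using L[OF SA[OF that]] r0[OF that] by simp
    show "dist (f y) (f x) \<le> L x / r x * r x" if "x \<in> S" "y \<in> \<Omega> \<inter> ball x (r x)" for x y
      using fL[OF SA[OF that(1)], of y] that(2) r0[OF that(1)] by (simp add: dist_commute)
    show "ennreal (L x / r x) * emeasure m (ball x (2 * r x)) \<le>
        ennreal (2 * D * 4 powr Q / c * T powr (1 - Q)) * v x"
      if x: "x \<in> S" and T: "0 < T" and big: "2 * T * P x / w x < L x / r x" for x T
    proof -
      note p = pos[OF SA[OF x]] and Lx = L[OF SA[OF x]] and r = r0[OF x]
      \<comment> \<open>A slope above the threshold is positive; this forces \<open>l x > 0\<close>,
        the case in which a lower bound for the image ball was recorded.\<close>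
      have "0 < L x / r x" using big p T by (auto intro: less_trans[rotated])
      then have "l x \<noteq> 0" using Lx r by (auto simp: zero_less_divide_iff)
      then have l: "0 < l x" using Lx by auto
      define E where "E = c * (w x * h x) powr Q / P x powr (Q - 1) * (l x / 4) powr Q"
      have "ennreal (L x / r x) * emeasure m (ball x (2 * r x)) \<le>
          ennreal (L x / r x) * ennreal (D * w x * r x powr Q)"
        by (intro mult_left_mono massD[OF x]) auto
      also have "\<dots> = ennreal (L x / r x * (D * w x * r x powr Q))"
        using Lx r p D by (intro ennreal_mult[symmetric]) auto
      also have "\<dots> \<le> ennreal (2 * D * 4 powr Q / c * T powr (1 - Q) * E)"
        unfolding E_def using p Lx r Q T c D big by (intro ennreal_leI selection_estimate) auto
      also have "\<dots> = ennreal (2 * D * 4 powr Q / c * T powr (1 - Q)) * ennreal E"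
        using D c by (intro ennreal_mult) (auto simp: E_def)
      also have "\<dots> \<le> ennreal (2 * D * 4 powr Q / c * T powr (1 - Q)) * v x"
        unfolding v_def E_def using vol[OF SA[OF x] l] by (intro mult_left_mono) auto
      finally show ?thesis .
    qed
  qed (fact massD)
  then show ?thesis by blast
qed

section \<open>Integral bounds for the covers\<close>

lemma nn_integral_count_space_disjoint_le:
  assumes S: "countable S" and B: "\<And>x. x \<in> S \<Longrightarrow> B x \<in> sets M \<and> B x \<subseteq> V" and V: "V \<in> sets M"
    and disj: "disjoint_family_on B S"
  shows "(\<integral>\<^sup>+x. emeasure M (B x) \<partial>count_space S) \<le> emeasure M V"
proof -
  have "(\<integral>\<^sup>+x. emeasure M (B x) \<partial>count_space S) = emeasure M (\<Union>x\<in>S. B x)"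
    using B S disj by (intro emeasure_UN_countable[symmetric]) auto
  also have "\<dots> \<le> emeasure M V" using B V by (intro emeasure_mono) auto
  finally show ?thesis .
qed

lemma borel_measurable_count_space_integral:
  fixes g :: "'i \<Rightarrow> 'a \<Rightarrow> ennreal"
  assumes I: "countable I" and g [measurable]: "\<And>i. i \<in> I \<Longrightarrow> g i \<in> borel_measurable M"
  shows "(\<lambda>x. \<integral>\<^sup>+i. g i x \<partial>count_space I) \<in> borel_measurable M"
proof (cases "finite I")
  case True
  then show ?thesis by (simp add: nn_integral_count_space_finite)
next
  case False
  then have [simp]: "I \<noteq> {}" by auto
  have "(\<integral>\<^sup>+i. g i x \<partial>count_space I) = (\<Sum>n. g (from_nat_into I n) x)" for x
    by (simp add: nn_integral_bij_count_space[symmetric, OF bij_betw_from_nat_into[OF I False]]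
        nn_integral_count_space_nat)
  then show ?thesis by (simp add: from_nat_into)
qed

text \<open>Rewrites \<open>r powr Q\<close> as mass of the ball of radius \<open>r / 5\<close>.
  These balls are disjoint, so sums of powers of radii become measures of unions.\<close>

lemma ahlfors_radius_powr_le:
  fixes Q C\<^sub>0 r :: real
  assumes "1 \<le> C\<^sub>0" "0 < r" "ennreal ((r / 5) powr Q / C\<^sub>0) \<le> y"
  shows "ennreal (r powr Q) \<le> ennreal (C\<^sub>0 * 5 powr Q) * y"
proof -
  have "r powr Q = C\<^sub>0 * 5 powr Q * ((r / 5) powr Q / C\<^sub>0)"
    using assms by (simp add: powr_divide)
  then have "ennreal (r powr Q) = ennreal (C\<^sub>0 * 5 powr Q) * ennreal ((r / 5) powr Q / C\<^sub>0)"
    using assms by (simp add: ennreal_mult[symmetric])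
  also have "\<dots> \<le> ennreal (C\<^sub>0 * 5 powr Q) * y" using assms by (intro mult_left_mono) auto
  finally show ?thesis .
qed

text \<open>The double integral in the square is split according to which of the two radii is larger.\<close>

lemma overlapping_balls_square_integral:
  fixes M\<^sub>0 m :: "'a::metric_space measure" and r t :: "'a \<Rightarrow> real" and Q C\<^sub>0 R\<^sub>0 E H :: real
  assumes C0: "1 \<le> C\<^sub>0" and H: "0 \<le> H" and E: "0 \<le> E" and J: "countable J"
    and low: "\<And>x r. 0 < r \<Longrightarrow> r < R\<^sub>0 \<Longrightarrow> ennreal (r powr Q / C\<^sub>0) \<le> emeasure M\<^sub>0 (ball x r)"
    and up: "\<And>x r. 0 < r \<Longrightarrow> r < R\<^sub>0 \<Longrightarrow> emeasure M\<^sub>0 (ball x r) \<le> ennreal (C\<^sub>0 * r powr Q)"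
    and M0: "sets borel \<subseteq> sets M\<^sub>0" and m: "sets m = sets borel"
    and r: "\<And>x. x \<in> J \<Longrightarrow> 0 < r x \<and> 100 * r x < R\<^sub>0 \<and> ball x (r x / 5) \<subseteq> \<Omega>" and \<Omega>: "open \<Omega>"
    and t: "\<And>x. x \<in> J \<Longrightarrow> t x \<le> H"
    and disj: "disjoint_family_on (\<lambda>x. ball x (r x / 5)) J"
    and mass: "\<And>x. x \<in> J \<Longrightarrow> emeasure m (ball x (2 * r x)) \<le> ennreal (E * r x powr Q)"
  shows "(\<integral>\<^sup>+z. (\<integral>\<^sup>+x. ennreal (2 * t x) * indicator (ball x (2 * r x)) z \<partial>count_space J)\<^sup>2 \<partial>m) \<le>
    ennreal (8 * H\<^sup>2 * E * (C\<^sub>0 * 5 powr Q) ^ 3) * emeasure M\<^sub>0 \<Omega>"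
proof -
  define b where "b x z = (indicator (ball x (2 * r x)) z :: ennreal)" for x z
  define \<phi> where "\<phi> x y z = (if r y \<le> r x then b x z * b y z else 0)" for x y z
  define k where "k = C\<^sub>0 * 5 powr Q"
  have k: "0 < k" using C0 by (simp add: k_def)
  have bm [measurable]: "b x \<in> borel_measurable m" for x
    unfolding b_def[abs_def] by (intro borel_measurable_indicator) (simp add: m)
  have \<phi>m [measurable]: "\<phi> x y \<in> borel_measurable m" for x y
    unfolding \<phi>_def[abs_def] by measurable
  have B: "ball x (r x / 5) \<in> sets M\<^sub>0" for x using M0 by auto
  have rQ: "ennreal (r x powr Q) \<le> ennreal k * emeasure M\<^sub>0 (ball x (r x / 5))" if "x \<in> J" for x
    unfolding k_def using C0 r[OF that] by (intro ahlfors_radius_powr_le low) auto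
  have pt: "(\<integral>\<^sup>+x. ennreal (2 * t x) * indicator (ball x (2 * r x)) z \<partial>count_space J)\<^sup>2 \<le>
      ennreal (8 * H\<^sup>2) * (\<integral>\<^sup>+x. \<integral>\<^sup>+y. \<phi> x y z \<partial>count_space J \<partial>count_space J)" for z
  proof -
    let ?s = "\<integral>\<^sup>+x. b x z \<partial>count_space J"
    have "(\<integral>\<^sup>+x. ennreal (2 * t x) * indicator (ball x (2 * r x)) z \<partial>count_space J) \<le>
        (\<integral>\<^sup>+x. ennreal (2 * H) * b x z \<partial>count_space J)"
      unfolding b_def using t by (intro nn_integral_mono mult_right_mono ennreal_leI) auto
    also have "\<dots> = ennreal (2 * H) * ?s" by (rule nn_integral_cmult) auto
    finally have "(\<integral>\<^sup>+x. ennreal (2 * t x) * indicator (ball x (2 * r x)) z \<partial>count_space J)\<^sup>2 \<le>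
        (ennreal (2 * H) * ?s)\<^sup>2" by (rule power_mono) simp
    also have "\<dots> = ennreal (4 * H\<^sup>2) * ?s\<^sup>2"
      using H by (simp add: power_mult_distrib ennreal_power)
    also have "?s\<^sup>2 = (\<integral>\<^sup>+x. \<integral>\<^sup>+y. b x z * b y z \<partial>count_space J \<partial>count_space J)"
      by (simp add: power2_eq_square nn_integral_cmult nn_integral_multc)
    also have "\<dots> \<le> (\<integral>\<^sup>+x. \<integral>\<^sup>+y. \<phi> x y z + \<phi> y x z \<partial>count_space J \<partial>count_space J)"
      by (intro nn_integral_mono) (auto simp: \<phi>_def mult.commute)
    also have "\<dots> = (\<integral>\<^sup>+x. \<integral>\<^sup>+y. \<phi> x y z \<partial>count_space J \<partial>count_space J) +
        (\<integral>\<^sup>+x. \<integral>\<^sup>+y. \<phi> y x z \<partial>count_space J \<partial>count_space J)"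
      by (simp add: nn_integral_add)
    also have "(\<integral>\<^sup>+x. \<integral>\<^sup>+y. \<phi> y x z \<partial>count_space J \<partial>count_space J) =
        (\<integral>\<^sup>+x. \<integral>\<^sup>+y. \<phi> x y z \<partial>count_space J \<partial>count_space J)"
      by (rule nn_integral_count_space_nn_integral[OF J, symmetric]) simp
    also have "(\<integral>\<^sup>+x. \<integral>\<^sup>+y. \<phi> x y z \<partial>count_space J \<partial>count_space J) +
        (\<integral>\<^sup>+x. \<integral>\<^sup>+y. \<phi> x y z \<partial>count_space J \<partial>count_space J) =
        ennreal 2 * (\<integral>\<^sup>+x. \<integral>\<^sup>+y. \<phi> x y z \<partial>count_space J \<partial>count_space J)"
      by (simp add: mult_2)
    also have "ennreal (4 * H\<^sup>2) * (ennreal 2 * (\<integral>\<^sup>+x. \<integral>\<^sup>+y. \<phi> x y z \<partial>count_space J \<partial>count_space J)) =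
        ennreal (8 * H\<^sup>2) * (\<integral>\<^sup>+x. \<integral>\<^sup>+y. \<phi> x y z \<partial>count_space J \<partial>count_space J)"
      unfolding mult.assoc[symmetric] by (subst ennreal_mult[symmetric]) (auto simp: mult.commute)
    finally show ?thesis by (simp add: mult_left_mono)
  qed
  have inner: "(\<integral>\<^sup>+y. (\<integral>\<^sup>+z. \<phi> x y z \<partial>m) \<partial>count_space J) \<le>
      ennreal (E * k ^ 3) * emeasure M\<^sub>0 (ball x (r x / 5))" if x: "x \<in> J" for x
  proof -
    \<comment> \<open>For fixed \<open>x\<close> only balls of no larger radius that meet the
      doubled ball of \<open>x\<close> matter. Their fifth-size balls are disjoint and lie in
      \<open>ball x (5 * r x)\<close>, so their total mass is of order \<open>r x powr Q\<close>.
      Each of the three passages between powers of radii and masses costs one factor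
      \<open>k\<close>.\<close>
    define K where "K = {y \<in> J. r y \<le> r x \<and> ball x (2 * r x) \<inter> ball y (2 * r y) \<noteq> {}}"
    have KJ: "K \<subseteq> J" by (auto simp: K_def)
    have "(\<integral>\<^sup>+y. (\<integral>\<^sup>+z. \<phi> x y z \<partial>m) \<partial>count_space J) \<le>
        (\<integral>\<^sup>+y. ennreal (E * k) * emeasure M\<^sub>0 (ball y (r y / 5)) * indicator K y \<partial>count_space J)"
    proof (rule nn_integral_mono)
      fix y assume "y \<in> space (count_space J)"
      then have y: "y \<in> J" by simp
      show "(\<integral>\<^sup>+z. \<phi> x y z \<partial>m) \<le> ennreal (E * k) * emeasure M\<^sub>0 (ball y (r y / 5)) * indicator K y"
      proof (cases "y \<in> K")
        case True
        have "(\<integral>\<^sup>+z. \<phi> x y z \<partial>m) \<le> (\<integral>\<^sup>+z. indicator (ball y (2 * r y)) z \<partial>m)"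
          by (intro nn_integral_mono) (auto simp: \<phi>_def b_def split: split_indicator)
        also have "\<dots> = emeasure m (ball y (2 * r y))" by (simp add: m)
        also have "\<dots> \<le> ennreal E * ennreal (r y powr Q)"
          using mass[OF y] E by (simp add: ennreal_mult)
        also have "\<dots> \<le> ennreal E * (ennreal k * emeasure M\<^sub>0 (ball y (r y / 5)))"
          by (intro mult_left_mono rQ[OF y]) auto
        finally show ?thesis using True E k by (simp add: ennreal_mult mult.assoc)
      next
        case False
        have "\<phi> x y z = 0" for z
          using False y by (auto simp: \<phi>_def b_def K_def split: split_indicator)
        then show ?thesis using False by simp
      qed
    qed
    also have "\<dots> = (\<integral>\<^sup>+y. ennreal (E * k) * emeasure M\<^sub>0 (ball y (r y / 5)) \<partial>count_space K)"
      using KJ by (subst (1 2) nn_integral_count_space_indicator)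
        (auto intro!: nn_integral_cong split: split_indicator)
    also have "\<dots> = ennreal (E * k) * (\<integral>\<^sup>+y. emeasure M\<^sub>0 (ball y (r y / 5)) \<partial>count_space K)"
      by (rule nn_integral_cmult) auto
    also have "\<dots> \<le> ennreal (E * k) * emeasure M\<^sub>0 (ball x (5 * r x))"
    proof (intro mult_left_mono nn_integral_count_space_disjoint_le)
      show "countable K" using KJ J by (rule countable_subset)
      show "disjoint_family_on (\<lambda>y. ball y (r y / 5)) K"
        using disj KJ by (rule disjoint_family_on_mono[rotated])
      show "ball x (5 * r x) \<in> sets M\<^sub>0" using M0 by auto
      fix y assume y: "y \<in> K"
      then obtain z where z: "z \<in> ball x (2 * r x)" "z \<in> ball y (2 * r y)" "r y \<le> r x" "y \<in> J"
        by (auto simp: K_def)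
      have "dist x y + r y / 5 \<le> 5 * r x"
        using z r[OF z(4)] dist_triangle2[of x y z] by (simp add: dist_commute)
      then have "ball y (r y / 5) \<subseteq> ball x (5 * r x)" by (rule ball_subset_ballI)
      then show "ball y (r y / 5) \<in> sets M\<^sub>0 \<and> ball y (r y / 5) \<subseteq> ball x (5 * r x)" using B by blast
    qed auto
    also have "\<dots> \<le> ennreal (E * k) * ennreal (k * r x powr Q)"
      using up[of "5 * r x" x] r[OF x] by (intro mult_left_mono) (auto simp: k_def powr_mult mult.assoc)
    also have "\<dots> = ennreal (E * k) * (ennreal k * ennreal (r x powr Q))"
      using k by (simp add: ennreal_mult)
    also have "\<dots> \<le> ennreal (E * k) * (ennreal k * (ennreal k * emeasure M\<^sub>0 (ball x (r x / 5))))"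
      by (intro mult_left_mono rQ[OF x]) auto
    also have "\<dots> = ennreal (E * k ^ 3) * emeasure M\<^sub>0 (ball x (r x / 5))"
      using k E by (simp add: ennreal_mult mult.assoc power3_eq_cube)
    finally show ?thesis .
  qed
  have "(\<integral>\<^sup>+z. (\<integral>\<^sup>+x. ennreal (2 * t x) * indicator (ball x (2 * r x)) z \<partial>count_space J)\<^sup>2 \<partial>m) \<le>
      (\<integral>\<^sup>+z. ennreal (8 * H\<^sup>2) * (\<integral>\<^sup>+x. \<integral>\<^sup>+y. \<phi> x y z \<partial>count_space J \<partial>count_space J) \<partial>m)"
    by (intro nn_integral_mono pt)
  also have mm: "(\<lambda>z. \<integral>\<^sup>+y. \<phi> x y z \<partial>count_space J) \<in> borel_measurable m" for x
    using J by (intro borel_measurable_count_space_integral) auto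
  have "(\<integral>\<^sup>+z. ennreal (8 * H\<^sup>2) * (\<integral>\<^sup>+x. \<integral>\<^sup>+y. \<phi> x y z \<partial>count_space J \<partial>count_space J) \<partial>m) =
      ennreal (8 * H\<^sup>2) * (\<integral>\<^sup>+z. (\<integral>\<^sup>+x. \<integral>\<^sup>+y. \<phi> x y z \<partial>count_space J \<partial>count_space J) \<partial>m)"
    using J mm by (intro nn_integral_cmult borel_measurable_count_space_integral) auto
  also have "(\<integral>\<^sup>+z. (\<integral>\<^sup>+x. \<integral>\<^sup>+y. \<phi> x y z \<partial>count_space J \<partial>count_space J) \<partial>m) =
      (\<integral>\<^sup>+x. (\<integral>\<^sup>+z. \<integral>\<^sup>+y. \<phi> x y z \<partial>count_space J \<partial>m) \<partial>count_space J)"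
    by (rule nn_integral_count_space_nn_integral[OF J mm])
  also have "\<dots> = (\<integral>\<^sup>+x. (\<integral>\<^sup>+y. (\<integral>\<^sup>+z. \<phi> x y z \<partial>m) \<partial>count_space J) \<partial>count_space J)"
    by (intro nn_integral_cong nn_integral_count_space_nn_integral[OF J \<phi>m])
  also have "\<dots> \<le> (\<integral>\<^sup>+x. ennreal (E * k ^ 3) * emeasure M\<^sub>0 (ball x (r x / 5)) \<partial>count_space J)"
    using inner by (intro nn_integral_mono) auto
  also have "\<dots> = ennreal (E * k ^ 3) * (\<integral>\<^sup>+x. emeasure M\<^sub>0 (ball x (r x / 5)) \<partial>count_space J)"
    by (rule nn_integral_cmult) auto
  also have "\<dots> \<le> ennreal (E * k ^ 3) * emeasure M\<^sub>0 \<Omega>"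
    using r B \<Omega> M0 by (intro mult_left_mono nn_integral_count_space_disjoint_le[OF J _ _ disj]) auto
  finally have "(\<integral>\<^sup>+z. (\<integral>\<^sup>+x. ennreal (2 * t x) * indicator (ball x (2 * r x)) z \<partial>count_space J)\<^sup>2 \<partial>m) \<le>
      ennreal (8 * H\<^sup>2) * (ennreal (E * k ^ 3) * emeasure M\<^sub>0 \<Omega>)"
    by (simp add: mult_left_mono)
  also have "\<dots> = ennreal (8 * H\<^sup>2 * E * k ^ 3) * emeasure M\<^sub>0 \<Omega>"
    using E k by (simp add: ennreal_mult mult.assoc)
  finally show ?thesis by (simp add: k_def)
qed

lemma ex_powr_small:
  fixes Q K e :: real
  assumes "1 < Q" "0 \<le> K" "0 < e"
  obtains T where "0 < T" "K * T powr (1 - Q) \<le> e"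
proof
  define T where "T = (K / e + 1) powr (1 / (Q - 1))"
  have p: "0 < K / e + 1" using assms by (simp add: add_nonneg_pos)
  then show "0 < T" by (simp add: T_def)
  have "T powr (1 - Q) = (K / e + 1) powr (1 / (Q - 1) * (1 - Q))"
    by (simp add: T_def powr_powr)
  also have "1 / (Q - 1) * (1 - Q) = - 1" using assms by (simp add: field_simps)
  also have "(K / e + 1) powr (- 1) = 1 / (K / e + 1)"
    using p by (simp add: powr_minus_divide)
  finally have "K * T powr (1 - Q) = K / (K / e + 1)" by simp
  also have "\<dots> \<le> e" using assms p by (simp add: field_simps)
  finally show "K * T powr (1 - Q) \<le> e" .
qed

text \<open>Adding the bounds of the two cases spares later sums the case distinction. Below the
  threshold the weight \<open>w\<close> in the mass cancels against the one in the slope.\<close>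

lemma two_case_mass_le:
  fixes w T P D t rQ K :: real and e v :: ennreal
  assumes pos: "0 < w" "0 < T" "0 < P" "0 < D" "0 \<le> rQ" "0 \<le> K" "0 \<le> t"
    and mass: "e \<le> ennreal (D * w * rQ)"
    and big: "2 * T * P / w < t \<Longrightarrow> ennreal t * e \<le> ennreal K * v"
  shows "ennreal (2 * t) * e \<le> ennreal (4 * D * T * P * rQ) + ennreal (2 * K) * v"
proof (cases "2 * T * P / w < t")
  case True
  have "ennreal (2 * t) * e = ennreal 2 * (ennreal t * e)"
    using pos by (simp add: ennreal_mult mult.assoc)
  also have "\<dots> \<le> ennreal 2 * (ennreal K * v)" using big[OF True] by (intro mult_left_mono) auto
  also have "\<dots> = ennreal (2 * K) * v" using pos by (simp add: ennreal_mult mult.assoc)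
  finally show ?thesis by (intro add_increasing) auto
next
  case False
  have "ennreal (2 * t) * e \<le> ennreal (2 * t) * ennreal (D * w * rQ)"
    using mass by (intro mult_left_mono) auto
  also have "\<dots> = ennreal (2 * t * (D * w * rQ))"
    using pos by (intro ennreal_mult[symmetric]) auto
  also have "2 * t * (D * w * rQ) \<le> 2 * (2 * T * P / w) * (D * w * rQ)"
    using False pos by (intro mult_right_mono) auto
  also have "\<dots> = 4 * D * T * P * rQ" using pos by simp
  finally show ?thesis by (auto intro!: add_increasing2 simp: ennreal_leI)
qed

text \<open>Chebyshev's inequality in pointwise form: where \<open>a\<close> exceeds
  \<open>c\<close>, it is at most its square divided by \<open>c\<close>. Thus an L2 bound controls
  excesses.\<close>

lemma ennreal_diff_le_square_div:
  fixes a :: ennreal and c :: real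
  assumes "0 < c" shows "a - ennreal c \<le> ennreal (1 / c) * a\<^sup>2"
proof (cases a)
  case (real b)
  show ?thesis
  proof (cases "b \<le> c")
    case True
    then have "a - ennreal c = 0" using real by (simp add: ennreal_minus ennreal_neg)
    then show ?thesis by simp
  next
    case False
    have "b - c \<le> b" using assms by simp
    also have "b = 1 / c * (c * b)" using assms by simp
    also have "\<dots> \<le> 1 / c * b\<^sup>2"
      using False assms real by (intro mult_left_mono) (auto simp: power2_eq_square)
    finally have "ennreal (b - c) \<le> ennreal (1 / c * b\<^sup>2)" by (rule ennreal_leI)
    also have "ennreal (1 / c * b\<^sup>2) = ennreal (1 / c) * ennreal (b\<^sup>2)"
      using assms by (intro ennreal_mult) auto
    finally show ?thesis using real assms by (simp only: ennreal_minus less_imp_le ennreal_power)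
  qed
next
  case top
  then show ?thesis using assms by (simp add: ennreal_mult_top power2_eq_square)
qed

text \<open>Common ground for two uses of the cover: on the null set where the integrand is infinite
  and on the rest of the complement of \<open>E\<close>. The two uses differ in the image measure
  \<kappa>, in \<open>P\<close> and in the prescribed neighbourhoods, so these are left open
  here.\<close>

locale quasiconformal_setting =
  fixes Q C\<^sub>0 R\<^sub>0 :: real and M\<^sub>0 m :: "'a::metric_space measure" and \<Omega> B :: "'a set"
    and f :: "'a \<Rightarrow> 'b::metric_space" and w h :: "'a \<Rightarrow> real"
  assumes Q: "1 < Q" and C0: "1 \<le> C\<^sub>0" and R0: "0 < R\<^sub>0"
    and low: "\<And>x r. 0 < r \<Longrightarrow> r < R\<^sub>0 \<Longrightarrow> ennreal (r powr Q / C\<^sub>0) \<le> emeasure M\<^sub>0 (ball x r)"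
    and up: "\<And>x r. 0 < r \<Longrightarrow> r < R\<^sub>0 \<Longrightarrow> emeasure M\<^sub>0 (ball x r) \<le> ennreal (C\<^sub>0 * r powr Q)"
    and fin: "\<And>x r. emeasure M\<^sub>0 (ball x r) < \<infinity>"
    and M0: "sets borel \<subseteq> sets M\<^sub>0" and m: "sets m = sets borel"
    and outer: "\<And>A e. A \<in> sets M\<^sub>0 \<Longrightarrow> 0 < (e::real) \<Longrightarrow>
      \<exists>U. open U \<and> A \<subseteq> U \<and> emeasure M\<^sub>0 (U - A) \<le> ennreal e"
    and f: "continuous_on \<Omega> f" and \<Omega>: "open \<Omega>" "bounded \<Omega>" and B: "B \<subseteq> \<Omega>"
    and pos: "\<And>x. x \<in> B \<Longrightarrow> 0 < w x \<and> 1 \<le> h x"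
    and dens: "\<And>x. x \<in> B \<Longrightarrow> \<exists>r1>0. \<forall>r. 0 < r \<and> r < r1 \<longrightarrow>
      emeasure m (ball x r) \<le> ennreal (2 * w x) * emeasure M\<^sub>0 (ball x r)"
    and dil: "\<And>x. x \<in> B \<Longrightarrow> dil_h \<Omega> f x < ennreal (2 * h x)"
begin

abbreviation "D \<equiv> 2 * C\<^sub>0 * 2 powr Q"

definition ball_sum :: "'a set \<Rightarrow> ('a \<Rightarrow> real) \<Rightarrow> ('a \<Rightarrow> real) \<Rightarrow> 'a \<Rightarrow> ennreal" where
  "ball_sum S r t z = (\<integral>\<^sup>+x. ennreal (2 * t x) * indicator (ball x (2 * r x)) z \<partial>count_space S)"

lemma ball_term_measurable: "(\<lambda>z. ennreal a * indicator (ball x s) z) \<in> borel_measurable borel"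
proof -
  have [measurable]: "ball x s \<in> sets borel" by simp
  show ?thesis by measurable
qed

lemma ball_sum_measurable: "countable S \<Longrightarrow> ball_sum S r t \<in> borel_measurable borel"
  unfolding ball_sum_def[abs_def]
  by (intro borel_measurable_count_space_integral ball_term_measurable)

lemma nn_integral_ball_sum:
  assumes "countable S"
  shows "(\<integral>\<^sup>+z. ball_sum S r t z \<partial>m) = (\<integral>\<^sup>+x. ennreal (2 * t x) * emeasure m (ball x (2 * r x)) \<partial>count_space S)"
proof -
  have "(\<lambda>z. ennreal (2 * t x) * indicator (ball x (2 * r x)) z) \<in> borel_measurable m" for x
    by (subst measurable_cong_sets[OF m refl]) (rule ball_term_measurable)
  then have "(\<integral>\<^sup>+z. ball_sum S r t z \<partial>m) =
      (\<integral>\<^sup>+x. (\<integral>\<^sup>+z. ennreal (2 * t x) * indicator (ball x (2 * r x)) z \<partial>m) \<partial>count_space S)"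
    unfolding ball_sum_def by (intro nn_integral_count_space_nn_integral assms)
  also have "\<dots> = (\<integral>\<^sup>+x. ennreal (2 * t x) * emeasure m (ball x (2 * r x)) \<partial>count_space S)"
    by (intro nn_integral_cong nn_integral_cmult_indicator) (simp add: m)
  finally show ?thesis .
qed

lemma ball_sum_controls:
  assumes "countable S" "A \<subseteq> (\<Union>x\<in>S. ball x (r x))" "\<And>x. x \<in> S \<Longrightarrow> 0 < r x \<and> r x < \<delta>"
    and "\<And>x. x \<in> S \<Longrightarrow> 0 \<le> t x"
    and "\<And>x y. x \<in> S \<Longrightarrow> y \<in> \<Omega> \<inter> ball x (r x) \<Longrightarrow> dist (f y) (f x) \<le> t x * r x"
  shows "controls \<Omega> f \<delta> A (ball_sum S r t)"
proof -
  have "controls \<Omega> f \<delta> (\<Union>x\<in>S. ball x (r x))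
      (\<lambda>z. \<integral>\<^sup>+x. ennreal (2 * t x) * indicator (ball x (2 * r x)) z \<partial>count_space S)"
  proof (rule controls_UN[OF assms(1) ball_term_measurable])
    fix x assume x: "x \<in> S"
    note rx = assms(3)[OF x] and tx = assms(4)[OF x]
    have "controls \<Omega> f \<delta> (ball x (r x))
        (\<lambda>z. ennreal (2 * (t x * r x) / r x) * indicator (ball x (2 * r x)) z)"
      by (rule controls_ball) (use rx tx assms(5)[OF x] in auto)
    moreover have "2 * (t x * r x) / r x = 2 * t x" using rx by simp
    ultimately show "controls \<Omega> f \<delta> (ball x (r x)) (\<lambda>z. ennreal (2 * t x) * indicator (ball x (2 * r x)) z)"
      by simp
  qed
  then show ?thesis
    by (rule controls_mono) (use assms(2) in \<open>auto simp: ball_sum_def\<close>)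
qed

text \<open>Where the integrand is infinite it yields no lower bound for the weighted image measure.
  With the unweighted one and P = (w h)^(Q/(Q-1)), the quotient (w h)^Q / P^(Q-1) is 1 and plain
  Ahlfors regularity supplies the lower bound. On a piece with w h bounded, \<open>P\<close> is
  bounded, so the domain part is small over an open set of small measure around the null
  set.\<close>

lemma null_piece_controls:
  fixes \<kappa> :: "'b measure" and c K k \<delta> e :: real
  assumes \<kappa>: "sets borel \<subseteq> sets \<kappa>" and c: "0 < c" and K: "0 < K"
    and low\<kappa>: "\<And>y s. 0 < s \<Longrightarrow> s < K \<Longrightarrow> ennreal (c * s powr Q) \<le> emeasure \<kappa> (ball y s)"
    and fin\<kappa>: "emeasure \<kappa> (ball y0 k) < \<infinity>"
    and N: "N \<subseteq> B" "N \<subseteq> Z" "Z \<in> sets M\<^sub>0" "emeasure M\<^sub>0 Z = 0"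
    and Nk: "\<And>x. x \<in> N \<Longrightarrow> w x * h x \<le> k \<and> f x \<in> ball y0 k" and \<delta>: "0 < \<delta>" and e: "0 < e"
  shows "\<exists>G\<in>borel_measurable borel. controls \<Omega> f \<delta> N G \<and> (\<integral>\<^sup>+x. G x \<partial>m) \<le> ennreal e"
proof -
  define P where "P x = (w x * h x) powr (Q / (Q - 1))" for x
  define Pm where "Pm = max k 1 powr (Q / (Q - 1))"
  have Pm: "0 < Pm" by (simp add: Pm_def)
  obtain V where V: "emeasure \<kappa> (ball y0 k) = ennreal V" "0 \<le> V"
    using fin\<kappa> by (cases "emeasure \<kappa> (ball y0 k)") auto
  define C1 where "C1 = 2 * D * 4 powr Q / c"
  have D: "0 < D" using C0 by simp
  have C1: "0 < C1" using D c by (simp add: C1_def)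
  define n where "n = C\<^sub>0\<^sup>2 * 24 powr Q"
  have n: "0 < n" using C0 by (simp add: n_def)
  \<comment> \<open>\<open>T\<close> comes first and makes the image part at most e / 2. The open
    set \<open>U\<close> is chosen afterwards, because the constant \<open>a\<close> of the domain
    part grows with \<open>T\<close>.\<close>
  obtain T where T: "0 < T" "2 * C1 * n * V * T powr (1 - Q) \<le> e / 2"
    using ex_powr_small[of Q "2 * C1 * n * V" "e / 2"] Q C1 n V e by auto
  define a where "a = 4 * D * T * Pm * (C\<^sub>0 * 5 powr Q)"
  have a: "0 < a" using D T Pm C0 by (simp add: a_def)
  obtain U where U: "open U" "Z \<subseteq> U" "emeasure M\<^sub>0 (U - Z) \<le> ennreal (e / 2 / a)"
    using outer[OF N(3), of "e / 2 / a"] e a by auto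
  have UM: "U \<in> sets M\<^sub>0" using U(1) M0 by auto
  have "emeasure M\<^sub>0 U \<le> emeasure M\<^sub>0 (Z \<union> (U - Z))"
    using U UM N(3) by (intro emeasure_mono) auto
  also have "\<dots> \<le> emeasure M\<^sub>0 Z + emeasure M\<^sub>0 (U - Z)"
    using UM N(3) by (intro emeasure_subadditive) auto
  finally have MU: "emeasure M\<^sub>0 U \<le> ennreal (e / 2 / a)" using N(4) U(3) by simp
  have "\<exists>S r t v. qc_cover Q D C1 (ennreal n * emeasure \<kappa> (ball y0 k)) \<delta> R\<^sub>0 m \<Omega> f N (\<lambda>_. U) w P S r t v"
    unfolding C1_def n_def
  proof (rule quasiconformal_cover)
    show "\<exists>s1>0. \<forall>s. 0 < s \<and> s < s1 \<longrightarrow>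
        ennreal (c * (w x * h x) powr Q / P x powr (Q - 1) * s powr Q) \<le> emeasure \<kappa> (ball (f x) s)"
      if x: "x \<in> N" for x
    proof (intro exI[of _ K] conjI allI impI K)
      fix s assume s: "0 < s \<and> s < K"
      have wh: "0 < w x * h x" using pos[of x] N(1) x by (auto intro!: mult_pos_pos)
      then have "P x powr (Q - 1) = (w x * h x) powr Q"
        using Q by (simp add: P_def powr_powr)
      moreover have "(w x * h x) powr Q \<noteq> 0" using wh by auto
      ultimately have "c * (w x * h x) powr Q / P x powr (Q - 1) * s powr Q = c * s powr Q"
        by (simp only: nonzero_mult_div_cancel_right not_False_eq_True)
      then show "ennreal (c * (w x * h x) powr Q / P x powr (Q - 1) * s powr Q) \<le> emeasure \<kappa> (ball (f x) s)"
        using low\<kappa> s by simp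
    qed
    show "0 < w x \<and> 1 \<le> h x \<and> 0 < P x" if "x \<in> N" for x
      using pos[of x] N(1) that by (auto simp: P_def)
    show "N \<subseteq> \<Omega>" using N(1) B by blast
    show "\<exists>r1>0. \<forall>r. 0 < r \<and> r < r1 \<longrightarrow> emeasure m (ball x r) \<le> ennreal (2 * w x) * emeasure M\<^sub>0 (ball x r)"
      if "x \<in> N" for x using dens N(1) that by blast
    show "dil_h \<Omega> f x < ennreal (2 * h x)" if "x \<in> N" for x using dil N(1) that by blast
    show "f ` N \<subseteq> ball y0 k" using Nk by blast
    show "open U \<and> x \<in> U" if "x \<in> N" for x using U N(2) that by blast
  qed (fact Q C0 R0 c \<delta> low up fin M0 \<kappa> f \<Omega> open_ball)+
  then obtain S r t v where cov: "qc_cover Q D C1 (ennreal n * emeasure \<kappa> (ball y0 k)) \<delta> R\<^sub>0 m \<Omega> f N (\<lambda>_. U) w P S r t v"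
    by (elim exE)
  note S = qc_coverD(1-3)[OF cov] and r = qc_coverD(4)[OF cov] and t = qc_coverD(5)[OF cov]
    and osc = qc_coverD(6)[OF cov] and disj = qc_coverD(7)[OF cov] and mass = qc_coverD(8)[OF cov]
    and big = qc_coverD(9)[OF cov] and vsum = qc_coverD(10)[OF cov]
  let ?b = "\<lambda>x. ball x (r x / 5)"
  have "ennreal (2 * t x) * emeasure m (ball x (2 * r x)) \<le>
      ennreal a * emeasure M\<^sub>0 (?b x) + ennreal (2 * (C1 * T powr (1 - Q))) * v x" if x: "x \<in> S" for x
  proof -
    have xN: "x \<in> N" "x \<in> B" using x S N by auto
    have wh: "0 < w x" "1 \<le> h x" using pos[OF xN(2)] by auto
    have Px: "0 < P x" "P x \<le> Pm"
      using wh Nk[OF xN(1)] Q by (auto simp: P_def Pm_def intro!: powr_mono2)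
    have "ennreal (2 * t x) * emeasure m (ball x (2 * r x)) \<le>
        ennreal (4 * D * T * P x * r x powr Q) + ennreal (2 * (C1 * T powr (1 - Q))) * v x"
    proof (rule two_case_mass_le[OF wh(1) T(1) Px(1) D _ _ t[OF x] mass[OF x]])
      show "0 \<le> C1 * T powr (1 - Q)" using C1 by simp
      show "ennreal (t x) * emeasure m (ball x (2 * r x)) \<le> ennreal (C1 * T powr (1 - Q)) * v x"
        if "2 * T * P x / w x < t x"
        by (rule big[OF x T(1) that])
    qed simp
    also have "4 * D * T * P x * r x powr Q \<le> 4 * D * T * Pm * r x powr Q"
      using D T Px by (intro mult_right_mono mult_left_mono) auto
    then have "ennreal (4 * D * T * P x * r x powr Q) \<le> ennreal (4 * D * T * Pm) * ennreal (r x powr Q)"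
      using D T Pm by (simp add: ennreal_mult[symmetric] ennreal_leI)
    also have "\<dots> \<le> ennreal (4 * D * T * Pm) * (ennreal (C\<^sub>0 * 5 powr Q) * emeasure M\<^sub>0 (?b x))"
      using C0 r[OF x] by (intro mult_left_mono ahlfors_radius_powr_le low) auto
    also have "\<dots> = ennreal a * emeasure M\<^sub>0 (?b x)"
      using D T Pm C0 unfolding a_def by (simp add: ennreal_mult mult.assoc)
    finally show ?thesis by (simp add: add_right_mono)
  qed
  then have "(\<integral>\<^sup>+z. ball_sum S r t z \<partial>m) \<le>
      (\<integral>\<^sup>+x. ennreal a * emeasure M\<^sub>0 (?b x) + ennreal (2 * (C1 * T powr (1 - Q))) * v x \<partial>count_space S)"
    unfolding nn_integral_ball_sum[OF S(1)] by (intro nn_integral_mono) auto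
  also have "\<dots> = ennreal a * (\<integral>\<^sup>+x. emeasure M\<^sub>0 (?b x) \<partial>count_space S) +
      ennreal (2 * (C1 * T powr (1 - Q))) * (\<integral>\<^sup>+x. v x \<partial>count_space S)"
    by (simp add: nn_integral_add nn_integral_cmult)
  also have "\<dots> \<le> ennreal a * emeasure M\<^sub>0 U + ennreal (2 * (C1 * T powr (1 - Q))) * (ennreal n * ennreal V)"
  proof (intro add_mono mult_left_mono)
    show "(\<integral>\<^sup>+x. emeasure M\<^sub>0 (?b x) \<partial>count_space S) \<le> emeasure M\<^sub>0 U"
    proof (rule nn_integral_count_space_disjoint_le[OF S(1) _ UM disj])
      fix x assume x: "x \<in> S"
      have "?b x \<subseteq> ball x (r x)" using r[OF x] by (intro subset_ball) auto
      then show "?b x \<in> sets M\<^sub>0 \<and> ?b x \<subseteq> U" using r[OF x] M0 by auto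
    qed
  qed (use vsum V in auto)
  also have "\<dots> \<le> ennreal a * ennreal (e / 2 / a) + ennreal (2 * (C1 * T powr (1 - Q))) * (ennreal n * ennreal V)"
    by (intro add_mono mult_left_mono MU) auto
  also have "\<dots> = ennreal (e / 2) + ennreal (2 * C1 * n * V * T powr (1 - Q))"
    using a e C1 n V by (simp add: ennreal_mult[symmetric] mult_ac)
  also have "\<dots> \<le> ennreal (e / 2) + ennreal (e / 2)"
    using T by (intro add_left_mono ennreal_leI) auto
  also have "\<dots> = ennreal e" using e by (simp add: ennreal_plus[symmetric] del: ennreal_plus)
  finally have "(\<integral>\<^sup>+z. ball_sum S r t z \<partial>m) \<le> ennreal e" .
  moreover have "controls \<Omega> f \<delta> N (ball_sum S r t)"
    using S r t osc by (intro ball_sum_controls) auto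
  ultimately show ?thesis using ball_sum_measurable[OF S(1)] by blast
qed

lemma null_set_controls:
  fixes \<kappa> :: "'b measure" and c K \<delta> e :: real
  assumes \<kappa>: "sets borel \<subseteq> sets \<kappa>" and c: "0 < c" and K: "0 < K"
    and low\<kappa>: "\<And>y s. 0 < s \<Longrightarrow> s < K \<Longrightarrow> ennreal (c * s powr Q) \<le> emeasure \<kappa> (ball y s)"
    and fin\<kappa>: "\<And>y s. emeasure \<kappa> (ball y s) < \<infinity>"
    and N: "N \<subseteq> B" "N \<subseteq> Z" "Z \<in> sets M\<^sub>0" "emeasure M\<^sub>0 Z = 0" and \<delta>: "0 < \<delta>" and e: "0 < e"
  shows "\<exists>G\<in>borel_measurable borel. controls \<Omega> f \<delta> N G \<and> (\<integral>\<^sup>+x. G x \<partial>m) \<le> ennreal e"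
proof -
  fix y0 :: 'b
  define A where "A k = {x \<in> N. w x * h x \<le> real k \<and> f x \<in> ball y0 (real k)}" for k :: nat
  have "N \<subseteq> (\<Union>k. A k)"
  proof
    fix x assume "x \<in> N"
    obtain k :: nat where "max (w x * h x) (dist y0 (f x)) < real k" using reals_Archimedean2 by blast
    then have "x \<in> A k" using \<open>x \<in> N\<close> by (simp add: A_def)
    then show "x \<in> (\<Union>k. A k)" by blast
  qed
  show ?thesis
  proof (rule controls_UN_small[OF m e \<open>N \<subseteq> (\<Union>k. A k)\<close>])
    fix k and e' :: real assume "0 < e'"
    show "\<exists>G\<in>borel_measurable borel. controls \<Omega> f \<delta> (A k) G \<and> (\<integral>\<^sup>+x. G x \<partial>m) \<le> ennreal e'"
    proof (rule null_piece_controls[OF \<kappa> c K low\<kappa> fin\<kappa>])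
      show "A k \<subseteq> B" "A k \<subseteq> Z" using N by (auto simp: A_def)
      show "w x * h x \<le> real k \<and> f x \<in> ball y0 (real k)" if "x \<in> A k" for x
        using that by (simp add: A_def)
    qed (use N \<delta> \<open>0 < e'\<close> in simp_all)
  qed
qed

end

context quasiconformal_setting
begin

text \<open>The bound \<open>L\<close> precedes \<delta>, so it is uniform over all scales. On the
  slice \<open>Z k\<close> the quantities \<open>P\<close>, \<open>w\<close> and P / w are bounded.
  Given \<eta>, a large T makes the image parts small and a large N the slices beyond N; the
  remaining summands have bounded slope and weight, hence a bounded L2 norm, and Chebyshev's
  inequality turns this into a small excess.\<close>

lemma uniformly_integrable_controls:
  fixes \<kappa> :: "'b measure" and c :: real and P :: "'a \<Rightarrow> real" and Z :: "nat \<Rightarrow> 'a set"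
    and b K :: "nat \<Rightarrow> real"
  assumes \<kappa>: "sets borel \<subseteq> sets \<kappa>" and c: "0 < c"
    and im: "\<And>x. x \<in> A \<Longrightarrow> \<exists>s1>0. \<forall>s. 0 < s \<and> s < s1 \<longrightarrow>
      ennreal (c * (w x * h x) powr Q / P x powr (Q - 1) * s powr Q) \<le> emeasure \<kappa> (ball (f x) s)"
    and W: "open W" "f ` A \<subseteq> W" "emeasure \<kappa> W < \<infinity>"
    and A: "A \<subseteq> B" "A \<subseteq> (\<Union>k. Z k)" and Z: "\<And>k. Z k \<in> sets M\<^sub>0"
    and b: "\<And>k. 0 < b k" "\<And>x k. x \<in> A \<Longrightarrow> x \<in> Z k \<Longrightarrow> 0 < P x \<and> P x \<le> b k"
    and K: "\<And>x k. x \<in> A \<Longrightarrow> x \<in> Z k \<Longrightarrow> w x \<le> K k \<and> P x / w x \<le> K k"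
    and sum: "(\<Sum>k. ennreal (b k) * emeasure M\<^sub>0 (Z k)) < \<infinity>"
  shows "\<exists>L. \<forall>\<delta>>0. \<exists>G\<in>borel_measurable borel. controls \<Omega> f \<delta> A G \<and>
    (\<forall>\<eta>>0. 0 \<le> L \<eta> \<and> (\<integral>\<^sup>+x. (G x - ennreal (L \<eta>)) \<partial>m) \<le> ennreal \<eta>)"
proof -
  \<comment> \<open>The cost of a slice after enlarging it to an open set; the geometric term pays
    for the enlargement and keeps the costs summable.\<close>
  define q where "q k = ennreal (b k) * emeasure M\<^sub>0 (Z k) + ennreal ((1 / 2) ^ Suc k)" for k
  have halves: "(\<Sum>k. ennreal ((1 / 2) ^ Suc k)) = ennreal 1"
    by (rule suminf_ennreal_eq[OF _ power_half_series]) auto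
  have "(\<Sum>k. q k) = (\<Sum>k. ennreal (b k) * emeasure M\<^sub>0 (Z k)) + (\<Sum>k. ennreal ((1 / 2) ^ Suc k))"
    unfolding q_def by (rule suminf_add[symmetric]) auto
  then have qfin: "(\<Sum>k. q k) < \<infinity>" using sum halves by simp
  obtain V where V: "emeasure \<kappa> W = ennreal V" "0 \<le> V" using W(3) by (cases "emeasure \<kappa> W") auto
  obtain F where F: "emeasure M\<^sub>0 \<Omega> = ennreal F" "0 \<le> F"
  proof -
    obtain x0 a where "\<Omega> \<subseteq> ball x0 a" using \<Omega>(2) bounded_subset_ballD by blast
    then have "emeasure M\<^sub>0 \<Omega> \<le> emeasure M\<^sub>0 (ball x0 a)" using M0 by (intro emeasure_mono) auto
    also have "\<dots> < \<infinity>" by (rule fin)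
    finally show ?thesis using that by (cases "emeasure M\<^sub>0 \<Omega>") auto
  qed
  define C1 where "C1 = 2 * D * 4 powr Q / c"
  define n where "n = C\<^sub>0\<^sup>2 * 24 powr Q"
  define k5 where "k5 = C\<^sub>0 * 5 powr Q"
  have D: "0 < D" and C1: "0 < C1" and n: "0 < n" and k5: "0 < k5"
    using C0 c by (auto simp: C1_def n_def k5_def)
  \<comment> \<open>\<open>H\<close> bounds the slopes of the retained summands, which are at most 2
    T P / w, and \<open>Y\<close> is the resulting bound for the squared L2 norm. The sum of
    absolute values dominates every single \<open>K k\<close> with \<open>k < N\<close>.\<close>
  define H where "H N T = 2 * T * (\<Sum>k<N. \<bar>K k\<bar>)" for N :: nat and T
  define Y where "Y N T = 8 * (H N T)\<^sup>2 * (D * (\<Sum>k<N. \<bar>K k\<bar>)) * k5 ^ 3 * F" for N T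
  define ok where "ok \<eta> T N L \<longleftrightarrow> 0 < T \<and> 2 * C1 * n * V * T powr (1 - Q) \<le> \<eta> / 4 \<and>
      ennreal (4 * D * T * k5) * (\<Sum>k. q (k + N)) \<le> ennreal (\<eta> / 4) \<and> 0 < L \<and> 1 / L * Y N T \<le> \<eta> / 2"
    for \<eta> T :: real and N and L :: real
  have choice: "\<exists>T N L. ok \<eta> T N L"
    if \<eta>: "0 < \<eta>" for \<eta>
  proof -
    obtain T where T: "0 < T" "2 * C1 * n * V * T powr (1 - Q) \<le> \<eta> / 4"
      using ex_powr_small[of Q "2 * C1 * n * V" "\<eta> / 4"] Q C1 n V \<eta> by auto
    define a where "a = 4 * D * T * k5"
    have a: "0 < a" using D T k5 by (simp add: a_def)
    have "(\<lambda>N. \<Sum>k. q (k + N)) \<longlonglongrightarrow> 0"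
    proof -
      obtain q' where q': "\<And>k. q k = ennreal (q' k)" "\<And>k. 0 \<le> q' k"
      proof -
        have "q k \<noteq> top" for k using qfin by (metis ennreal_suminf_lessD infinity_ennreal_def less_irrefl)
        then show ?thesis by (intro that[of "\<lambda>k. enn2real (q k)"]) (auto simp: top.not_eq_extremum)
      qed
      have sq: "summable q'"
        using qfin q' by (intro summable_suminf_not_top) (auto simp: less_top[symmetric])
      have "(\<Sum>k. q (k + N)) = ennreal (\<Sum>k. q' (k + N))" for N
        unfolding q'(1) using sq q'(2) by (intro suminf_ennreal2) (auto simp: summable_iff_shift)
      moreover have "(\<lambda>N. \<Sum>k. q' (k + N)) \<longlonglongrightarrow> 0" by (rule suminf_exist_split2[OF sq])
      ultimately show ?thesis by (auto intro: tendsto_ennrealI[where x = 0, simplified])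
    qed
    then have "eventually (\<lambda>N. (\<Sum>k. q (k + N)) < ennreal (\<eta> / 4 / a)) sequentially"
      using \<eta> a by (intro order_tendstoD) auto
    then obtain N where N: "(\<Sum>k. q (k + N)) < ennreal (\<eta> / 4 / a)" by (auto simp: eventually_sequentially)
    have "ennreal a * (\<Sum>k. q (k + N)) \<le> ennreal a * ennreal (\<eta> / 4 / a)"
      using N by (intro mult_left_mono) auto
    also have "\<dots> = ennreal (\<eta> / 4)" using a \<eta> by (simp add: ennreal_mult[symmetric])
    finally have N': "ennreal a * (\<Sum>k. q (k + N)) \<le> ennreal (\<eta> / 4)" .
    define L where "L = 2 * (\<bar>Y N T\<bar> + 1) / \<eta>"
    have L: "0 < L" using \<eta> by (auto simp: L_def)
    have "1 / L * Y N T = Y N T * \<eta> / (2 * (\<bar>Y N T\<bar> + 1))" using \<eta> by (simp add: L_def)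
    also have "\<dots> \<le> \<eta> / 2"
    proof -
      have "Y N T * \<eta> \<le> (\<bar>Y N T\<bar> + 1) * \<eta>" using \<eta> by (intro mult_right_mono) auto
      then show ?thesis using \<eta> by (simp add: field_simps)
    qed
    finally have "ok \<eta> T N L" unfolding ok_def using T N' L unfolding a_def by (intro conjI)
    then show ?thesis by blast
  qed
  have "\<forall>\<eta>. \<exists>T N L. 0 < \<eta> \<longrightarrow> ok \<eta> T N L"
    using choice by blast
  then obtain T N L where "\<And>\<eta>. 0 < \<eta> \<Longrightarrow> ok \<eta> (T \<eta>) (N \<eta>) (L \<eta>)" by metis
  note TNL = this[unfolded ok_def]
  \<comment> \<open>The slices may overlap; each point is assigned to one of them.\<close>
  define p where "p x = (SOME k. x \<in> Z k)" for x
  have p: "x \<in> Z (p x)" if "x \<in> A" for x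
  proof -
    have "\<exists>k. x \<in> Z k" using that A(2) by blast
    then show ?thesis unfolding p_def by (rule someI_ex)
  qed
  have "\<exists>U. open U \<and> Z k \<subseteq> U \<and> emeasure M\<^sub>0 (U - Z k) \<le> ennreal ((1 / 2) ^ Suc k / b k)" for k
    by (rule outer[OF Z]) (use b(1)[of k] in auto)
  then obtain U where U: "\<And>k. open (U k)" "\<And>k. Z k \<subseteq> U k"
    "\<And>k. emeasure M\<^sub>0 (U k - Z k) \<le> ennreal ((1 / 2) ^ Suc k / b k)" by metis
  have UM: "U k \<in> sets M\<^sub>0" for k using U(1)[of k] M0 by auto
  have bU: "ennreal (b k) * emeasure M\<^sub>0 (U k) \<le> q k" for k
  proof -
    have "emeasure M\<^sub>0 (U k) \<le> emeasure M\<^sub>0 (Z k \<union> (U k - Z k))"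
      using UM Z by (intro emeasure_mono) auto
    also have "\<dots> \<le> emeasure M\<^sub>0 (Z k) + emeasure M\<^sub>0 (U k - Z k)"
      using UM Z by (intro emeasure_subadditive) auto
    also have "\<dots> \<le> emeasure M\<^sub>0 (Z k) + ennreal ((1 / 2) ^ Suc k / b k)"
      by (intro add_left_mono U)
    finally have "ennreal (b k) * emeasure M\<^sub>0 (U k) \<le>
        ennreal (b k) * (emeasure M\<^sub>0 (Z k) + ennreal ((1 / 2) ^ Suc k / b k))"
      by (intro mult_left_mono) auto
    also have "\<dots> = ennreal (b k) * emeasure M\<^sub>0 (Z k) + ennreal (b k * ((1 / 2) ^ Suc k / b k))"
      using b(1)[of k] by (simp only: distrib_left ennreal_mult'[OF less_imp_le])
    also have "b k * ((1 / 2) ^ Suc k / b k) = (1 / 2) ^ Suc k" using b(1)[of k] by simp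
    finally show ?thesis by (simp only: q_def)
  qed
  show ?thesis
  proof (intro exI[of _ L] allI impI)
    fix \<delta> :: real assume \<delta>: "0 < \<delta>"
    have "\<exists>S r t v. qc_cover Q D C1 (ennreal n * emeasure \<kappa> (W)) \<delta> R\<^sub>0 m \<Omega> f A (\<lambda>x. U (p x) \<inter> \<Omega>) w P S r t v"
      unfolding C1_def n_def
    proof (rule quasiconformal_cover)
      show "0 < w x \<and> 1 \<le> h x \<and> 0 < P x" if "x \<in> A" for x
        using pos[of x] b(2)[OF that p[OF that]] A(1) that by auto
      show "open (U (p x) \<inter> \<Omega>) \<and> x \<in> U (p x) \<inter> \<Omega>" if "x \<in> A" for x
        using U(1,2) p[OF that] A(1) B \<Omega>(1) that by blast
      show "A \<subseteq> \<Omega>" using A(1) B by blast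
      show "\<exists>r1>0. \<forall>r. 0 < r \<and> r < r1 \<longrightarrow> emeasure m (ball x r) \<le> ennreal (2 * w x) * emeasure M\<^sub>0 (ball x r)"
        if "x \<in> A" for x using dens A(1) that by blast
      show "dil_h \<Omega> f x < ennreal (2 * h x)" if "x \<in> A" for x using dil A(1) that by blast
    qed (fact Q C0 R0 c \<delta> low up fin M0 \<kappa> f \<Omega> im W)+
    then obtain S r t v where cov: "qc_cover Q D C1 (ennreal n * emeasure \<kappa> (W)) \<delta> R\<^sub>0 m \<Omega> f A (\<lambda>x. U (p x) \<inter> \<Omega>) w P S r t v"
      by (elim exE)
    note S = qc_coverD(1-3)[OF cov] and r = qc_coverD(4)[OF cov] and t = qc_coverD(5)[OF cov]
      and osc = qc_coverD(6)[OF cov] and disj = qc_coverD(7)[OF cov] and mass = qc_coverD(8)[OF cov]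
      and big = qc_coverD(9)[OF cov] and vsum = qc_coverD(10)[OF cov]
    have SA: "x \<in> A" if "x \<in> S" for x using S that by blast
    let ?b = "\<lambda>x. ball x (r x / 5)" and ?G = "ball_sum S r t"
    have bU': "?b x \<in> sets M\<^sub>0 \<and> ?b x \<subseteq> U (p x)" "?b x \<subseteq> \<Omega>" if "x \<in> S" for x
    proof -
      have "?b x \<subseteq> ball x (r x)" using r[OF that] by (intro subset_ball) auto
      then show "?b x \<in> sets M\<^sub>0 \<and> ?b x \<subseteq> U (p x)" "?b x \<subseteq> \<Omega>" using r[OF that] M0 by auto
    qed
    show "\<exists>G\<in>borel_measurable borel. controls \<Omega> f \<delta> A G \<and>
        (\<forall>\<eta>>0. 0 \<le> L \<eta> \<and> (\<integral>\<^sup>+x. (G x - ennreal (L \<eta>)) \<partial>m) \<le> ennreal \<eta>)"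
    proof (intro bexI[of _ ?G] conjI allI impI)
      show "?G \<in> borel_measurable borel" by (rule ball_sum_measurable[OF S(1)])
      show "controls \<Omega> f \<delta> A ?G"
        using S r t osc by (intro ball_sum_controls) auto
      fix \<eta> :: real assume \<eta>: "0 < \<eta>"
      define T' where "T' = T \<eta>"
      define N' where "N' = N \<eta>"
      define L' where "L' = L \<eta>"
      have T': "0 < T'" "2 * C1 * n * V * T' powr (1 - Q) \<le> \<eta> / 4"
        and N': "ennreal (4 * D * T' * k5) * (\<Sum>k. q (k + N')) \<le> ennreal (\<eta> / 4)"
        and L': "0 < L'" "1 / L' * Y N' T' \<le> \<eta> / 2"
        using TNL[OF \<eta>] by (auto simp: T'_def N'_def L'_def)
      show "0 \<le> L \<eta>" using L'(1) by (simp add: L'_def)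
      \<comment> \<open>The summands on early slices with slope below the threshold. Everything else
        is either on a late slice or steep, and is small in L1.\<close>
      define J where "J = {x \<in> S. p x < N' \<and> t x \<le> 2 * T' * P x / w x}"
      have J: "J \<subseteq> S" "S - J \<subseteq> S" "countable J" "countable (S - J)"
        using S(1) by (auto simp: J_def intro: countable_subset)
      have split: "?G z = ball_sum J r t z + ball_sum (S - J) r t z" for z
      proof -
        let ?g = "\<lambda>x. ennreal (2 * t x) * indicator (ball x (2 * r x)) z"
        have restr: "(\<integral>\<^sup>+x. ?g x * indicator I x \<partial>count_space S) = (\<integral>\<^sup>+x. ?g x \<partial>count_space I)"
          if "I \<subseteq> S" for I
          using that by (subst (1 2) nn_integral_count_space_indicator)
            (auto intro!: nn_integral_cong split: split_indicator)
        have "?G z = (\<integral>\<^sup>+x. ?g x * indicator J x + ?g x * indicator (S - J) x \<partial>count_space S)"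
          unfolding ball_sum_def by (intro nn_integral_cong) (auto split: split_indicator)
        also have "\<dots> = (\<integral>\<^sup>+x. ?g x * indicator J x \<partial>count_space S) + (\<integral>\<^sup>+x. ?g x * indicator (S - J) x \<partial>count_space S)"
          by (rule nn_integral_add) auto
        also have "\<dots> = ball_sum J r t z + ball_sum (S - J) r t z"
          unfolding ball_sum_def restr[OF J(1)] restr[OF J(2)] ..
        finally show ?thesis .
      qed
      have wK: "0 < w x \<and> 0 < P x \<and> w x \<le> K (p x) \<and> P x / w x \<le> K (p x)" if "x \<in> S" for x
        using pos[of x] b(2)[OF SA[OF that] p[OF SA[OF that]]] K[OF SA[OF that] p[OF SA[OF that]]]
          A(1) SA[OF that] by auto
      have Ksum: "K (p x) \<le> (\<Sum>k<N'. \<bar>K k\<bar>)" if "x \<in> J" for x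
        using member_le_sum[of "p x" "{..<N'}" "\<lambda>k. \<bar>K k\<bar>"] that by (auto simp: J_def)
      have sq: "(\<integral>\<^sup>+z. (ball_sum J r t z)\<^sup>2 \<partial>m) \<le> ennreal (Y N' T')"
      proof -
        have "(\<integral>\<^sup>+z. (ball_sum J r t z)\<^sup>2 \<partial>m) \<le>
            ennreal (8 * (H N' T')\<^sup>2 * (D * (\<Sum>k<N'. \<bar>K k\<bar>)) * (C\<^sub>0 * 5 powr Q) ^ 3) * emeasure M\<^sub>0 \<Omega>"
          unfolding ball_sum_def
        proof (rule overlapping_balls_square_integral[OF C0 _ _ J(3) low up M0 m])
          show "0 \<le> H N' T'" using T' by (auto simp: H_def intro!: mult_nonneg_nonneg sum_nonneg)
          show "0 \<le> D * (\<Sum>k<N'. \<bar>K k\<bar>)" using C0 by (intro mult_nonneg_nonneg sum_nonneg) auto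
          show "disjoint_family_on ?b J" using disj J(1) by (rule disjoint_family_on_mono[rotated])
          show "open \<Omega>" by (rule \<Omega>)
          fix x assume x: "x \<in> J"
          then have xS: "x \<in> S" using J by blast
          show "0 < r x \<and> 100 * r x < R\<^sub>0 \<and> ?b x \<subseteq> \<Omega>" using r[OF xS] bU'(2)[OF xS] by simp
          have "t x \<le> 2 * T' * (P x / w x)" using x by (simp add: J_def)
          also have "\<dots> \<le> H N' T'"
            unfolding H_def using wK[OF xS] Ksum[OF x] T' by (intro mult_left_mono) auto
          finally show "t x \<le> H N' T'" .
          have "D * w x * r x powr Q \<le> D * (\<Sum>k<N'. \<bar>K k\<bar>) * r x powr Q"
            using wK[OF xS] Ksum[OF x] C0 by (intro mult_right_mono mult_left_mono) auto
          then show "emeasure m (ball x (2 * r x)) \<le> ennreal (D * (\<Sum>k<N'. \<bar>K k\<bar>) * r x powr Q)"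
            using mass[OF xS] by (meson ennreal_leI order_trans)
        qed
        also have "\<dots> = ennreal (Y N' T')"
          unfolding F Y_def k5_def using F C0
          by (intro ennreal_mult[symmetric] mult_nonneg_nonneg sum_nonneg) auto
        finally show ?thesis .
      qed
      have rest: "(\<integral>\<^sup>+z. ball_sum (S - J) r t z \<partial>m) \<le> ennreal (\<eta> / 2)"
      proof -
        \<comment> \<open>Only late slices contribute a domain part: a summand of
          \<open>S - J\<close> on an early slice is steep and is paid for by its image ball
          alone.\<close>
        define \<theta> where "\<theta> x = (if N' \<le> p x then ennreal (b (p x)) * emeasure M\<^sub>0 (?b x) else 0)" for x
        let ?C = "C1 * T' powr (1 - Q)"
        have C: "0 \<le> ?C" using C1 by simp
        have "ennreal (2 * t x) * emeasure m (ball x (2 * r x)) \<le>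
            ennreal (4 * D * T' * k5) * \<theta> x + ennreal (2 * ?C) * v x" if x: "x \<in> S - J" for x
        proof -
          have xS: "x \<in> S" using x by simp
          have wx: "0 < w x" "0 < P x" "P x \<le> b (p x)"
            using wK[OF xS] b(2)[OF SA[OF xS] p[OF SA[OF xS]]] by auto
          have big': "ennreal (t x) * emeasure m (ball x (2 * r x)) \<le> ennreal ?C * v x"
            if "2 * T' * P x / w x < t x"
            by (rule big[OF xS T'(1) that])
          show ?thesis
          proof (cases "N' \<le> p x")
            case True
            have "ennreal (2 * t x) * emeasure m (ball x (2 * r x)) \<le>
                ennreal (4 * D * T' * P x * r x powr Q) + ennreal (2 * ?C) * v x"
              by (rule two_case_mass_le[OF wx(1) T'(1) wx(2) D _ C t[OF xS] mass[OF xS] big']) auto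
            also have "4 * D * T' * P x * r x powr Q \<le> 4 * D * T' * b (p x) * r x powr Q"
              using C0 T' wx by (intro mult_right_mono mult_left_mono) auto
            then have "ennreal (4 * D * T' * P x * r x powr Q) \<le>
                ennreal (4 * D * T' * b (p x)) * ennreal (r x powr Q)"
              using D T' b(1)[of "p x"] by (simp add: ennreal_mult[symmetric] ennreal_leI)
            also have "\<dots> \<le> ennreal (4 * D * T' * b (p x)) * (ennreal k5 * emeasure M\<^sub>0 (?b x))"
              unfolding k5_def using C0 r[OF xS] by (intro mult_left_mono ahlfors_radius_powr_le low) auto
            also have "\<dots> = (ennreal (4 * D * T' * b (p x)) * ennreal k5) * emeasure M\<^sub>0 (?b x)"
              by (simp only: mult.assoc)
            also have "ennreal (4 * D * T' * b (p x)) * ennreal k5 = ennreal (4 * D * T' * k5) * ennreal (b (p x))"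
              using C0 T'(1) b(1)[of "p x"] k5
              by (subst (1 2) ennreal_mult[symmetric]) (auto simp: mult_ac)
            also have "ennreal (4 * D * T' * k5) * ennreal (b (p x)) * emeasure M\<^sub>0 (?b x) =
                ennreal (4 * D * T' * k5) * \<theta> x"
              using True by (simp only: \<theta>_def if_True mult.assoc)
            finally show ?thesis by (simp add: add_right_mono)
          next
            case False
            then have gt: "2 * T' * P x / w x < t x" using x by (auto simp: J_def)
            have "ennreal (2 * t x) * emeasure m (ball x (2 * r x)) =
                ennreal 2 * (ennreal (t x) * emeasure m (ball x (2 * r x)))"
              using t[OF xS] by (simp add: ennreal_mult mult.assoc)
            also have "\<dots> \<le> ennreal 2 * (ennreal ?C * v x)" by (intro mult_left_mono big' gt) auto
            also have "\<dots> = ennreal (2 * ?C) * v x" using C by (simp only: ennreal_mult mult.assoc zero_le_numeral)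
            finally show ?thesis by (intro add_increasing) auto
          qed
        qed
        then have "(\<integral>\<^sup>+z. ball_sum (S - J) r t z \<partial>m) \<le>
            (\<integral>\<^sup>+x. ennreal (4 * D * T' * k5) * \<theta> x + ennreal (2 * ?C) * v x \<partial>count_space (S - J))"
          unfolding nn_integral_ball_sum[OF J(4)] by (intro nn_integral_mono) auto
        also have "\<dots> \<le> (\<integral>\<^sup>+x. ennreal (4 * D * T' * k5) * \<theta> x + ennreal (2 * ?C) * v x \<partial>count_space S)"
          by (subst (1 2) nn_integral_count_space_indicator)
            (auto intro!: nn_integral_mono split: split_indicator)
        also have "\<dots> = ennreal (4 * D * T' * k5) * (\<integral>\<^sup>+x. \<theta> x \<partial>count_space S) +
            ennreal (2 * ?C) * (\<integral>\<^sup>+x. v x \<partial>count_space S)"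
          by (subst nn_integral_add) (auto simp: nn_integral_cmult)
        also have "(\<integral>\<^sup>+x. \<theta> x \<partial>count_space S) \<le> (\<Sum>k. q (k + N'))"
        proof -
          let ?S = "\<lambda>k. {x \<in> S. p x = k}"
          have "(\<integral>\<^sup>+x. \<theta> x \<partial>count_space S) \<le>
              (\<integral>\<^sup>+x. (\<Sum>k. ennreal (b (k + N')) * emeasure M\<^sub>0 (?b x) * indicator (?S (k + N')) x) \<partial>count_space S)"
          proof (rule nn_integral_mono)
            fix x assume "x \<in> space (count_space S)"
            show "\<theta> x \<le> (\<Sum>k. ennreal (b (k + N')) * emeasure M\<^sub>0 (?b x) * indicator (?S (k + N')) x)"
            proof (cases "N' \<le> p x")
              case True
              have "\<theta> x = (\<Sum>k\<in>{p x - N'}. ennreal (b (k + N')) * emeasure M\<^sub>0 (?b x) * indicator (?S (k + N')) x)"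
                using True \<open>x \<in> space (count_space S)\<close> by (simp add: \<theta>_def)
              also have "\<dots> \<le> (\<Sum>k. ennreal (b (k + N')) * emeasure M\<^sub>0 (?b x) * indicator (?S (k + N')) x)"
                by (rule sum_le_suminf) auto
              finally show ?thesis .
            qed (simp add: \<theta>_def)
          qed
          also have "\<dots> = (\<Sum>k. \<integral>\<^sup>+x. ennreal (b (k + N')) * emeasure M\<^sub>0 (?b x) * indicator (?S (k + N')) x \<partial>count_space S)"
            by (rule nn_integral_suminf) auto
          also have "\<dots> \<le> (\<Sum>k. q (k + N'))"
          proof (intro suminf_le allI)
            fix k
            have "(\<integral>\<^sup>+x. ennreal (b (k + N')) * emeasure M\<^sub>0 (?b x) * indicator (?S (k + N')) x \<partial>count_space S) =
                (\<integral>\<^sup>+x. ennreal (b (k + N')) * emeasure M\<^sub>0 (?b x) \<partial>count_space (?S (k + N')))"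
              by (subst (1 2) nn_integral_count_space_indicator)
                (auto intro!: nn_integral_cong split: split_indicator)
            also have "\<dots> = ennreal (b (k + N')) * (\<integral>\<^sup>+x. emeasure M\<^sub>0 (?b x) \<partial>count_space (?S (k + N')))"
              by (rule nn_integral_cmult) auto
            also have "\<dots> \<le> ennreal (b (k + N')) * emeasure M\<^sub>0 (U (k + N'))"
            proof (intro mult_left_mono nn_integral_count_space_disjoint_le UM)
              show "countable (?S (k + N'))" using S(1) by (rule countable_subset[rotated]) auto
              show "disjoint_family_on ?b (?S (k + N'))"
                using disj by (rule disjoint_family_on_mono[rotated]) auto
              show "?b x \<in> sets M\<^sub>0 \<and> ?b x \<subseteq> U (k + N')" if "x \<in> ?S (k + N')" for x
                using bU'(1)[of x] that by auto
            qed auto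
            also have "\<dots> \<le> q (k + N')" by (rule bU)
            finally show "(\<integral>\<^sup>+x. ennreal (b (k + N')) * emeasure M\<^sub>0 (?b x) * indicator (?S (k + N')) x \<partial>count_space S) \<le>
              q (k + N')" .
          qed auto
          finally show ?thesis .
        qed
        also have "ennreal (4 * D * T' * k5) * (\<Sum>k. q (k + N')) \<le> ennreal (\<eta> / 4)" by (rule N')
        also have "(\<integral>\<^sup>+x. v x \<partial>count_space S) \<le> ennreal n * ennreal V"
          using vsum V by simp
        also have "ennreal (2 * ?C) * (ennreal n * ennreal V) = ennreal (2 * C1 * n * V * T' powr (1 - Q))"
          using C n V C1 by (simp add: ennreal_mult[symmetric] mult_ac)
        also have "\<dots> \<le> ennreal (\<eta> / 4)" using T' by (intro ennreal_leI)
        also have "ennreal (\<eta> / 4) + ennreal (\<eta> / 4) = ennreal (\<eta> / 2)"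
          using \<eta> by (simp add: ennreal_plus[symmetric] del: ennreal_plus)
        finally show ?thesis by (simp add: add_left_mono add_right_mono mult_left_mono)
      qed
      have meas: "ball_sum J r t \<in> borel_measurable m" "ball_sum (S - J) r t \<in> borel_measurable m"
        by (subst measurable_cong_sets[OF m refl], rule ball_sum_measurable, rule J)+
      have "?G z - ennreal L' \<le> ennreal (1 / L') * (ball_sum J r t z)\<^sup>2 + ball_sum (S - J) r t z" for z
      proof -
        let ?a = "ball_sum J r t z" and ?c = "ball_sum (S - J) r t z"
        have "?G z \<le> ennreal L' + (?a - ennreal L') + ?c"
          unfolding split by (intro add_right_mono) (metis ennreal_minus_le_iff order_refl ennreal_neq_top)
        also have "\<dots> \<le> ennreal L' + (ennreal (1 / L') * ?a\<^sup>2 + ?c)"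
          unfolding add.assoc by (intro add_left_mono add_right_mono ennreal_diff_le_square_div L')
        finally show ?thesis by (simp add: ennreal_minus_le_iff)
      qed
      then have "(\<integral>\<^sup>+z. (?G z - ennreal L') \<partial>m) \<le>
          (\<integral>\<^sup>+z. ennreal (1 / L') * (ball_sum J r t z)\<^sup>2 + ball_sum (S - J) r t z \<partial>m)"
        by (intro nn_integral_mono)
      also have "\<dots> = ennreal (1 / L') * (\<integral>\<^sup>+z. (ball_sum J r t z)\<^sup>2 \<partial>m) + (\<integral>\<^sup>+z. ball_sum (S - J) r t z \<partial>m)"
        using meas by (simp add: nn_integral_add nn_integral_cmult)
      also have "\<dots> \<le> ennreal (1 / L') * ennreal (Y N' T') + ennreal (\<eta> / 2)"
        by (intro add_mono mult_left_mono sq rest) auto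
      also have "\<dots> \<le> ennreal (\<eta> / 2) + ennreal (\<eta> / 2)"
      proof (rule add_right_mono)
        have "0 \<le> Y N' T'"
          unfolding Y_def using C0 k5 F by (intro mult_nonneg_nonneg sum_nonneg) auto
        then have "ennreal (1 / L') * ennreal (Y N' T') = ennreal (1 / L' * Y N' T')"
          using L' by (intro ennreal_mult[symmetric]) auto
        also have "\<dots> \<le> ennreal (\<eta> / 2)" by (intro ennreal_leI L')
        finally show "ennreal (1 / L') * ennreal (Y N' T') \<le> ennreal (\<eta> / 2)" .
      qed
      also have "\<dots> = ennreal \<eta>" using \<eta> by (simp add: ennreal_plus[symmetric] del: ennreal_plus)
      finally show "(\<integral>\<^sup>+z. (?G z - ennreal (L \<eta>)) \<partial>m) \<le> ennreal \<eta>" by (simp add: L'_def)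
    qed
  qed
qed

end

section \<open>Weighted Ahlfors regular spaces\<close>

lemma borel_subset_caratheodory:
  assumes "borel_regular_outer_measure \<mu>"
  shows "sets borel \<subseteq> sets (caratheodory_measure \<mu>)" "space (caratheodory_measure \<mu>) = UNIV"
    "A \<in> sets borel \<Longrightarrow> emeasure (caratheodory_measure \<mu>) A = \<mu> A"
proof -
  have om: "outer_measure_space UNIV \<mu>" using assms by (simp add: borel_regular_outer_measure_def)
  show s: "sets borel \<subseteq> sets (caratheodory_measure \<mu>)"
    using assms by (simp add: borel_regular_outer_measure_def sets_caratheodory_measure[OF om])
  show "space (caratheodory_measure \<mu>) = UNIV" using om by simp
  show "emeasure (caratheodory_measure \<mu>) A = \<mu> A" if "A \<in> sets borel"
    using that s by (intro emeasure_caratheodory_measure[OF om]) blast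
qed

text \<open>In a one-point space the diameter is 0 and regularity is vacuous. Two distinct points
  give a positive radius below which the estimates hold everywhere.\<close>

lemma ahlfors_regular_bounds:
  fixes \<mu> :: "'a::metric_space set \<Rightarrow> ennreal"
  assumes reg: "ahlfors_regular Q \<mu>" and \<mu>: "borel_regular_outer_measure \<mu>" and xy: "(x::'a) \<noteq> y"
  shows "\<exists>C R :: real. 1 \<le> C \<and> 0 < R \<and> (\<forall>x r. 0 < r \<and> r < R \<longrightarrow>
    ennreal (r powr Q / C) \<le> emeasure (caratheodory_measure \<mu>) (ball x r) \<and>
    emeasure (caratheodory_measure \<mu>) (ball x r) \<le> ennreal (C * r powr Q))"
proof -
  obtain C where C: "1 \<le> C" "\<And>x r. 0 < r \<Longrightarrow> ennreal r < ediam (UNIV :: 'a set) \<Longrightarrow>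
      ennreal (inverse C * r powr Q) \<le> \<mu> (ball x r) \<and> \<mu> (ball x r) \<le> ennreal (C * r powr Q)"
    using reg unfolding ahlfors_regular_def by blast
  have "ennreal (dist x y) \<le> ediam (UNIV :: 'a set)"
  proof -
    have "ennreal (dist x y) \<le> (SUP y. ennreal (dist x y))"
      by (rule SUP_upper[of y UNIV "\<lambda>y. ennreal (dist x y)"]) simp
    also have "\<dots> \<le> ediam (UNIV :: 'a set)"
      unfolding ediam_def by (rule SUP_upper[of x UNIV "\<lambda>x. SUP y. ennreal (dist x y)"]) simp
    finally show ?thesis .
  qed
  then have small: "ennreal r < ediam (UNIV :: 'a set)" if "0 < r" "r < dist x y" for r
  proof -
    have "ennreal r < ennreal (dist x y)" using that by (simp add: ennreal_less_iff)
    then show ?thesis using \<open>ennreal (dist x y) \<le> _\<close> by (rule less_le_trans)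
  qed
  have em: "emeasure (caratheodory_measure \<mu>) (ball x r) = \<mu> (ball x r)" for x r
    by (rule borel_subset_caratheodory(3)[OF \<mu>]) simp
  show ?thesis
  proof (rule exI[of _ C], rule exI[of _ "dist x y"], intro conjI allI impI)
    show "1 \<le> C" by (rule C)
    show "0 < dist x y" using xy by simp
    fix z and r :: real assume r: "0 < r \<and> r < dist x y"
    have *: "ennreal (inverse C * r powr Q) \<le> \<mu> (ball z r)" "\<mu> (ball z r) \<le> ennreal (C * r powr Q)"
      using C(2)[of r z] small[of r] r by auto
    show "emeasure (caratheodory_measure \<mu>) (ball z r) \<le> ennreal (C * r powr Q)"
      unfolding em by (rule *)
    have "r powr Q / C = inverse C * r powr Q" by (simp add: divide_inverse)
    then show "ennreal (r powr Q / C) \<le> emeasure (caratheodory_measure \<mu>) (ball z r)"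
      unfolding em using *(1) by simp
  qed
qed

text \<open>The weighted measure on the Borel sets alone. Upper gradients are Borel functions, so
  the estimates can be made here and transferred to the Caratheodory measure once, at the
  end.\<close>

definition borel_weighted :: "('a::metric_space set \<Rightarrow> ennreal) \<Rightarrow> ('a \<Rightarrow> ennreal) \<Rightarrow> 'a measure" where
  "borel_weighted \<mu> w = distr (density (caratheodory_measure \<mu>) w) borel (\<lambda>x. x)"

lemma sets_borel_weighted [simp]: "sets (borel_weighted \<mu> w) = sets borel"
  by (simp add: borel_weighted_def)

lemma id_measurable_borel:
  assumes "sets borel \<subseteq> sets M" "space M = UNIV"
  shows "(\<lambda>x. x) \<in> measurable M borel"
  using assms by (auto intro!: measurableI)

lemma emeasure_borel_weighted:
  assumes \<mu>: "borel_regular_outer_measure \<mu>" and w: "weight \<mu> w" and A: "A \<in> sets borel"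
  shows "emeasure (borel_weighted \<mu> w) A = (\<integral>\<^sup>+x\<in>A. w x \<partial>caratheodory_measure \<mu>)"
    "emeasure (borel_weighted \<mu> w) A = weighted_measure \<mu> w A"
proof -
  note b = borel_subset_caratheodory[OF \<mu>]
  let ?D = "density (caratheodory_measure \<mu>) w"
  have AM: "A \<in> sets ?D" using A b(1) by auto
  have "(\<lambda>x. x) \<in> measurable ?D borel" using b by (intro id_measurable_borel) auto
  then have *: "emeasure (borel_weighted \<mu> w) A = emeasure ?D A"
    using A by (simp add: borel_weighted_def emeasure_distr b(2))
  show "emeasure (borel_weighted \<mu> w) A = weighted_measure \<mu> w A"
    unfolding weighted_measure_def * using AM by simp
  show "emeasure (borel_weighted \<mu> w) A = (\<integral>\<^sup>+x\<in>A. w x \<partial>caratheodory_measure \<mu>)"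
    unfolding * using AM w by (intro emeasure_density) (auto simp: weight_def)
qed

text \<open>The integral of a Borel function depends only on the measures of Borel sets, and there
  the density, its outer measure and the Caratheodory measure of the latter agree.\<close>

lemma L1_on_weighted_borelI:
  assumes \<mu>: "borel_regular_outer_measure \<mu>" and w: "weight \<mu> w"
    and H: "H \<in> sets borel" and g: "g \<in> borel_measurable borel"
    and fin: "(\<integral>\<^sup>+x\<in>H. g x \<partial>borel_weighted \<mu> w) < \<infinity>"
  shows "L1_on (weighted_measure \<mu> w) H g"
proof -
  let ?\<mu> = "weighted_measure \<mu> w" and ?D = "density (caratheodory_measure \<mu>) w"
  let ?C = "caratheodory_measure ?\<mu>"
  note b = borel_subset_caratheodory[OF \<mu>]
  have spD: "space ?D = UNIV" using b by simp
  have om: "outer_measure_space UNIV ?\<mu>"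
    unfolding weighted_measure_def by (rule outer_measure_space_outer_measure_of[OF spD])
  have sD: "sets ?D \<subseteq> sets ?C"
    using sets_subset_lambda_system_outer_measure_of[OF spD]
    unfolding sets_caratheodory_measure[OF om] unfolding weighted_measure_def .
  then have sb: "sets borel \<subseteq> sets ?C" using b(1) by auto
  have id: "(\<lambda>x. x) \<in> measurable ?C borel" using sb om by (intro id_measurable_borel) auto
  have eq: "distr ?C borel (\<lambda>x. x) = borel_weighted \<mu> w"
  proof (rule measure_eqI)
    fix A assume "A \<in> sets (distr ?C borel (\<lambda>x. x))"
    then have A: "A \<in> sets borel" by simp
    have "emeasure (distr ?C borel (\<lambda>x. x)) A = emeasure ?C A"
      using A id om by (simp add: emeasure_distr)
    also have "\<dots> = ?\<mu> A" using A sb by (intro emeasure_caratheodory_measure[OF om]) auto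
    also have "\<dots> = emeasure (borel_weighted \<mu> w) A" by (rule emeasure_borel_weighted(2)[OF \<mu> w A, symmetric])
    finally show "emeasure (distr ?C borel (\<lambda>x. x)) A = emeasure (borel_weighted \<mu> w) A" .
  qed simp
  have gH: "(\<lambda>x. g x * indicator H x) \<in> borel_measurable borel" using g H by measurable
  have "(\<integral>\<^sup>+x\<in>H. g x \<partial>?C) = (\<integral>\<^sup>+x\<in>H. g x \<partial>distr ?C borel (\<lambda>x. x))"
    using gH id by (subst nn_integral_distr) auto
  also have "\<dots> < \<infinity>" unfolding eq by (rule fin)
  finally have 1: "(\<integral>\<^sup>+x\<in>H. g x \<partial>?C) < \<infinity>" .
  have "g \<in> borel_measurable ?C" using measurable_compose[OF id g] by simp
  then have "g \<in> borel_measurable (restrict_space ?C H)" by (rule measurable_restrict_space1)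
  with 1 show ?thesis by (simp add: L1_on_def)
qed

lemma constant_curves_dirichlet:
  assumes "\<And>\<gamma> l. arc_length_curve \<Omega> \<gamma> l \<Longrightarrow> f (\<gamma> 0) = f (\<gamma> l)"
  shows "f \<in> dirichlet_space \<mu> \<Omega>"
proof -
  have "upper_gradient \<Omega> f (\<lambda>_. 0)" using assms by (auto simp: upper_gradient_def)
  moreover have "L1_on \<mu> \<Omega> (\<lambda>_. 0)" by (simp add: L1_on_def)
  ultimately show ?thesis unfolding dirichlet_space_def by blast
qed

section \<open>Pointwise densities of the weighted measures\<close>

lemma ennreal_divide_mult_cancel: "b \<noteq> 0 \<Longrightarrow> b \<noteq> top \<Longrightarrow> a / b * b = (a :: ennreal)"
  by (metis ennreal_mult_divide_eq ennreal_times_divide mult.commute)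

lemma eventually_at_right_0D:
  assumes "eventually P (at_right (0::real))"
  shows "\<exists>d>0. \<forall>r. 0 < r \<longrightarrow> r < d \<longrightarrow> P r"
  using assms by (auto simp: eventually_at_right_field)

lemma average_mult_measure:
  fixes \<mu> :: "'a::metric_space set \<Rightarrow> ennreal"
  assumes \<mu>: "borel_regular_outer_measure \<mu>" and w: "weight \<mu> w" and fin: "finite_on_balls \<mu>"
    and pos: "0 < \<mu> (ball x r)"
  shows "average \<mu> w x r * emeasure (caratheodory_measure \<mu>) (ball x r) =
    emeasure (borel_weighted \<mu> w) (ball x r)"
proof -
  have ne: "\<mu> (ball x r) \<noteq> 0" "\<mu> (ball x r) \<noteq> top"
    using pos fin by (auto simp: finite_on_balls_def less_top[symmetric])
  have "emeasure (caratheodory_measure \<mu>) (ball x r) = \<mu> (ball x r)"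
    by (rule borel_subset_caratheodory(3)[OF \<mu>]) simp
  then show ?thesis
    by (simp add: average_def ennreal_divide_mult_cancel[OF ne] emeasure_borel_weighted(1)[OF \<mu> w])
qed

text \<open>The representative by upper limits yields a density bound at every single point. This
  matters because every point of the complement of \<open>E\<close> may become the centre of a
  ball.\<close>

lemma average_less_imp_measure_le:
  fixes \<mu> :: "'a::metric_space set \<Rightarrow> ennreal"
  assumes \<mu>: "borel_regular_outer_measure \<mu>" and w: "weight \<mu> w" and fin: "finite_on_balls \<mu>"
    and lim: "Limsup (at_right 0) (average \<mu> w x) < ennreal a"
    and pos: "0 < R" "\<And>r. 0 < r \<Longrightarrow> r < R \<Longrightarrow> 0 < \<mu> (ball x r)"
  shows "\<exists>d>0. \<forall>r. 0 < r \<and> r < d \<longrightarrow>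
    emeasure (borel_weighted \<mu> w) (ball x r) \<le> ennreal a * emeasure (caratheodory_measure \<mu>) (ball x r)"
proof -
  obtain d where d: "0 < d" "\<And>r. 0 < r \<Longrightarrow> r < d \<Longrightarrow> average \<mu> w x r < ennreal a"
    using eventually_at_right_0D[OF Limsup_lessD[OF lim]] by blast
  show ?thesis
  proof (intro exI[of _ "min d R"] conjI allI impI)
    show "0 < min d R" using d pos by simp
    fix r assume r: "0 < r \<and> r < min d R"
    then have "0 < \<mu> (ball x r)" using pos(2) by simp
    then show "emeasure (borel_weighted \<mu> w) (ball x r) \<le>
        ennreal a * emeasure (caratheodory_measure \<mu>) (ball x r)"
      using d(2)[of r] r by (subst average_mult_measure[OF \<mu> w fin, symmetric]) (auto intro: mult_right_mono)
  qed
qed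

text \<open>Lower limits play the same part in the target, where the bound is needed at each image
  point \<open>f x\<close>; an almost everywhere statement would not do, as \<open>f\<close> may
  carry large sets into null sets.\<close>

lemma less_average_imp_measure_ge:
  fixes \<mu> :: "'a::metric_space set \<Rightarrow> ennreal"
  assumes \<mu>: "borel_regular_outer_measure \<mu>" and w: "weight \<mu> w" and fin: "finite_on_balls \<mu>"
    and lim: "a < Liminf (at_right 0) (average \<mu> w x)"
    and pos: "0 < R" "\<And>r. 0 < r \<Longrightarrow> r < R \<Longrightarrow> 0 < \<mu> (ball x r)"
  shows "\<exists>d>0. \<forall>r. 0 < r \<and> r < d \<longrightarrow>
    a * emeasure (caratheodory_measure \<mu>) (ball x r) \<le> emeasure (borel_weighted \<mu> w) (ball x r)"
proof -
  obtain d where d: "0 < d" "\<And>r. 0 < r \<Longrightarrow> r < d \<Longrightarrow> a < average \<mu> w x r"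
    using eventually_at_right_0D[OF less_LiminfD[OF lim]] by blast
  show ?thesis
  proof (intro exI[of _ "min d R"] conjI allI impI)
    show "0 < min d R" using d pos by simp
    fix r assume r: "0 < r \<and> r < min d R"
    then have "0 < \<mu> (ball x r)" using pos(2) by simp
    then show "a * emeasure (caratheodory_measure \<mu>) (ball x r) \<le>
        emeasure (borel_weighted \<mu> w) (ball x r)"
      using d(2)[of r] r by (subst average_mult_measure[OF \<mu> w fin, symmetric]) (auto intro: mult_right_mono)
  qed
qed

text \<open>The inequality along a curve is affine in the integrand. The common error term
  \<open>s\<close> reproduces itself under averaging, being the mean of \<open>s\<close> and
  \<open>s\<close>.\<close>

lemma midpoint_closure_curve_le:
  assumes \<gamma>: "arc_length_curve \<Omega> \<gamma> l" and h: "h \<in> midpoint_closure \<F>" and s: "s \<in> borel_measurable borel"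
    and \<F>: "\<And>g. g \<in> \<F> \<Longrightarrow> g \<in> borel_measurable borel"
    and le: "\<And>g. g \<in> \<F> \<Longrightarrow> a \<le> (\<integral>\<^sup>+u\<in>{0..l}. (g (\<gamma> u) + s (\<gamma> u)) \<partial>lborel)"
  shows "h \<in> borel_measurable borel \<and> a \<le> (\<integral>\<^sup>+u\<in>{0..l}. (h (\<gamma> u) + s (\<gamma> u)) \<partial>lborel)"
  using h
proof induction
  case (base g)
  then show ?case using \<F> le by blast
next
  case (mid g h)
  have [measurable]: "g \<in> borel_measurable borel" "h \<in> borel_measurable borel" using mid by auto
  have eq: "(g x + h x) / 2 + s x = ((g x + s x) + (h x + s x)) / 2" for x
  proof -
    have "(g x + h x) / 2 + s x = (g x + h x) / 2 + (s x / 2 + s x / 2)"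
      by (simp only: ennreal_half_add_half)
    also have "\<dots> = ((g x + s x) + (h x + s x)) / 2"
      by (simp only: add_divide_distrib_ennreal ac_simps)
    finally show ?thesis .
  qed
  let ?I = "\<lambda>k. \<integral>\<^sup>+u\<in>{0..l}. (k (\<gamma> u) + s (\<gamma> u)) \<partial>lborel"
  have meas: "(\<lambda>u. (k (\<gamma> u) + s (\<gamma> u)) * indicator {0..l} u) \<in> borel_measurable lborel"
    if "k \<in> borel_measurable borel" for k
    by (rule borel_measurable_comp_arc_length_curve[OF \<gamma>, of "\<lambda>x. k x + s x"])
       (intro borel_measurable_add that s)
  have "a \<le> (?I g + ?I h) / 2" using mid by (intro ennreal_le_midpoint) auto
  also have "\<dots> = (\<integral>\<^sup>+u. ((g (\<gamma> u) + s (\<gamma> u)) * indicator {0..l} u +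
      (h (\<gamma> u) + s (\<gamma> u)) * indicator {0..l} u) / 2 \<partial>lborel)"
    by (rule nn_integral_midpoint[symmetric, OF meas meas]) fact+
  also have "\<dots> = ?I (\<lambda>x. (g x + h x) / 2)"
    unfolding eq by (intro nn_integral_cong) (auto split: split_indicator)
  finally show ?case by simp
qed

text \<open>Image balls stick out of the image of \<Omega>, so the image budget has to be the
  measure of an open set around it. The set \<open>S\<close> may fail to be measurable: a hull for
  the density is followed by a Borel hull, and outer regularity gives the open set.\<close>

lemma finite_open_superset:
  fixes \<nu> :: "'b::metric_space set \<Rightarrow> ennreal"
  assumes \<nu>: "borel_regular_outer_measure \<nu>" and fin: "finite_on_balls \<nu>" and w: "weight \<nu> w"
    and finw: "finite_on_balls (weighted_measure \<nu> w)" and S: "weighted_measure \<nu> w S < \<infinity>"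
  shows "\<exists>W. open W \<and> S \<subseteq> W \<and> emeasure (borel_weighted \<nu> w) W < \<infinity>"
proof -
  let ?N = "caratheodory_measure \<nu>" and ?\<kappa> = "borel_weighted \<nu> w"
  let ?D = "density ?N w"
  note b = borel_subset_caratheodory[OF \<nu>]
  have wm: "w \<in> borel_measurable ?N" using w by (simp add: weight_def)
  have spD: "space ?D = UNIV" by (simp add: b(2))
  obtain E where E: "E \<in> sets ?D" "S \<subseteq> E" "outer_measure_of ?D S = emeasure ?D E"
    using outer_measure_of_attain[of S ?D] spD by auto
  then have EN: "E \<in> sets ?N" by simp
  obtain H where H: "H \<in> sets borel" "E \<subseteq> H" "emeasure ?N (H - E) = 0"
    using borel_hull_null[OF \<nu> fin EN] by blast
  have HN: "H \<in> sets ?N" using H(1) b(1) by blast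
  have HE: "H - E \<in> null_sets ?N" using H(3) HN EN by (auto simp: null_sets_def)
  have "emeasure ?D (H - E) = (\<integral>\<^sup>+x\<in>(H - E). w x \<partial>?N)"
    using wm HE by (intro emeasure_density) auto
  also have "\<dots> = 0" using HE by (rule nn_integral_null_set)
  finally have 0: "emeasure ?D (H - E) = 0" .
  have "emeasure ?\<kappa> H = emeasure ?D H"
    unfolding emeasure_borel_weighted(2)[OF \<nu> w H(1)] weighted_measure_def using HN by simp
  also have "\<dots> \<le> emeasure ?D (E \<union> (H - E))" using HN EN by (intro emeasure_mono) auto
  also have "\<dots> \<le> emeasure ?D E + emeasure ?D (H - E)" using HN EN by (intro emeasure_subadditive) auto
  also have "\<dots> < \<infinity>" using S E(3) unfolding 0 by (simp add: weighted_measure_def)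
  finally have fH: "emeasure ?\<kappa> H < \<infinity>" .
  obtain W where W: "open W" "H \<subseteq> W" "emeasure ?\<kappa> (W - H) \<le> ennreal 1"
  proof (rule open_superset_measure_le[of ?\<kappa> H 1])
    show "emeasure ?\<kappa> (ball x r) < \<infinity>" for x r
      using finw by (subst emeasure_borel_weighted(2)[OF \<nu> w]) (auto simp: finite_on_balls_def)
    show "space ?\<kappa> = UNIV" by (simp add: borel_weighted_def)
    show "\<exists>B\<in>sets borel. H \<subseteq> B \<and> emeasure ?\<kappa> (B - H) = 0" using H(1) by (intro bexI[of _ H]) auto
  qed (use H in auto)
  have "emeasure ?\<kappa> W \<le> emeasure ?\<kappa> (H \<union> (W - H))" using H(1) W(1) by (intro emeasure_mono) auto
  also have "\<dots> \<le> emeasure ?\<kappa> H + emeasure ?\<kappa> (W - H)" using H(1) W(1) by (intro emeasure_subadditive) auto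
  also have "\<dots> \<le> emeasure ?\<kappa> H + ennreal 1" by (intro add_left_mono W)
  also have "\<dots> < \<infinity>" using fH by simp
  finally show ?thesis using W E(2) H(2) by blast
qed

text \<open>Solving the definition of \<open>F\<close> for \<open>y\<close> gives y = a^Q / F^(Q-1).
  Replacing \<open>F\<close> by F + 1 makes the inequality strict and includes F = 0, which occurs
  for infinite \<open>y\<close>; the value y = 0 would make \<open>F\<close> infinite.\<close>

lemma weight_quotient_threshold:
  fixes Q a :: real and y F :: ennreal
  assumes Q: "1 < Q" and a: "0 < a"
    and F: "F = ennreal_powr (ennreal_powr (ennreal a) Q / y) (1 / (Q - 1))" "F \<noteq> \<infinity>"
  shows "ennreal (a powr Q / (enn2real F + 1) powr (Q - 1)) < y"
proof -
  have aQ: "ennreal_powr (ennreal a) Q = ennreal (a powr Q)" using a by (simp add: ennreal_powr_def)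
  show ?thesis
  proof (cases y)
    case top
    then show ?thesis by (simp add: ennreal_less_top)
  next
    case (real b)
    have "y \<noteq> 0"
    proof
      assume "y = 0"
      then have "F = \<infinity>" using a unfolding F(1) aQ by (simp add: ennreal_powr_def ennreal_divide_zero)
      then show False using F(2) by simp
    qed
    then have b: "0 < b" using real by (cases "b = 0") auto
    have "F = ennreal ((a powr Q / b) powr (1 / (Q - 1)))"
      unfolding F(1) aQ using a b real by (simp add: divide_ennreal ennreal_powr_def)
    then have "enn2real F + 1 > (a powr Q / b) powr (1 / (Q - 1))" by simp
    then have "(enn2real F + 1) powr (Q - 1) > ((a powr Q / b) powr (1 / (Q - 1))) powr (Q - 1)"
      using Q by (intro powr_less_mono2) auto
    also have "((a powr Q / b) powr (1 / (Q - 1))) powr (Q - 1) = a powr Q / b"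
      using Q a b by (simp add: powr_powr)
    finally have *: "a powr Q / b < (enn2real F + 1) powr (Q - 1)" .
    have "0 < enn2real F + 1" using enn2real_nonneg[of F] by linarith
    then have "a powr Q / (enn2real F + 1) powr (Q - 1) < b"
      using * b by (simp add: field_simps)
    then show ?thesis using real b by (simp add: ennreal_less_iff)
  qed
qed

lemma suminf_level_sets:
  fixes p :: "'a \<Rightarrow> nat" and b :: "nat \<Rightarrow> real"
  assumes p: "p \<in> measurable M (count_space UNIV)" and \<Omega>: "\<Omega> \<in> sets M" and sp: "space M = UNIV"
  shows "{x \<in> \<Omega>. p x = k} \<in> sets M"
    "(\<Sum>k. ennreal (b k) * emeasure M {x \<in> \<Omega>. p x = k}) = (\<integral>\<^sup>+x\<in>\<Omega>. ennreal (b (p x)) \<partial>M)"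
proof -
  show s: "{x \<in> \<Omega>. p x = k} \<in> sets M" for k
  proof -
    have "p -` {k} \<inter> space M \<in> sets M" using p by (rule measurable_sets) simp
    then have "\<Omega> \<inter> (p -` {k} \<inter> space M) \<in> sets M" by (rule sets.Int[OF \<Omega>])
    also have "\<Omega> \<inter> (p -` {k} \<inter> space M) = {x \<in> \<Omega>. p x = k}" by (auto simp: sp)
    finally show ?thesis .
  qed
  define S where "S k = {x \<in> \<Omega>. p x = k}" for k
  have [measurable]: "S k \<in> sets M" for k using s by (simp add: S_def)
  have "(\<Sum>k. ennreal (b k) * emeasure M (S k)) = (\<Sum>k. \<integral>\<^sup>+x. ennreal (b k) * indicator (S k) x \<partial>M)"
    by (intro suminf_cong nn_integral_cmult_indicator[symmetric]) simp
  also have "\<dots> = (\<integral>\<^sup>+x. (\<Sum>k. ennreal (b k) * indicator (S k) x) \<partial>M)"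
    by (rule nn_integral_suminf[symmetric]) simp
  also have "\<dots> = (\<integral>\<^sup>+x\<in>\<Omega>. ennreal (b (p x)) \<partial>M)"
  proof (rule nn_integral_cong)
    fix x
    have eq: "ennreal (b k) * indicator (S k) x = (if k = p x then ennreal (b k) * indicator \<Omega> x else 0)" for k
      by (cases "k = p x"; cases "x \<in> \<Omega>") (simp_all add: S_def)
    have "(\<lambda>k. if k = p x then ennreal (b k) * indicator \<Omega> x else 0) sums (ennreal (b (p x)) * indicator \<Omega> x)"
      by (rule sums_single)
    then show "(\<Sum>k. ennreal (b k) * indicator (S k) x) = ennreal (b (p x)) * indicator \<Omega> x"
      unfolding eq by (rule sums_unique[symmetric])
  qed
  finally show "(\<Sum>k. ennreal (b k) * emeasure M {x \<in> \<Omega>. p x = k}) = (\<integral>\<^sup>+x\<in>\<Omega>. ennreal (b (p x)) \<partial>M)"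
    by (simp only: S_def)
qed

section \<open>From controls at all scales to an upper gradient\<close>

lemma sigma_finite_codim1_controls:
  fixes M :: "'a::metric_space measure" and f :: "'a \<Rightarrow> 'b::metric_space"
  assumes M: "sets M = sets borel" "\<And>c r. emeasure M (ball c r) \<le> \<mu> (ball c r)"
    and S: "sigma_finite_codim1 \<mu> S" "S \<subseteq> \<Omega>" and f: "continuous_on \<Omega> f"
    and \<delta>: "0 < \<delta>" and e: "0 < (e::real)"
  shows "\<exists>G\<in>borel_measurable borel. controls \<Omega> f \<delta> S G \<and> (\<integral>\<^sup>+x. G x \<partial>M) \<le> ennreal e"
proof -
  obtain T :: "nat \<Rightarrow> 'a set" where T: "S = (\<Union>n. T n)" "\<And>n. codim1_hausdorff \<mu> (T n) < \<infinity>"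
    using S(1) unfolding sigma_finite_codim1_def by blast
  show ?thesis
  proof (rule controls_UN_small[OF M(1) e])
    show "S \<subseteq> (\<Union>n. T n)" using T(1) by simp
    fix n and e' :: real assume "0 < e'"
    show "\<exists>G\<in>borel_measurable borel. controls \<Omega> f \<delta> (T n) G \<and> (\<integral>\<^sup>+x. G x \<partial>M) \<le> ennreal e'"
      by (rule codim1_small_controls[OF M T(2) _ f \<delta> \<open>0 < e'\<close>]) (use T(1) S(2) in blast)
  qed
qed

text \<open>The sum \<open>s\<close> of all error functions dominates each of them, so the upper
  gradient is the majorant of the \<open>G i\<close> plus \<open>s\<close>. A given curve is
  controlled only at scales fine compared with its diameter, hence only by the members of some tail;
  this is why the majorant must dominate a combination from every tail.\<close>

lemma dirichlet_space_of_controls: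
  fixes M :: "'a::metric_space measure" and f :: "'a \<Rightarrow> 'b::metric_space"
  assumes M: "finite_measure M" "sets M = sets borel" and f: "continuous_on \<Omega> f"
    and G: "\<And>i. G i \<in> borel_measurable borel" and H: "\<And>i. H i \<in> borel_measurable borel"
    and c: "\<And>i. controls \<Omega> f (inverse (real (Suc i))) \<Omega> (\<lambda>x. G i x + H i x)"
    and ui: "\<And>\<eta>::real. 0 < \<eta> \<Longrightarrow> \<exists>c::real. 0 \<le> c \<and> (\<forall>i. (\<integral>\<^sup>+x. (G i x - ennreal c) \<partial>M) \<le> ennreal \<eta>)"
    and small: "(\<Sum>i. \<integral>\<^sup>+x. H i x \<partial>M) < \<infinity>"
  shows "\<exists>g\<in>borel_measurable borel. upper_gradient \<Omega> f g \<and> (\<integral>\<^sup>+x. g x \<partial>M) < \<infinity>"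
proof -
  have mM: "borel_measurable M = (borel_measurable borel :: ('a \<Rightarrow> ennreal) set)"
    by (rule measurable_cong_sets[OF M(2) refl])
  have "\<exists>g. g \<in> borel_measurable M \<and> (\<integral>\<^sup>+x. g x \<partial>M) < \<infinity> \<and>
      (\<forall>n. \<exists>h\<in>midpoint_closure (G ` {n..}). \<forall>x. h x \<le> g x)"
  proof (rule uniformly_integrable_majorant[OF M(1), of G])
    show "G i \<in> borel_measurable M" for i unfolding mM by (rule G)
    show "\<exists>c\<ge>0. \<forall>i. (\<integral>\<^sup>+x. (G i x - ennreal c) \<partial>M) \<le> ennreal \<eta>" if "0 < \<eta>" for \<eta>
      using ui[OF that] .
  qed blast
  then obtain g where g: "g \<in> borel_measurable borel" "(\<integral>\<^sup>+x. g x \<partial>M) < \<infinity>"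
    "\<And>n. \<exists>h\<in>midpoint_closure (G ` {n..}). \<forall>x. h x \<le> g x" unfolding mM by blast
  define s where "s x = (\<Sum>i. H i x)" for x
  have s: "s \<in> borel_measurable borel" unfolding s_def[abs_def] using H by measurable
  have "(\<integral>\<^sup>+x. s x \<partial>M) = (\<Sum>i. \<integral>\<^sup>+x. H i x \<partial>M)"
    unfolding s_def by (rule nn_integral_suminf) (simp add: mM H)
  then have sfin: "(\<integral>\<^sup>+x. s x \<partial>M) < \<infinity>" using small by simp
  have Hs: "H i x \<le> s x" for i x
    using sum_le_suminf[of "\<lambda>i. H i x" "{i}"] by (simp add: s_def)
  have "ennreal (dist (f (\<gamma> 0)) (f (\<gamma> l))) \<le> (\<integral>\<^sup>+u\<in>{0..l}. (g (\<gamma> u) + s (\<gamma> u)) \<partial>lborel)"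
    if \<gamma>: "arc_length_curve \<Omega> \<gamma> l" for \<gamma> l
  proof (cases "l = 0")
    case True
    then show ?thesis by simp
  next
    case False
    then have "0 < l" using \<gamma> by (simp add: arc_length_curve_def)
    from arc_length_curve_nonconstant[OF \<gamma> this]
    obtain a b where ab: "a \<in> {0..l}" "b \<in> {0..l}" "\<gamma> a \<noteq> \<gamma> b" by blast
    then have "0 < dist (\<gamma> a) (\<gamma> b) / 4" by simp
    then obtain n where n: "inverse (real (Suc n)) < dist (\<gamma> a) (\<gamma> b) / 4"
      using reals_Archimedean by blast
    have Gs: "ennreal (dist (f (\<gamma> 0)) (f (\<gamma> l))) \<le> (\<integral>\<^sup>+u\<in>{0..l}. (k (\<gamma> u) + s (\<gamma> u)) \<partial>lborel)"
      if k: "k \<in> G ` {n..}" for k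
    proof -
      obtain i where i: "n \<le> i" "k = G i" using k by auto
      have "inverse (real (Suc i)) \<le> inverse (real (Suc n))" using i by (intro le_imp_inverse_le) auto
      then have far: "4 * inverse (real (Suc i)) \<le> dist (\<gamma> a) (\<gamma> b)" using n by linarith
      have "controls \<Omega> f (inverse (real (Suc i))) \<Omega> (\<lambda>x. G i x + s x)"
        by (rule controls_mono[OF c]) (auto intro: add_left_mono Hs)
      from controls_dist_le[OF this f \<gamma> ab(1,2) far] show ?thesis unfolding i .
    qed
    obtain h where h: "h \<in> midpoint_closure (G ` {n..})" "\<And>x. h x \<le> g x" using g(3)[of n] by blast
    have "ennreal (dist (f (\<gamma> 0)) (f (\<gamma> l))) \<le> (\<integral>\<^sup>+u\<in>{0..l}. (h (\<gamma> u) + s (\<gamma> u)) \<partial>lborel)"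
      using midpoint_closure_curve_le[OF \<gamma> h(1) s _ Gs] G by blast
    also have "\<dots> \<le> (\<integral>\<^sup>+u\<in>{0..l}. (g (\<gamma> u) + s (\<gamma> u)) \<partial>lborel)"
      using h(2) by (intro nn_integral_mono mult_right_mono add_right_mono) auto
    finally show ?thesis .
  qed
  moreover have gs: "(\<lambda>x. g x + s x) \<in> borel_measurable borel" using g(1) s by measurable
  ultimately have "upper_gradient \<Omega> f (\<lambda>x. g x + s x)"
    unfolding upper_gradient_def using measurable_restrict_space1[OF gs] by blast
  moreover have "(\<integral>\<^sup>+x. g x + s x \<partial>M) < \<infinity>"
    using g(2) sfin by (subst nn_integral_add) (auto simp: mM g(1) s)
  ultimately show ?thesis using gs by blast
qed

theorem corollary1p7:
  fixes Q :: real
    and \<mu>\<^sub>0 \<mu> :: "'a::metric_space set \<Rightarrow> ennreal"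
    and \<nu>\<^sub>0 \<nu> :: "'b::metric_space set \<Rightarrow> ennreal"
    and w :: "'a \<Rightarrow> ennreal" and w\<^sub>Y :: "'b \<Rightarrow> ennreal"
    and \<Omega> E :: "'a set" and f :: "'a \<Rightarrow> 'b"
  assumes "Q > 1"
    and "borel_regular_outer_measure \<mu>\<^sub>0" "finite_on_balls \<mu>\<^sub>0" "ahlfors_regular Q \<mu>\<^sub>0"
    and "borel_regular_outer_measure \<nu>\<^sub>0" "finite_on_balls \<nu>\<^sub>0" "ahlfors_regular Q \<nu>\<^sub>0"
    and "weight \<mu>\<^sub>0 w" "\<mu> = weighted_measure \<mu>\<^sub>0 w" "finite_on_balls \<mu>"
    and "weight \<nu>\<^sub>0 w\<^sub>Y" "\<nu> = weighted_measure \<nu>\<^sub>0 w\<^sub>Y" "finite_on_balls \<nu>"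
    and "\<forall>x. w x = Limsup (at_right 0) (average \<mu>\<^sub>0 w x)"
    and "\<forall>y. w\<^sub>Y y = Liminf (at_right 0) (average \<nu>\<^sub>0 w\<^sub>Y y)"
    and "open \<Omega>" "bounded \<Omega>"
    and "inj_on f \<Omega>" "continuous_on \<Omega> f"
    and "\<nu> (f ` \<Omega>) < \<infinity>"
    and "E \<subseteq> \<Omega>"
    and "\<exists>E\<^sub>1 E\<^sub>2. E = E\<^sub>1 \<union> E\<^sub>2 \<and> countable E\<^sub>1 \<and> sigma_finite_codim1 \<mu> E\<^sub>2"
    and "\<forall>x\<in>\<Omega> - E. dil_h \<Omega> f x < \<infinity>"
    and "\<forall>x\<in>\<Omega> - E. 0 < w x \<and> w x < \<infinity>"
    and "\<forall>x\<in>\<Omega> - E. \<exists>r>0. \<exists>c>0. \<forall>y\<in>ball x r \<inter> (\<Omega> - E). c \<le> w y"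
    and "L1_on \<mu>\<^sub>0 \<Omega>
           (\<lambda>x. ennreal_powr
                  (ennreal_powr (w x * max (dil_h \<Omega> f x) 1) Q / w\<^sub>Y (f x)) (1 / (Q - 1)))"
  shows "f \<in> dirichlet_space \<mu> \<Omega>"
proof (cases "(\<exists>x y :: 'a. x \<noteq> y) \<and> (\<exists>x y :: 'b. x \<noteq> y)")
  case False
  \<comment> \<open>If either space is a single point, \<open>f\<close> has equal values at the ends
    of every curve.\<close>
  then have "f (\<gamma> 0) = f (\<gamma> l)" for \<gamma> :: "real \<Rightarrow> 'a" and l by metis
  then show ?thesis by (rule constant_curves_dirichlet)
next
  case True
  then obtain x1 x2 :: 'a and y1 y2 :: 'b where neq: "x1 \<noteq> x2" "y1 \<noteq> y2" by blast
  note Q = assms(1) and \<mu>0 = assms(2) and fin\<mu>0 = assms(3) and \<nu>0 = assms(5) and fin\<nu>0 = assms(6)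
    and w = assms(8) and \<mu> = assms(9) and wY = assms(11) and \<nu> = assms(12)
    and wlim = assms(14) and wYlim = assms(15) and \<Omega> = assms(16,17) and f = assms(19)
    and \<nu>f = assms(20) and E = assms(21) and E12 = assms(22) and hfin = assms(23) and wpos = assms(24)
  let ?M0 = "caratheodory_measure \<mu>\<^sub>0" and ?N0 = "caratheodory_measure \<nu>\<^sub>0"
  define m where "m = borel_weighted \<mu>\<^sub>0 w"
  define \<kappa> where "\<kappa> = borel_weighted \<nu>\<^sub>0 w\<^sub>Y"
  note bM = borel_subset_caratheodory[OF \<mu>0] and bN = borel_subset_caratheodory[OF \<nu>0]
  have sm: "sets m = sets borel" and s\<kappa>: "sets \<kappa> = sets borel" by (simp_all add: m_def \<kappa>_def)
  have m\<mu>: "emeasure m A = \<mu> A" if "A \<in> sets borel" for A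
    unfolding m_def \<mu> by (rule emeasure_borel_weighted(2)[OF \<mu>0 w that])
  have fin\<mu>: "\<mu> (ball x r) < \<infinity>" for x r using assms(10) by (simp add: finite_on_balls_def)
  obtain C R :: real where C: "1 \<le> C" and R: "0 < R"
    and CR: "\<forall>x r. 0 < r \<and> r < R \<longrightarrow> ennreal (r powr Q / C) \<le> emeasure ?M0 (ball x r) \<and>
      emeasure ?M0 (ball x r) \<le> ennreal (C * r powr Q)"
    using ahlfors_regular_bounds[OF assms(4) \<mu>0 neq(1)] by (elim exE conjE)
  obtain C' R' :: real where C': "1 \<le> C'" and R': "0 < R'"
    and CR': "\<forall>x r. 0 < r \<and> r < R' \<longrightarrow> ennreal (r powr Q / C') \<le> emeasure ?N0 (ball x r) \<and>
      emeasure ?N0 (ball x r) \<le> ennreal (C' * r powr Q)"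
    using ahlfors_regular_bounds[OF assms(7) \<nu>0 neq(2)] by (elim exE conjE)
  have posM: "0 < \<mu>\<^sub>0 (ball x r)" if "0 < r" "r < R" for x r
  proof -
    have "0 < ennreal (r powr Q / C)" using that C by simp
    also have "\<dots> \<le> emeasure ?M0 (ball x r)" using CR that by blast
    finally show ?thesis by (simp add: bM(3))
  qed
  have posN: "0 < \<nu>\<^sub>0 (ball x r)" if "0 < r" "r < R'" for x r
  proof -
    have "0 < ennreal (r powr Q / C')" using that C' by simp
    also have "\<dots> \<le> emeasure ?N0 (ball x r)" using CR' that by blast
    finally show ?thesis by (simp add: bN(3))
  qed
  define B where "B = \<Omega> - E"
  define wr where "wr x = enn2real (w x)" for x
  define h where "h x = max (enn2real (dil_h \<Omega> f x)) 1" for x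
  have wr: "w x = ennreal (wr x)" "0 < wr x" if "x \<in> B" for x
  proof -
    have *: "0 < w x" "w x < \<infinity>" using wpos that by (auto simp: B_def)
    then show "w x = ennreal (wr x)" by (simp add: wr_def)
    then show "0 < wr x" using * by simp
  qed
  have dilr: "dil_h \<Omega> f x = ennreal (enn2real (dil_h \<Omega> f x))" if "x \<in> B" for x
    using hfin that by (simp add: B_def)
  have setting: "quasiconformal_setting Q C R ?M0 m \<Omega> B f wr h"
  proof
    show "1 < Q" "1 \<le> C" "0 < R" "continuous_on \<Omega> f" "open \<Omega>" "bounded \<Omega>" by fact+
    show "ennreal (r powr Q / C) \<le> emeasure ?M0 (ball x r)" if "0 < r" "r < R" for x r
      using CR that by blast
    show "emeasure ?M0 (ball x r) \<le> ennreal (C * r powr Q)" if "0 < r" "r < R" for x r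
      using CR that by blast
    show finM: "emeasure ?M0 (ball x r) < \<infinity>" for x r
      using fin\<mu>0 by (simp add: bM(3) finite_on_balls_def)
    show "sets borel \<subseteq> sets ?M0" by (rule bM)
    show "sets m = sets borel" by fact
    show "B \<subseteq> \<Omega>" by (auto simp: B_def)
    show "0 < wr x \<and> 1 \<le> h x" if "x \<in> B" for x using wr[OF that] by (simp add: h_def)
    show "\<exists>U. open U \<and> A \<subseteq> U \<and> emeasure ?M0 (U - A) \<le> ennreal e" if "A \<in> sets ?M0" "0 < e" for A and e :: real
      by (rule open_superset_measure_le[OF bM(1,2) finM that(1) borel_hull_null[OF \<mu>0 fin\<mu>0 that(1)] that(2)]) blast
    show "\<exists>r1>0. \<forall>r. 0 < r \<and> r < r1 \<longrightarrow> emeasure m (ball x r) \<le> ennreal (2 * wr x) * emeasure ?M0 (ball x r)"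
      if "x \<in> B" for x
      unfolding m_def
    proof (rule average_less_imp_measure_le[OF \<mu>0 w fin\<mu>0 _ R posM])
      have "Limsup (at_right 0) (average \<mu>\<^sub>0 w x) = ennreal (wr x)" using wlim wr[OF that] by simp
      also have "\<dots> < ennreal (2 * wr x)" using wr[OF that] by (simp add: ennreal_less_iff)
      finally show "Limsup (at_right 0) (average \<mu>\<^sub>0 w x) < ennreal (2 * wr x)" .
    qed
    show "dil_h \<Omega> f x < ennreal (2 * h x)" if "x \<in> B" for x
      by (subst dilr[OF that]) (auto simp: h_def ennreal_less_iff max_def)
  qed
  interpret quasiconformal_setting Q C R ?M0 m \<Omega> B f wr h by (rule setting)
  define F where "F x = ennreal_powr (ennreal_powr (w x * max (dil_h \<Omega> f x) 1) Q / w\<^sub>Y (f x)) (1 / (Q - 1))" for x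
  define F' where "F' x = F x * indicator \<Omega> x" for x
  have \<Omega>M: "\<Omega> \<in> sets ?M0" using \<Omega>(1) bM(1) by auto
  have L1F: "F \<in> borel_measurable (restrict_space ?M0 \<Omega>)" "(\<integral>\<^sup>+x. F' x \<partial>?M0) < \<infinity>"
    using assms(26) unfolding L1_on_def F_def[abs_def] F'_def by auto
  have F'm [measurable]: "F' \<in> borel_measurable ?M0"
    using L1F(1) \<Omega>M unfolding F'_def[abs_def]
    by (subst (asm) borel_measurable_restrict_space_iff_ennreal) (auto simp: mult.commute)
  have wm [measurable]: "w \<in> borel_measurable ?M0" using w by (simp add: weight_def)
  define N where "N = {x \<in> B. F x = \<infinity>}"
  define A where "A = {x \<in> B. F x \<noteq> \<infinity>}"
  \<comment> \<open>\<open>N\<close> may fail to be measurable, since \<open>E\<close> is arbitrary.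
    \<open>Z\<close> is a measurable null set containing it.\<close>
  define Z where "Z = F' -` {\<infinity>} \<inter> space ?M0"
  have Z: "Z \<in> sets ?M0" unfolding Z_def by measurable
  have Z0: "emeasure ?M0 Z = 0"
    unfolding Z_def using L1F(2) by (intro nn_integral_PInf) auto
  have NZ: "N \<subseteq> B" "N \<subseteq> Z"
    using bM(2) by (auto simp: N_def Z_def F'_def B_def)
  have fin\<Omega>: "emeasure ?M0 \<Omega> < \<infinity>" "emeasure m \<Omega> < \<infinity>"
  proof -
    obtain x0 a where a: "\<Omega> \<subseteq> ball x0 a" using \<Omega>(2) bounded_subset_ballD by blast
    have "emeasure ?M0 \<Omega> \<le> emeasure ?M0 (ball x0 a)" using a bM(1) by (intro emeasure_mono) auto
    also have "\<dots> < \<infinity>" by (rule fin)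
    finally show "emeasure ?M0 \<Omega> < \<infinity>" .
    have "emeasure m \<Omega> \<le> emeasure m (ball x0 a)" using a sm by (intro emeasure_mono) auto
    also have "\<dots> < \<infinity>" using fin\<mu> by (simp add: m\<mu>)
    finally show "emeasure m \<Omega> < \<infinity>" .
  qed
  \<comment> \<open>Adding 1 keeps \<open>P\<close> positive and strictly above the integrand; on
    the bounded set \<Omega> the extra 1 has finite integral.\<close>
  define P where "P x = enn2real (F x) + 1" for x
  obtain W where W: "open W" "f ` \<Omega> \<subseteq> W" "emeasure \<kappa> W < \<infinity>"
    using finite_open_superset[OF \<nu>0 fin\<nu>0 wY _ \<nu>f[unfolded \<nu>]] assms(13) unfolding \<nu> \<kappa>_def by blast
  have im: "\<exists>s1>0. \<forall>s. 0 < s \<and> s < s1 \<longrightarrow>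
      ennreal (1 / C' * (wr x * h x) powr Q / P x powr (Q - 1) * s powr Q) \<le> emeasure \<kappa> (ball (f x) s)"
    if x: "x \<in> A" for x
  proof -
    have xB: "x \<in> B" and Fx: "F x \<noteq> \<infinity>" using x by (auto simp: A_def)
    have wh: "0 < wr x * h x" using wr(2)[OF xB] by (auto simp: h_def intro!: mult_pos_pos)
    have "max (dil_h \<Omega> f x) 1 = ennreal (h x)"
      by (subst dilr[OF xB]) (simp add: h_def max_def ennreal_le_1 flip: ennreal_1)
    then have "w x * max (dil_h \<Omega> f x) 1 = ennreal (wr x * h x)"
      using wr[OF xB] by (simp add: ennreal_mult h_def)
    then have "F x = ennreal_powr (ennreal_powr (ennreal (wr x * h x)) Q / w\<^sub>Y (f x)) (1 / (Q - 1))"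
      by (simp add: F_def)
    from weight_quotient_threshold[OF Q wh this Fx]
    have lt: "ennreal ((wr x * h x) powr Q / P x powr (Q - 1)) < w\<^sub>Y (f x)" by (simp add: P_def)
    define \<tau> where "\<tau> = (wr x * h x) powr Q / P x powr (Q - 1)"
    have "\<exists>d>0. \<forall>r. 0 < r \<and> r < d \<longrightarrow> ennreal \<tau> * emeasure ?N0 (ball (f x) r) \<le> emeasure \<kappa> (ball (f x) r)"
      unfolding \<kappa>_def
      by (rule less_average_imp_measure_ge[OF \<nu>0 wY fin\<nu>0 _ R' posN]) (use lt wYlim in \<open>simp_all add: \<tau>_def\<close>)
    then obtain d where d: "0 < d" "\<And>r. 0 < r \<Longrightarrow> r < d \<Longrightarrow>
        ennreal \<tau> * emeasure ?N0 (ball (f x) r) \<le> emeasure \<kappa> (ball (f x) r)" by blast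
    show ?thesis
    proof (intro exI[of _ "min d R'"] conjI allI impI)
      show "0 < min d R'" using d R' by simp
      fix s assume s: "0 < s \<and> s < min d R'"
      have "1 / C' * (wr x * h x) powr Q / P x powr (Q - 1) * s powr Q = \<tau> * (s powr Q / C')"
        by (simp add: \<tau>_def)
      moreover have "0 \<le> \<tau>" by (simp add: \<tau>_def)
      ultimately have "ennreal (1 / C' * (wr x * h x) powr Q / P x powr (Q - 1) * s powr Q) =
          ennreal \<tau> * ennreal (s powr Q / C')" using C' by (simp only: ennreal_mult'[symmetric])
      also have "\<dots> \<le> ennreal \<tau> * emeasure ?N0 (ball (f x) s)"
        using CR' s by (intro mult_left_mono) auto
      also have "\<dots> \<le> emeasure \<kappa> (ball (f x) s)" using d(2)[of s] s by simp
      finally show "ennreal (1 / C' * (wr x * h x) powr Q / P x powr (Q - 1) * s powr Q) \<le>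
          emeasure \<kappa> (ball (f x) s)" .
    qed
  qed
  \<comment> \<open>Each slice fixes the integer part of the integrand and an integer bound for w +
    1 / w. The first gives \<open>b\<close>, where F + 1 < \<open>p1\<close> + 2 explains the 2, and
    makes the sum over slices comparable with the integral; the second bounds \<open>w\<close> and P
    / w. Pairing the two numbers yields one countable index.\<close>
  define p1 where "p1 x = nat \<lfloor>enn2real (F' x)\<rfloor>" for x
  define p2 where "p2 x = nat \<lceil>enn2real (w x) + 1 / enn2real (w x)\<rceil>" for x
  define p where "p x = prod_encode (p1 x, p2 x)" for x
  define b where "b k = real (fst (prod_decode k)) + 2" for k
  define K where "K k = b k * real (snd (prod_decode k))" for k
  define T where "T k = {x \<in> \<Omega>. p x = k}" for k
  have pm: "p \<in> measurable ?M0 (count_space UNIV)"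
  proof -
    have [measurable]: "p1 \<in> measurable ?M0 (count_space UNIV)" "p2 \<in> measurable ?M0 (count_space UNIV)"
      unfolding p1_def[abs_def] p2_def[abs_def] by measurable
    show ?thesis unfolding p_def[abs_def] by measurable
  qed
  have bp: "b (p x) = real (p1 x) + 2" "K (p x) = (real (p1 x) + 2) * real (p2 x)" for x
    by (simp_all add: b_def K_def p_def)
  have TM: "T k \<in> sets ?M0" for k
    unfolding T_def by (rule suminf_level_sets(1)[OF pm \<Omega>M bM(2)])
  have "(\<Sum>k. ennreal (b k) * emeasure ?M0 (T k)) = (\<integral>\<^sup>+x\<in>\<Omega>. ennreal (b (p x)) \<partial>?M0)"
    unfolding T_def by (rule suminf_level_sets(2)[OF pm \<Omega>M bM(2)])
  also have "\<dots> \<le> (\<integral>\<^sup>+x. F' x + 2 * indicator \<Omega> x \<partial>?M0)"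
  proof (rule nn_integral_mono)
    fix x
    have "real (p1 x) \<le> enn2real (F' x)" unfolding p1_def by (simp add: of_nat_floor)
    then have "ennreal (real (p1 x)) \<le> ennreal (enn2real (F' x))" by (rule ennreal_leI)
    also have "\<dots> \<le> F' x" by (cases "F' x") auto
    finally have "ennreal (b (p x)) \<le> F' x + 2"
      unfolding bp by (simp add: ennreal_plus add_right_mono)
    then show "ennreal (b (p x)) * indicator \<Omega> x \<le> F' x + 2 * indicator \<Omega> x"
      by (auto split: split_indicator)
  qed
  also have "\<dots> = (\<integral>\<^sup>+x. F' x \<partial>?M0) + 2 * emeasure ?M0 \<Omega>"
    using \<Omega>M by (subst nn_integral_add) (auto simp: nn_integral_cmult_indicator)
  also have "\<dots> < \<infinity>" using L1F(2) fin\<Omega> by (simp add: ennreal_mult_less_top)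
  finally have bsum: "(\<Sum>k. ennreal (b k) * emeasure ?M0 (T k)) < \<infinity>" .
  have AB: "A \<subseteq> B" by (auto simp: A_def)
  have AO: "x \<in> \<Omega>" if "x \<in> A" for x using that by (auto simp: A_def B_def)
  have bP: "0 < P x \<and> P x \<le> b (p x)" "wr x \<le> K (p x) \<and> P x / wr x \<le> K (p x)" if x: "x \<in> A" for x
  proof -
    have F'x: "F' x = F x" using AO[OF x] by (simp add: F'_def)
    have "enn2real (F x) < real (p1 x) + 1"
      unfolding p1_def F'x using enn2real_nonneg[of "F x"] by linarith
    then have P: "P x \<le> b (p x)" by (simp add: P_def bp)
    have P0: "0 < P x" using enn2real_nonneg[of "F x"] unfolding P_def by linarith
    have w0: "0 < wr x" using wr(2) x AB by blast
    have "wr x + 1 / wr x \<le> real (p2 x)"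
      unfolding p2_def wr_def by (rule real_nat_ceiling_ge)
    moreover have "0 < 1 / wr x" using w0 by simp
    ultimately have p2: "wr x \<le> real (p2 x)" "1 / wr x \<le> real (p2 x)" using w0 by linarith+
    have "1 * real (p2 x) \<le> K (p x)" unfolding bp by (intro mult_right_mono) auto
    moreover have "P x * (1 / wr x) \<le> b (p x) * real (p2 x)"
      using P P0 p2 w0 by (intro mult_mono) auto
    ultimately show "wr x \<le> K (p x) \<and> P x / wr x \<le> K (p x)"
      using p2(1) by (simp add: bp)
    show "0 < P x \<and> P x \<le> b (p x)" using P P0 by simp
  qed
  have "\<exists>L. \<forall>\<delta>>0. \<exists>G\<in>borel_measurable borel. controls \<Omega> f \<delta> A G \<and>
    (\<forall>\<eta>>0. 0 \<le> L \<eta> \<and> (\<integral>\<^sup>+x. (G x - ennreal (L \<eta>)) \<partial>m) \<le> ennreal \<eta>)"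
  proof (rule uniformly_integrable_controls[where \<kappa> = \<kappa> and c = "1 / C'" and P = P and W = W and Z = T and b = b and K = K])
    show "sets borel \<subseteq> sets \<kappa>" by (simp add: s\<kappa>)
    show "0 < 1 / C'" using C' by simp
    show "f ` A \<subseteq> W" using W(2) AO by blast
    show "A \<subseteq> (\<Union>k. T k)" using AO by (auto simp: T_def)
    show "0 < b k" for k by (simp add: b_def)
    show "0 < P x \<and> P x \<le> b k" if "x \<in> A" "x \<in> T k" for x k
      using bP(1)[OF that(1)] that(2) by (simp add: T_def)
    show "wr x \<le> K k \<and> P x / wr x \<le> K k" if "x \<in> A" "x \<in> T k" for x k
      using bP(2)[OF that(1)] that(2) by (simp add: T_def)
  qed (fact im W AB TM bsum)+
  \<comment> \<open>A single \<open>L\<close> for all scales: this is the uniform integrability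
    asked for by the majorant theorem.\<close>
  then obtain L where L: "\<And>\<delta>. 0 < \<delta> \<Longrightarrow> \<exists>G\<in>borel_measurable borel. controls \<Omega> f \<delta> A G \<and>
    (\<forall>\<eta>>0. 0 \<le> L \<eta> \<and> (\<integral>\<^sup>+x. (G x - ennreal (L \<eta>)) \<partial>m) \<le> ennreal \<eta>)" by blast
  have "\<exists>G\<in>borel_measurable borel. controls \<Omega> f (inverse (real (Suc i))) A G \<and>
    (\<forall>\<eta>>0. 0 \<le> L \<eta> \<and> (\<integral>\<^sup>+x. (G x - ennreal (L \<eta>)) \<partial>m) \<le> ennreal \<eta>)" for i
    by (rule L) simp
  then obtain G where G: "\<And>i. G i \<in> borel_measurable borel"
    "\<And>i. controls \<Omega> f (inverse (real (Suc i))) A (G i)"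
    and GL: "\<And>i \<eta>. 0 < \<eta> \<Longrightarrow> 0 \<le> L \<eta> \<and> (\<integral>\<^sup>+x. (G i x - ennreal (L \<eta>)) \<partial>m) \<le> ennreal \<eta>"
    by metis
  \<comment> \<open>Only \<Omega> matters, and it has finite measure, as the majorant theorem
    demands.\<close>
  define M where "M = density m (indicator \<Omega>)"
  have sM: "sets M = sets borel" by (simp add: M_def sm)
  have \<Omega>m: "\<Omega> \<in> sets m" using \<Omega>(1) sm by simp
  have nnM: "(\<integral>\<^sup>+x. g x \<partial>M) = (\<integral>\<^sup>+x\<in>\<Omega>. g x \<partial>m)" if "g \<in> borel_measurable borel" for g
  proof -
    have "g \<in> borel_measurable m" by (subst measurable_cong_sets[OF sm refl]) (rule that)
    then show ?thesis unfolding M_def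
      using \<Omega>m by (subst nn_integral_density) (auto simp: mult.commute)
  qed
  have nnMm: "(\<integral>\<^sup>+x. g x \<partial>M) \<le> (\<integral>\<^sup>+x. g x \<partial>m)" if "g \<in> borel_measurable borel" for g
    unfolding nnM[OF that] by (intro nn_integral_mono) (auto split: split_indicator)
  have Mle: "emeasure M S \<le> \<mu> S" if "S \<in> sets borel" for S
    using nnMm[of "indicator S"] that by (simp add: sM sm m\<mu>)
  have spM: "space M = UNIV" by (simp add: M_def m_def borel_weighted_def)
  have finM: "finite_measure M"
  proof (rule finite_measureI)
    have "emeasure M (space M) = (\<integral>\<^sup>+x. 1 \<partial>M)" by simp
    also have "\<dots> = (\<integral>\<^sup>+x. 1 * indicator \<Omega> x \<partial>m)" by (rule nnM) simp
    also have "\<dots> = emeasure m \<Omega>" using \<Omega>m by simp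
    finally show "emeasure M (space M) \<noteq> \<infinity>" using fin\<Omega>(2) by simp
  qed
  obtain E1 E2 where E12': "E = E1 \<union> E2" "countable E1" "sigma_finite_codim1 \<mu> E2"
    using E12 by blast
  \<comment> \<open>The budgets for the null set and for \<open>E2\<close> are halved from scale to
    scale, while \<open>E1\<close> costs nothing, so the errors of all scales add up to one
    integrable function.\<close>
  have "\<exists>H\<in>borel_measurable borel. controls \<Omega> f (inverse (real (Suc i))) (N \<union> (E1 \<union> E2)) H \<and>
      (\<integral>\<^sup>+x. H x \<partial>M) \<le> ennreal (2 * (1 / 2) ^ Suc i)" for i
  proof -
    let ?\<delta> = "inverse (real (Suc i))" and ?e = "(1 / 2 :: real) ^ Suc i"
    have \<delta>: "0 < ?\<delta>" and e: "0 < ?e" by simp_all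
    obtain H1 where H1: "H1 \<in> borel_measurable borel" "controls \<Omega> f ?\<delta> N H1" "(\<integral>\<^sup>+x. H1 x \<partial>m) \<le> ennreal ?e"
    proof -
      have "\<exists>G\<in>borel_measurable borel. controls \<Omega> f ?\<delta> N G \<and> (\<integral>\<^sup>+x. G x \<partial>m) \<le> ennreal ?e"
      proof (rule null_set_controls[OF bN(1) _ R' _ _ NZ Z Z0 \<delta> e, of "1 / C'"])
        show "0 < 1 / C'" using C' by simp
        show "ennreal (1 / C' * s powr Q) \<le> emeasure ?N0 (ball y s)" if "0 < s" "s < R'" for y s
          using CR' that by simp
        show "emeasure ?N0 (ball y s) < \<infinity>" for y s
          using fin\<nu>0 by (simp add: bN(3) finite_on_balls_def)
      qed
      then show thesis using that by blast
    qed
    obtain H2 where H2: "H2 \<in> borel_measurable borel" "controls \<Omega> f ?\<delta> E2 H2" "(\<integral>\<^sup>+x. H2 x \<partial>M) \<le> ennreal ?e"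
    proof -
      have "\<exists>G\<in>borel_measurable borel. controls \<Omega> f ?\<delta> E2 G \<and> (\<integral>\<^sup>+x. G x \<partial>M) \<le> ennreal ?e"
      proof (rule sigma_finite_codim1_controls[OF sM _ E12'(3) _ f \<delta> e])
        show "emeasure M (ball c r) \<le> \<mu> (ball c r)" for c r by (rule Mle) simp
        show "E2 \<subseteq> \<Omega>" using E E12'(1) by blast
      qed
      then show thesis using that by blast
    qed
    have "controls \<Omega> f ?\<delta> (N \<union> (E1 \<union> E2)) (\<lambda>x. H1 x + (0 + H2 x))"
      by (intro controls_Un controls_countable H1 H2 E12' borel_measurable_const borel_measurable_add)
    moreover have "(\<integral>\<^sup>+x. H1 x + (0 + H2 x) \<partial>M) \<le> ennreal (2 * ?e)"
    proof -
      have "(\<integral>\<^sup>+x. H1 x + (0 + H2 x) \<partial>M) = (\<integral>\<^sup>+x. H1 x \<partial>M) + (\<integral>\<^sup>+x. H2 x \<partial>M)"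
        using H1(1) H2(1) by (subst nn_integral_add) (simp_all add: measurable_cong_sets[OF sM refl])
      also have "\<dots> \<le> ennreal ?e + ennreal ?e"
        using nnMm[OF H1(1)] H1(3) H2(3) by (intro add_mono) auto
      also have "\<dots> = ennreal (?e + ?e)" using e by (intro ennreal_plus[symmetric]) auto
      finally show ?thesis by simp
    qed
    moreover have "(\<lambda>x. H1 x + (0 + H2 x)) \<in> borel_measurable borel" using H1(1) H2(1) by measurable
    ultimately show ?thesis by blast
  qed
  then obtain H where H: "\<And>i. H i \<in> borel_measurable borel"
    "\<And>i. controls \<Omega> f (inverse (real (Suc i))) (N \<union> (E1 \<union> E2)) (H i)"
    "\<And>i. (\<integral>\<^sup>+x. H i x \<partial>M) \<le> ennreal (2 * (1 / 2) ^ Suc i)" by metis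
  have "\<exists>g\<in>borel_measurable borel. upper_gradient \<Omega> f g \<and> (\<integral>\<^sup>+x. g x \<partial>M) < \<infinity>"
  proof (rule dirichlet_space_of_controls[OF finM sM f G(1) H(1)])
    fix i
    have "controls \<Omega> f (inverse (real (Suc i))) (A \<union> (N \<union> (E1 \<union> E2))) (\<lambda>x. G i x + H i x)"
      by (intro controls_Un G H)
    then show "controls \<Omega> f (inverse (real (Suc i))) \<Omega> (\<lambda>x. G i x + H i x)"
    proof (rule controls_mono)
      show "\<Omega> \<inter> \<Omega> \<subseteq> A \<union> (N \<union> (E1 \<union> E2))" using E12'(1) by (auto simp: A_def N_def B_def)
    qed simp_all
  next
    fix \<eta> :: real assume \<eta>: "0 < \<eta>"
    have "(\<integral>\<^sup>+x. (G i x - ennreal (L \<eta>)) \<partial>M) \<le> ennreal \<eta>" for i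
    proof -
      have "(\<lambda>x. G i x - ennreal (L \<eta>)) \<in> borel_measurable borel" using G(1) by measurable
      from nnMm[OF this] show ?thesis using GL[OF \<eta>, of i] by (blast intro: order_trans)
    qed
    then show "\<exists>c\<ge>0. \<forall>i. (\<integral>\<^sup>+x. (G i x - ennreal c) \<partial>M) \<le> ennreal \<eta>"
      using GL[OF \<eta>] by blast
  next
    have "(\<Sum>i. \<integral>\<^sup>+x. H i x \<partial>M) \<le> (\<Sum>i. ennreal (2 * (1 / 2) ^ Suc i))"
      using H(3) by (intro suminf_le) auto
    also have "\<dots> = ennreal 2"
      using sums_mult[OF power_half_series, of 2]
      by (intro suminf_ennreal_eq) (auto simp del: power_Suc)
    also have "\<dots> < \<infinity>" by simp
    finally show "(\<Sum>i. \<integral>\<^sup>+x. H i x \<partial>M) < \<infinity>" .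
  qed
  then obtain g where g: "g \<in> borel_measurable borel" "upper_gradient \<Omega> f g" "(\<integral>\<^sup>+x. g x \<partial>M) < \<infinity>"
    by blast
  have "L1_on (weighted_measure \<mu>\<^sub>0 w) \<Omega> g"
    by (rule L1_on_weighted_borelI[OF \<mu>0 w _ g(1)]) (use \<Omega>(1) g(3) nnM[OF g(1)] in \<open>simp_all add: m_def\<close>)
  then show ?thesis using g(2) unfolding \<mu> dirichlet_space_def by blast
qed

end
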